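(* Let $u$ be a blow-up (non-global) solution of $\partial_t^2u=\partial_x^2u+e^u$ with initial data $(u_0,u_1)\in W^{1,\infty}(\mathbb R)\times L^\infty(\mathbb R)$, with maximal domain of definition $D=\{(x,t): 0\le t<T(x)\}$, and let $\mathcal R$ be its set of non-characteristic points. Then, for all $R>0$ and for any $a\in\mathcal R$ such that $(a,T(a))\in D_R$: (i) (Uniform bounds on $w$) For all $s\ge-\log T(a)+1$ and all $|y|<1$, $$|w_a(y,s)|+\int_{-1}^1\left((\partial_sw_a(y,s))^2+(\partial_yw_a(y,s))^2\right)dy\le C(R).$$ (ii) (Uniform bounds on $u$) For all $t\in[0,T(a))$ and all $x\in I(a,t)$, $$|u(x,t)+2\log(T(a)-t)|+(T(a)-t)\int_{I(a,t)}\left((\partial_xu(x,t))^2+(\partial_tu(x,t))^2\right)dx\le C(R).$$ In particular, $$\frac1{C(R)}\le e^{u(x,t)}(T(a)-t)^2\le C(R).$$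
   Context: For $x\in\mathbb R$, $t>0$, $\delta>0$, let $\mathcal C_{x,t,\delta}=\{(\xi,\tau)\ne(x,t): 0\le\tau\le t-\delta|\xi-x|\}$. A solution on $\mathcal C_{x_0,t_0,1}$ is a function $u$ with $(u,\partial_tu)\in C([0,t_0),H^1\times L^2(|x-x_0|<t_0-t))$ satisfying Duhamel's formula $u(x,t)=\frac12(u_0(x-t)+u_0(x+t))+\frac12\int_{x-t}^{x+t}u_1+\frac12\int_0^t\int_{x-t+\tau}^{x+t-\tau}e^{u(z,\tau)}dz\,d\tau$. The maximal domain of definition $D$ is the set of $(x,t)$, $t\ge0$, such that the solution exists on $\mathcal C_{x,t',1}$ for some $t'>t$. The solution is a blow-up solution if it is not global, i.e. $D\ne\mathbb R\times[0,\infty)$; then $D=\{(x,t):0\le t<T(x)\}$ for a 1-Lipschitz function $T:\mathbb R\to(0,\infty)$. A point $x_0\in\mathbb R$ is non-characteristic if there is $\delta_0=\delta_0(x_0)\in(0,1)$ such that $u$ is defined on $\mathcal C_{x_0,T(x_0),\delta_0}$ (i.e. this cone is contained in $D$); $\mathcal R$ is the set of such points. $D_R=\{(x,t)\in\mathbb R\times\mathbb R_+: |x|<R-t\}$; $I(a,t)=(a-(T(a)-t),a+(T(a)-t))$. Similarity variables: $w_a(y,s)=u(x,t)+2\log(T(a)-t)$, with $y=\frac{x-a}{T(a)-t}$, $s=-\log(T(a)-t)$. $C(R)$ denotes positive constants, possibly different at each occurrence, depending only on $R$ and on the initial data. *)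

theory Defs
  imports "HOL-Analysis.Analysis"
begin

text \<open>
  Functions of space and time take the space variable first.  Elements of \<open>L\<^sup>2\<close>,
  \<open>L\<^sup>\<infinity>\<close> and so on are represented by honest functions on \<open>\<real>\<close>, measurability and
  integrals being with respect to Lebesgue measure.
\<close>

section \<open>Lebesgue and Sobolev spaces on the line\<close>

definition Linf :: "(real \<Rightarrow> real) \<Rightarrow> bool" where
  "Linf f \<longleftrightarrow> f \<in> borel_measurable lebesgue \<and> (\<exists>M. AE x in lebesgue. \<bar>f x\<bar> \<le> M)"

definition L2_on :: "real set \<Rightarrow> (real \<Rightarrow> real) \<Rightarrow> bool" where
  "L2_on J f \<longleftrightarrow> set_borel_measurable lebesgue J f \<and> set_integrable lebesgue J (\<lambda>x. (f x)\<^sup>2)"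

definition L2_norm_on :: "real set \<Rightarrow> (real \<Rightarrow> real) \<Rightarrow> real" where
  "L2_norm_on J f = sqrt (LINT x:J|lebesgue. (f x)\<^sup>2)"

definition loc_integrable_on :: "real set \<Rightarrow> (real \<Rightarrow> real) \<Rightarrow> bool" where
  "loc_integrable_on J f \<longleftrightarrow> (\<forall>K. compact K \<and> K \<subseteq> J \<longrightarrow> set_integrable lebesgue K f)"

text \<open>Test functions: \<open>C\<^sup>1\<close> with compact support in the open set \<open>J\<close>.\<close>

definition test_function :: "real set \<Rightarrow> (real \<Rightarrow> real) \<Rightarrow> bool" where
  "test_function J \<phi> \<longleftrightarrow> \<phi> C1_differentiable_on UNIV \<and>
     compact (closure {x. \<phi> x \<noteq> 0}) \<and> closure {x. \<phi> x \<noteq> 0} \<subseteq> J"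

definition has_weak_deriv :: "real set \<Rightarrow> (real \<Rightarrow> real) \<Rightarrow> (real \<Rightarrow> real) \<Rightarrow> bool" where
  "has_weak_deriv J f g \<longleftrightarrow> loc_integrable_on J f \<and> loc_integrable_on J g \<and>
     (\<forall>\<phi>. test_function J \<phi> \<longrightarrow>
        (LINT x:J|lebesgue. f x * deriv \<phi> x) = - (LINT x:J|lebesgue. g x * \<phi> x))"

text \<open>As usual, elements of \<open>W\<^sup>1\<^sup>,\<^sup>\<infinity>(\<real>)\<close> are identified with their continuous
  representative; this gives a meaning to the point values in Duhamel's formula.\<close>

definition W1inf :: "(real \<Rightarrow> real) \<Rightarrow> bool" where
  "W1inf f \<longleftrightarrow> continuous_on UNIV f \<and> Linf f \<and> (\<exists>g. Linf g \<and> has_weak_deriv UNIV f g)"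

section \<open>Partial derivatives of functions of space and time\<close>

text \<open>
  \<open>g\<close> is the derivative, at the time \<open>t \<in> A\<close>, of the distribution-valued map
  \<open>s \<mapsto> f(\<cdot>, s)\<close> on the open set \<open>J\<close>.  The test function is supported in a compact
  subset of \<open>J\<close>, so \<open>f(\<cdot>, s)\<close> need not be defined up to the boundary of \<open>J\<close> for
  \<open>s \<noteq> t\<close>.
\<close>

definition has_time_deriv ::
  "real set \<Rightarrow> real set \<Rightarrow> (real \<Rightarrow> real \<Rightarrow> real) \<Rightarrow> real \<Rightarrow> (real \<Rightarrow> real) \<Rightarrow> bool" where
  "has_time_deriv J A f t g \<longleftrightarrow> loc_integrable_on J g \<and>
     (\<forall>\<phi>. test_function J \<phi> \<longrightarrow>
        set_integrable lebesgue J (\<lambda>x. f x t * \<phi> x) \<and>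
        (\<forall>\<^sub>F s in at t within A. set_integrable lebesgue J (\<lambda>x. f x s * \<phi> x)) \<and>
        ((\<lambda>s. LINT x:J|lebesgue. f x s * \<phi> x) has_real_derivative
           (LINT x:J|lebesgue. g x * \<phi> x)) (at t within A))"

text \<open>Both derivatives are unique up to null sets, so the choice of representative is
  immaterial when they are integrated.\<close>

definition space_deriv :: "real set \<Rightarrow> (real \<Rightarrow> real \<Rightarrow> real) \<Rightarrow> real \<Rightarrow> real \<Rightarrow> real" where
  "space_deriv J f t = (SOME g. has_weak_deriv J (\<lambda>x. f x t) g)"

definition time_deriv ::
  "real set \<Rightarrow> real set \<Rightarrow> (real \<Rightarrow> real \<Rightarrow> real) \<Rightarrow> real \<Rightarrow> real \<Rightarrow> real" where
  "time_deriv J A f t = (SOME g. has_time_deriv J A f t g)"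

section \<open>Solutions on backward cones\<close>

definition bcone :: "real \<Rightarrow> real \<Rightarrow> real \<Rightarrow> (real \<times> real) set" where
  "bcone x t \<delta> = {(\<xi>, \<tau>). (\<xi>, \<tau>) \<noteq> (x, t) \<and> 0 \<le> \<tau> \<and> \<tau> \<le> t - \<delta> * \<bar>\<xi> - x\<bar>}"

text \<open>\<open>f \<in> C([0,t\<^sub>0), L\<^sup>2(|x-x\<^sub>0| < t\<^sub>0-t))\<close>.  Continuity on each \<open>[0,t\<^sub>1]\<close>, \<open>t\<^sub>1 < t\<^sub>0\<close>, is
  measured on the part \<open>|x-x\<^sub>0| < t\<^sub>0-t\<^sub>1\<close> common to all the sections up to time \<open>t\<^sub>1\<close>.\<close>

definition cont_L2_cone :: "real \<Rightarrow> real \<Rightarrow> (real \<Rightarrow> real \<Rightarrow> real) \<Rightarrow> bool" where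
  "cont_L2_cone x0 t0 f \<longleftrightarrow>
     (\<forall>t\<in>{0..<t0}. L2_on (ball x0 (t0 - t)) (\<lambda>x. f x t)) \<and>
     (\<forall>t1\<in>{0..<t0}. \<forall>t\<in>{0..t1}.
        ((\<lambda>s. L2_norm_on (ball x0 (t0 - t1)) (\<lambda>x. f x s - f x t)) \<longlongrightarrow> 0)
          (at t within {0..t1}))"

definition energy_regular :: "real \<Rightarrow> real \<Rightarrow> (real \<Rightarrow> real \<Rightarrow> real) \<Rightarrow> bool" where
  "energy_regular x0 t0 u \<longleftrightarrow>
     (\<exists>ux ut. cont_L2_cone x0 t0 u \<and> cont_L2_cone x0 t0 ux \<and> cont_L2_cone x0 t0 ut \<and>
        (\<forall>t\<in>{0..<t0}.
           has_weak_deriv (ball x0 (t0 - t)) (\<lambda>x. u x t) (\<lambda>x. ux x t) \<and>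
           has_time_deriv (ball x0 (t0 - t)) {0..<t0} u t (\<lambda>x. ut x t)))"

text \<open>The integrability conditions only say that the double integral makes sense, the
  Bochner integral of a non-integrable function being \<open>0\<close> by convention.\<close>

definition duhamel ::
  "(real \<Rightarrow> real) \<Rightarrow> (real \<Rightarrow> real) \<Rightarrow> (real \<Rightarrow> real \<Rightarrow> real) \<Rightarrow> real \<Rightarrow> real \<Rightarrow> bool" where
  "duhamel u0 u1 u x t \<longleftrightarrow>
     (\<forall>\<tau>\<in>{0..t}. set_integrable lebesgue {x - t + \<tau>..x + t - \<tau>} (\<lambda>z. exp (u z \<tau>))) \<and>
     set_integrable lebesgue {0..t}
       (\<lambda>\<tau>. LINT z:{x - t + \<tau>..x + t - \<tau>}|lebesgue. exp (u z \<tau>)) \<and>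
     u x t = 1/2 * (u0 (x - t) + u0 (x + t))
       + 1/2 * (LINT z:{x - t..x + t}|lebesgue. u1 z)
       + 1/2 * (LINT \<tau>:{0..t}|lebesgue.
                  (LINT z:{x - t + \<tau>..x + t - \<tau>}|lebesgue. exp (u z \<tau>)))"

definition solution_on_cone ::
  "(real \<Rightarrow> real) \<Rightarrow> (real \<Rightarrow> real) \<Rightarrow> (real \<Rightarrow> real \<Rightarrow> real) \<Rightarrow> real \<Rightarrow> real \<Rightarrow> bool" where
  "solution_on_cone u0 u1 u x0 t0 \<longleftrightarrow>
     energy_regular x0 t0 u \<and> (\<forall>(x, t)\<in>bcone x0 t0 1. duhamel u0 u1 u x t)"

section \<open>The maximal solution and its blow-up curve\<close>

definition max_domain :: "(real \<Rightarrow> real) \<Rightarrow> (real \<Rightarrow> real) \<Rightarrow> (real \<times> real) set" where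
  "max_domain u0 u1 = {(x, t). 0 \<le> t \<and> (\<exists>t'>t. \<exists>v. solution_on_cone u0 u1 v x t')}"

text \<open>Solutions on cones are unique, so they are all restrictions of one function.  Its
  values outside the union of these cones are irrelevant.\<close>

definition maximal_solution ::
  "(real \<Rightarrow> real) \<Rightarrow> (real \<Rightarrow> real) \<Rightarrow> (real \<Rightarrow> real \<Rightarrow> real) \<Rightarrow> bool" where
  "maximal_solution u0 u1 u \<longleftrightarrow>
     (\<forall>x0 t0. t0 > 0 \<and> (\<exists>v. solution_on_cone u0 u1 v x0 t0) \<longrightarrow> solution_on_cone u0 u1 u x0 t0)"

definition blowup_solution ::
  "(real \<Rightarrow> real) \<Rightarrow> (real \<Rightarrow> real) \<Rightarrow> (real \<Rightarrow> real \<Rightarrow> real) \<Rightarrow> bool" where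
  "blowup_solution u0 u1 u \<longleftrightarrow>
     maximal_solution u0 u1 u \<and> max_domain u0 u1 \<noteq> UNIV \<times> {0..}"

text \<open>For a blow-up solution the set below is the interval \<open>[0, T(x))\<close> with
  \<open>0 < T(x) < \<infinity>\<close>, so that the maximal domain is \<open>{(x,t). 0 \<le> t < T(x)}\<close>.\<close>

definition blowup_time :: "(real \<Rightarrow> real) \<Rightarrow> (real \<Rightarrow> real) \<Rightarrow> real \<Rightarrow> real" where
  "blowup_time u0 u1 x = Sup {t. (x, t) \<in> max_domain u0 u1}"

definition noncharacteristic :: "(real \<Rightarrow> real) \<Rightarrow> (real \<Rightarrow> real) \<Rightarrow> real set" where
  "noncharacteristic u0 u1 =
     {x0. \<exists>\<delta>0\<in>{0<..<1}. bcone x0 (blowup_time u0 u1 x0) \<delta>0 \<subseteq> max_domain u0 u1}"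

definition D_trunc :: "real \<Rightarrow> (real \<times> real) set" where
  "D_trunc R = {(x, t). 0 \<le> t \<and> \<bar>x\<bar> < R - t}"

definition section_ivl :: "(real \<Rightarrow> real) \<Rightarrow> real \<Rightarrow> real \<Rightarrow> real set" where
  "section_ivl T a t = {a - (T a - t)<..<a + (T a - t)}"

text \<open>Here \<open>t = T(a) - e\<^sup>-\<^sup>s\<close> and \<open>x = a + y (T(a) - t)\<close> invert the similarity variables.\<close>

definition similarity ::
  "(real \<Rightarrow> real \<Rightarrow> real) \<Rightarrow> (real \<Rightarrow> real) \<Rightarrow> real \<Rightarrow> real \<Rightarrow> real \<Rightarrow> real" where
  "similarity u T a y s =
     (let t = T a - exp (- s); x = a + y * (T a - t) in u x t + 2 * ln (T a - t))"

end

theory Submission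
  imports Defs "HOL-Real_Asymp.Real_Asymp"
begin

text \<open>
  In one space dimension \<open>u\<^sub>t\<^sub>t = u\<^sub>x\<^sub>x + e\<^sup>u\<close> is Liouville's equation and can be solved
  explicitly.  Write \<open>p = x + t\<close>, \<open>q = x - t\<close> and let \<open>f(p) + h(q)\<close> be the free wave with the
  same data.  If the vector functions \<open>A\<close>, \<open>C\<close> solve the linear system
  \<open>A' = - \<kappa> e\<^sup>f C\<close>, \<open>C' = \<kappa> e\<^sup>h A\<close> with \<open>\<kappa> = 1 / sqrt 8\<close> and \<open>C \<and> A = 1\<close> at \<open>0\<close>, then
  \<open>u = f(p) + h(q) - 2 ln Z(p, q)\<close> with \<open>Z(p, q) = C(q) \<and> A(p)\<close>.  All the irregularity of the
  data is in \<open>f\<close> and \<open>h\<close>; \<open>Z\<close> is continuously differentiable.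

  The solution lives as long as \<open>Z\<close> is positive on the backward triangle, and \<open>Z\<close> vanishes at
  the point \<open>(a, T(a))\<close> above a non-characteristic point \<open>a\<close>.  Below it \<open>Z\<close> decreases in \<open>p\<close>
  and increases in \<open>q\<close>.  Along each of the two characteristics through \<open>(a, T(a))\<close> the pair of
  \<open>Z\<close> and its normalised derivative solves a linear system and stays away from \<open>(0, 0)\<close>, so \<open>Z\<close>
  vanishes exactly to first order there; hence \<open>Z\<close> is comparable to \<open>T(a) - t\<close> in the whole
  backward cone, with constants depending only on bounds of the data.  This gives the rate of
  \<open>e\<^sup>u = e\<^sup>f\<^sup>+\<^sup>h / Z\<^sup>2\<close>, and the derivatives of \<open>u\<close> are \<open>O(1 / Z)\<close>.
\<close>

section \<open>Linear systems of ordinary differential equations\<close>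

text \<open>The maximal domain speaks of arbitrary solutions on cones. What is extracted from them
  is Duhamel's formula at every point: the sign of \<open>e^u\<close> turns it into a bound on the
  closed triangle, boundedness gives uniqueness, and so every solution is the explicit one. In the
  other direction the explicit function has to be an energy solution although \<open>f\<close> and
  \<open>h\<close> only have bounded weak derivatives. The derivatives in the theorem are arbitrary
  choices among weak derivatives, so they are compared almost everywhere with explicit Borel
  representatives. The linear system has \<open>e^f\<close> and \<open>e^h\<close> as coefficients,
  so that \<open>Z\<close> is obtained without differentiating \<open>f\<close> or
  \<open>h\<close>.\<close>

lemma antiderivative_exists:
  fixes g :: "real \<Rightarrow> real"
  assumes "continuous_on UNIV g"
  shows "\<exists>G. G 0 = 0 \<and> (\<forall>x. (G has_real_derivative g x) (at x))"
proof -
  have "isCont g x" for x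
    using assms by (simp add: continuous_on_eq_continuous_at)
  then obtain F where F: "\<And>x. (F has_real_derivative g x) (at x)"
    using einterval_antiderivative[of "-\<infinity>" \<infinity> g]
    by (auto simp: has_real_derivative_iff_has_vector_derivative)
  show ?thesis
    by (rule exI[of _ "\<lambda>x. F x - F 0"]) (auto intro!: derivative_eq_intros F)
qed

text \<open>One step of the Picard estimate: integration raises the exponent by one and divides by
  it, which builds up the factorials of the exponential series. The difference with the majorant is
  monotone on the nonnegative axis; reflection gives the other half.\<close>

lemma power_bound_of_derivative:
  fixes G g :: "real \<Rightarrow> real"
  assumes G0: "G 0 = 0" and G: "\<And>x. (G has_real_derivative g x) (at x)"
    and g: "\<And>x. \<bar>x\<bar> \<le> R \<Longrightarrow> \<bar>g x\<bar> \<le> c * \<bar>x\<bar> ^ n" and x: "\<bar>x\<bar> \<le> R"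
  shows "\<bar>G x\<bar> \<le> c * \<bar>x\<bar> ^ Suc n / Suc n"
proof -
  have nonneg: "H y \<le> c * y ^ Suc n / Suc n"
    if H0: "H 0 = 0" and H: "\<And>x. (H has_real_derivative h x) (at x)"
      and h: "\<And>x. \<bar>x\<bar> \<le> R \<Longrightarrow> h x \<le> c * \<bar>x\<bar> ^ n" and y: "0 \<le> y" "y \<le> R"
    for H h :: "real \<Rightarrow> real" and y
  proof -
    let ?D = "\<lambda>x. c * x ^ Suc n / Suc n - H x"
    have "?D 0 \<le> ?D y"
    proof (rule DERIV_nonneg_imp_nondecreasing[OF y(1)])
      fix z assume z: "0 \<le> z" "z \<le> y"
      have "(?D has_real_derivative (c * (real (Suc n) * z ^ n) / Suc n - h z)) (at z)"
        using DERIV_pow[of "Suc n" z UNIV]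
        by (intro DERIV_diff[OF DERIV_cdivide[OF DERIV_cmult] H]) simp
      then have "(?D has_real_derivative (c * z ^ n - h z)) (at z)"
        by (simp del: of_nat_Suc)
      moreover have "0 \<le> c * z ^ n - h z" using h[of z] z y by simp
      ultimately show "\<exists>d. (?D has_real_derivative d) (at z) \<and> 0 \<le> d" by blast
    qed
    then show ?thesis using H0 by simp
  qed
  show ?thesis
  proof (cases "0 \<le> x")
    case True
    have "G x \<le> c * x ^ Suc n / Suc n"
      by (rule nonneg[of G g x]) (use G0 G g x True in \<open>auto dest: abs_le_D1\<close>)
    moreover have "- G x \<le> c * x ^ Suc n / Suc n"
      by (rule nonneg[of "\<lambda>x. - G x" "\<lambda>x. - g x" x])
        (use G0 G g x True in \<open>auto intro!: derivative_intros dest: abs_le_D2\<close>)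
    ultimately show ?thesis using True by (auto simp: abs_le_iff)
  next
    case False
    have G': "((\<lambda>x. G (- x)) has_real_derivative - g (- x)) (at x)" for x
      using DERIV_chain2[of G "g (-x)" "\<lambda>x. -x" x "-1" UNIV] G[of "-x"]
      by (simp add: DERIV_minus[OF DERIV_ident])
    have g': "\<bar>g (- x)\<bar> \<le> c * \<bar>x\<bar> ^ n" if "\<bar>x\<bar> \<le> R" for x using g[of "-x"] that by simp
    have "G (- (- x)) \<le> c * (- x) ^ Suc n / Suc n"
      by (rule nonneg[of "\<lambda>x. G (- x)" "\<lambda>x. - g (- x)" "-x"])
       (use G0 G' g' x False in \<open>auto dest: abs_le_D2\<close>)
    moreover have "- G (- (- x)) \<le> c * (- x) ^ Suc n / Suc n"
      by (rule nonneg[of "\<lambda>x. - G (- x)" "\<lambda>x. g (- x)" "-x"])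
       (use G0 DERIV_minus[OF G'] g' x False in \<open>auto dest: abs_le_D1\<close>)
    ultimately show ?thesis using False by (auto simp: abs_le_iff)
  qed
qed

text \<open>Picard iteration written as a series. Its terms are iterated integrals, dominated on
  every bounded interval by the exponential series; by linearity the solution is therefore global
  even if the coefficients are unbounded on the line.\<close>

lemma linear_system_exists:
  fixes g1 g2 :: "real \<Rightarrow> real"
  assumes g1: "continuous_on UNIV g1" and g2: "continuous_on UNIV g2"
  shows "\<exists>y z. y 0 = y0 \<and> z 0 = z0 \<and>
    (\<forall>x. (y has_real_derivative g1 x * z x) (at x)) \<and>
    (\<forall>x. (z has_real_derivative g2 x * y x) (at x))"
proof -
  define I where "I g = (SOME G. G 0 = 0 \<and> (\<forall>x. (G has_real_derivative g x) (at x)))"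
    for g :: "real \<Rightarrow> real"
  have I: "I g 0 = 0" "\<And>x. (I g has_real_derivative g x) (at x)"
    if "continuous_on UNIV g" for g
    using someI_ex[OF antiderivative_exists[OF that]] unfolding I_def by blast+
  \<comment> \<open>\<open>Y n\<close> and \<open>Z n\<close> are the terms of the series, not its
    partial sums: all but the zeroth vanish at \<open>0\<close>, so the initial values sit in the
    zeroth term.\<close>
  define it where "it = rec_nat (\<lambda>x::real. y0, \<lambda>x::real. z0)
    (\<lambda>n p. (I (\<lambda>x. g1 x * snd p x), I (\<lambda>x. g2 x * fst p x)))"
  define Y where "Y n = fst (it n)" for n
  define Z where "Z n = snd (it n)" for n
  have Y0: "Y 0 = (\<lambda>x. y0)" and Z0: "Z 0 = (\<lambda>x. z0)"
    and YS: "\<And>n. Y (Suc n) = I (\<lambda>x. g1 x * Z n x)" and ZS: "\<And>n. Z (Suc n) = I (\<lambda>x. g2 x * Y n x)"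
    by (simp_all add: Y_def Z_def it_def)
  have cont: "continuous_on UNIV (Y n) \<and> continuous_on UNIV (Z n)" for n
  proof (induction n)
    case 0 then show ?case by (simp add: Y0 Z0)
  next
    case (Suc n)
    have "continuous_on UNIV (\<lambda>x. g1 x * Z n x)" "continuous_on UNIV (\<lambda>x. g2 x * Y n x)"
      using Suc g1 g2 by (auto intro!: continuous_intros)
    then show ?case unfolding YS ZS
      using I(2) by (meson DERIV_continuous_on has_field_derivative_at_within)
  qed
  have cgz: "continuous_on UNIV (\<lambda>x. g1 x * Z n x)" and cgy: "continuous_on UNIV (\<lambda>x. g2 x * Y n x)" for n
    using cont g1 g2 by (auto intro!: continuous_intros)
  have dY: "(Y (Suc n) has_real_derivative g1 x * Z n x) (at x)"
    and dZ: "(Z (Suc n) has_real_derivative g2 x * Y n x) (at x)" for n x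
    unfolding YS ZS using I(2)[OF cgz] I(2)[OF cgy] by auto
  have Y00: "Y (Suc n) 0 = 0" "Z (Suc n) 0 = 0" for n
    unfolding YS ZS using I(1)[OF cgz] I(1)[OF cgy] by auto
  define y where "y x = (\<Sum>n. Y n x)" for x
  define z where "z x = (\<Sum>n. Z n x)" for x
  \<comment> \<open>The termwise derivatives carry an index shift: the term \<open>n + 1\<close>
    differentiates to a coefficient times the term \<open>n\<close>.\<close>
  define dy where "dy n x = (case n of 0 \<Rightarrow> 0 | Suc m \<Rightarrow> g1 x * Z m x)" for n x
  define dz where "dz n x = (case n of 0 \<Rightarrow> 0 | Suc m \<Rightarrow> g2 x * Y m x)" for n x
  define B where "B = max \<bar>y0\<bar> \<bar>z0\<bar>"
  have main: "(y has_real_derivative (\<Sum>n. dy n x)) (at x) \<and> (z has_real_derivative (\<Sum>n. dz n x)) (at x)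
      \<and> summable (\<lambda>n. Y n x) \<and> summable (\<lambda>n. Z n x)" for x
  proof -
    \<comment> \<open>The bounds are uniform only on compact sets, so each point gets its own
      interval; the added 1 keeps \<open>x\<close> in the interior.\<close>
    define R where "R = \<bar>x\<bar> + 1"
    have "\<exists>K. \<forall>t\<in>{-R..R}. \<bar>g1 t\<bar> \<le> K" "\<exists>K. \<forall>t\<in>{-R..R}. \<bar>g2 t\<bar> \<le> K"
      using compact_imp_bounded[OF compact_continuous_image[OF continuous_on_subset[OF g1] compact_Icc]]
        compact_imp_bounded[OF compact_continuous_image[OF continuous_on_subset[OF g2] compact_Icc]]
      by (auto simp: bounded_iff)
    then obtain K1 K2 where "\<forall>t\<in>{-R..R}. \<bar>g1 t\<bar> \<le> K1" "\<forall>t\<in>{-R..R}. \<bar>g2 t\<bar> \<le> K2" by blast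
    then obtain K where K: "K \<ge> 0" "\<And>t. \<bar>t\<bar> \<le> R \<Longrightarrow> \<bar>g1 t\<bar> \<le> K" "\<And>t. \<bar>t\<bar> \<le> R \<Longrightarrow> \<bar>g2 t\<bar> \<le> K"
      by (intro that[of "max 0 (max K1 K2)"]) (auto simp: abs_le_iff le_max_iff_disj)
    have bound: "\<forall>t. \<bar>t\<bar> \<le> R \<longrightarrow> \<bar>Y n t\<bar> \<le> B * K ^ n / fact n * \<bar>t\<bar> ^ n \<and> \<bar>Z n t\<bar> \<le> B * K ^ n / fact n * \<bar>t\<bar> ^ n" for n
    proof (induction n)
      case 0 then show ?case by (simp add: Y0 Z0 B_def)
    next
      case (Suc n)
      have g: "\<bar>g1 t * Z n t\<bar> \<le> (K * (B * K ^ n / fact n)) * \<bar>t\<bar> ^ n"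
              "\<bar>g2 t * Y n t\<bar> \<le> (K * (B * K ^ n / fact n)) * \<bar>t\<bar> ^ n" if "\<bar>t\<bar> \<le> R" for t
        using mult_mono[OF K(2)[OF that], of "\<bar>Z n t\<bar>" "B * K ^ n / fact n * \<bar>t\<bar> ^ n"]
          mult_mono[OF K(3)[OF that], of "\<bar>Y n t\<bar>" "B * K ^ n / fact n * \<bar>t\<bar> ^ n"] Suc that K(1)
        by (auto simp: abs_mult mult.assoc)
      show ?case
        using power_bound_of_derivative[OF Y00(1) dY g(1)] power_bound_of_derivative[OF Y00(2) dZ g(2)]
        by (auto simp: field_simps simp del: of_nat_Suc)
    qed
    have B0: "B \<ge> 0" by (simp add: B_def)
    have bd: "\<bar>Y n t\<bar> \<le> B * ((K * R) ^ n / fact n) \<and> \<bar>Z n t\<bar> \<le> B * ((K * R) ^ n / fact n)" if "\<bar>t\<bar> \<le> R" for n t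
    proof -
      have "B * K ^ n / fact n * \<bar>t\<bar> ^ n \<le> B * K ^ n / fact n * R ^ n"
        using that B0 K(1) by (intro mult_left_mono power_mono) auto
      then show ?thesis using bound[rule_format, OF that, of n] by (auto simp: power_mult_distrib field_simps)
    qed
    have sumR: "summable (\<lambda>n. B * ((K * R) ^ n / fact n))"
      using summable_exp[of "K * R"] by (intro summable_mult) (simp add: field_simps)
    have R0: "0 \<in> {-R..R}" and xi: "x \<in> interior {-R..R}" and xR: "\<bar>x\<bar> \<le> R" by (auto simp: R_def)
    have sY: "summable (\<lambda>n. Y n t)" and sZ: "summable (\<lambda>n. Z n t)" if "\<bar>t\<bar> \<le> R" for t
      by (rule summable_comparison_test'[OF sumR, of 0]; use bd[OF that] in auto)+
    define M where "M n = (case n of 0 \<Rightarrow> 0 | Suc m \<Rightarrow> K * (B * ((K * R) ^ m / fact m)))" for n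
    have sM: "summable M"
      using summable_mult[OF sumR, of K] by (subst summable_Suc_iff[symmetric]) (simp add: M_def)
    have dM: "\<bar>dy n t\<bar> \<le> M n" "\<bar>dz n t\<bar> \<le> M n" if "\<bar>t\<bar> \<le> R" for n t
    proof -
      have "\<bar>g1 t\<bar> * \<bar>Z m t\<bar> \<le> K * (B * ((K * R) ^ m / fact m))"
        "\<bar>g2 t\<bar> * \<bar>Y m t\<bar> \<le> K * (B * ((K * R) ^ m / fact m))" for m
        using bd[OF that, of m] K that by (auto intro!: mult_mono simp del: times_divide_eq_right)
      then show "\<bar>dy n t\<bar> \<le> M n" "\<bar>dz n t\<bar> \<le> M n"
        by (simp_all add: dy_def dz_def M_def abs_mult del: times_divide_eq_right split: nat.splits)
    qed
    have uc1: "uniformly_convergent_on {-R..R} (\<lambda>n x. \<Sum>i<n. dy i x)"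
      by (rule Weierstrass_m_test'[OF _ sM]) (use dM in auto)
    have der1: "(Y n has_real_derivative dy n t) (at t within {-R..R})" for n t
      by (cases n) (auto simp: dy_def Y0 intro: has_field_derivative_at_within[OF dY])
    have 1: "(y has_real_derivative (\<Sum>n. dy n x)) (at x)"
      unfolding y_def
      by (rule has_field_derivative_series'(2)[OF convex_real_interval(5) der1 uc1 R0 sY xi])
        (simp add: R_def)
    have uc2: "uniformly_convergent_on {-R..R} (\<lambda>n x. \<Sum>i<n. dz i x)"
      by (rule Weierstrass_m_test'[OF _ sM]) (use dM in auto)
    have der2: "(Z n has_real_derivative dz n t) (at t within {-R..R})" for n t
      by (cases n) (auto simp: dz_def Z0 intro: has_field_derivative_at_within[OF dZ])
    have 2: "(z has_real_derivative (\<Sum>n. dz n x)) (at x)"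
      unfolding z_def
      by (rule has_field_derivative_series'(2)[OF convex_real_interval(5) der2 uc2 R0 sZ xi])
        (simp add: R_def)
    show ?thesis using 1 2 sY[OF xR] sZ[OF xR] by simp
  qed
  have "(\<Sum>n. dy n x) = g1 x * z x \<and> (\<Sum>n. dz n x) = g2 x * y x" for x
  proof -
    have "(\<lambda>n. dy (Suc n) x) sums (g1 x * z x)" "(\<lambda>n. dz (Suc n) x) sums (g2 x * y x)"
      unfolding dy_def dz_def y_def z_def using main[of x] by (auto intro!: sums_mult summable_sums)
    from this[THEN sums_Suc, THEN sums_unique] show ?thesis
      by (simp add: dy_def dz_def)
  qed
  moreover have "y 0 = y0" "z 0 = z0"
  proof -
    have "(\<lambda>n. Y n 0) sums Y 0 0" "(\<lambda>n. Z n 0) sums Z 0 0"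
      by (rule sums_unique2 sums_0 sums_zero | use sums_Suc_iff[of "\<lambda>n. Y n 0" 0] sums_Suc_iff[of "\<lambda>n. Z n 0" 0] Y00 in simp)+
    then show "y 0 = y0" "z 0 = z0" unfolding y_def z_def by (auto simp: sums_iff Y0 Z0)
  qed
  ultimately show ?thesis using main by (intro exI[of _ y] exI[of _ z]) auto
qed

section \<open>Liouville's formula\<close>

text \<open>In the coordinates \<open>p\<close>, \<open>q\<close> the equation reads
  \<open>- 4 u_pq = e^u\<close>. For \<open>u = f + h - 2 ln Z\<close> this is
  \<open>8 (Z Z_pq - Z_p Z_q) = e^(f + h)\<close>, and the Pluecker relation below evaluates the
  bracket to \<open>kap^2 e^(f + h)\<close>. Hence \<open>8 kap^2 = 1\<close>.\<close>

definition kap :: real where "kap = 1 / sqrt 8"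

lemma kap_pos: "0 < kap" and kap_square: "kap * kap = 1 / 8"
  by (simp_all add: kap_def)

text \<open>The initial values give the vectors \<open>C\<close> and \<open>A\<close> determinant 1
  at \<open>0\<close>. This propagates to \<open>Z = 1\<close> on the diagonal \<open>p = q\<close>,
  which is the initial line \<open>t = 0\<close>, so that the explicit solution starts from
  \<open>f + h\<close>.\<close>

locale liouville =
  fixes f h a1 a2 c1 c2 :: "real \<Rightarrow> real"
  assumes cont_f: "continuous_on UNIV f" and cont_h: "continuous_on UNIV h"
    and deriv_a1: "\<And>x. (a1 has_real_derivative - kap * exp (f x) * c1 x) (at x)"
    and deriv_a2: "\<And>x. (a2 has_real_derivative - kap * exp (f x) * c2 x) (at x)"
    and deriv_c1: "\<And>x. (c1 has_real_derivative kap * exp (h x) * a1 x) (at x)"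
    and deriv_c2: "\<And>x. (c2 has_real_derivative kap * exp (h x) * a2 x) (at x)"
    and init: "a1 0 = 0" "a2 0 = 1" "c1 0 = 1" "c2 0 = 0"
begin

text \<open>Three determinants of the vectors \<open>A\<close> and \<open>C\<close> taken at
  \<open>p\<close> and \<open>q\<close>. Up to sign, \<open>Yp\<close> and \<open>Yq\<close> are the
  derivatives of \<open>Z\<close> stripped of the factors \<open>kap e^f\<close> and
  \<open>kap e^h\<close>; unlike those derivatives they can be differentiated again in their own
  variable while \<open>f\<close> and \<open>h\<close> are only continuous. \<open>Vp\<close> and
  \<open>Vq\<close> are the derivatives of \<open>- 2 ln Z\<close>.\<close>

definition Z :: "real \<Rightarrow> real \<Rightarrow> real" where "Z p q = c1 q * a2 p - c2 q * a1 p"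
definition Yp :: "real \<Rightarrow> real \<Rightarrow> real" where "Yp p q = c1 q * c2 p - c2 q * c1 p"
definition Yq :: "real \<Rightarrow> real \<Rightarrow> real" where "Yq p q = a1 q * a2 p - a2 q * a1 p"
definition Vp :: "real \<Rightarrow> real \<Rightarrow> real" where "Vp p q = 2 * kap * exp (f p) * Yp p q / Z p q"
definition Vq :: "real \<Rightarrow> real \<Rightarrow> real" where "Vq p q = - 2 * kap * exp (h q) * Yq p q / Z p q"
definition E :: "real \<Rightarrow> real \<Rightarrow> real" where "E p q = exp (f p + h q) / (Z p q)\<^sup>2"
definition v :: "real \<Rightarrow> real \<Rightarrow> real" where
  "v x t = f (x + t) + h (x - t) - 2 * ln (Z (x + t) (x - t))"

section \<open>Continuity and derivatives of the determinants\<close>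

lemma cont_acc: "continuous_on UNIV a1" "continuous_on UNIV a2" "continuous_on UNIV c1" "continuous_on UNIV c2"
  by (intro continuous_at_imp_continuous_on ballI DERIV_isCont[OF deriv_a1] DERIV_isCont[OF deriv_a2]
    DERIV_isCont[OF deriv_c1] DERIV_isCont[OF deriv_c2])+

lemma cont_fh_comp [continuous_intros]:
  assumes "continuous_on S g"
  shows "continuous_on S (\<lambda>x. f (g x))" "continuous_on S (\<lambda>x. h (g x))"
  using continuous_on_compose2[OF cont_f assms] continuous_on_compose2[OF cont_h assms] by auto

lemma cont_acc_comp [continuous_intros]:
  assumes "continuous_on S g"
  shows "continuous_on S (\<lambda>x. a1 (g x))" "continuous_on S (\<lambda>x. a2 (g x))"
    "continuous_on S (\<lambda>x. c1 (g x))" "continuous_on S (\<lambda>x. c2 (g x))"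
  using continuous_on_compose2[OF cont_acc(1) assms] continuous_on_compose2[OF cont_acc(2) assms]
    continuous_on_compose2[OF cont_acc(3) assms] continuous_on_compose2[OF cont_acc(4) assms] by auto

lemma cont_ZY_comp [continuous_intros]:
  assumes "continuous_on S g" "continuous_on S k"
  shows "continuous_on S (\<lambda>x. Z (g x) (k x))" "continuous_on S (\<lambda>x. Yp (g x) (k x))"
    "continuous_on S (\<lambda>x. Yq (g x) (k x))"
  unfolding Z_def Yp_def Yq_def using assms by (auto intro!: continuous_intros)

lemma cont_VE_comp:
  assumes "continuous_on S g" "continuous_on S k" "\<And>x. x \<in> S \<Longrightarrow> Z (g x) (k x) \<noteq> 0"
  shows "continuous_on S (\<lambda>x. Vp (g x) (k x))" "continuous_on S (\<lambda>x. Vq (g x) (k x))"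
    "continuous_on S (\<lambda>x. E (g x) (k x))"
  unfolding Vp_def Vq_def E_def using assms by (auto intro!: continuous_intros)

text \<open>The contributions of \<open>A'\<close> and of \<open>C'\<close> to the derivative cancel
  separately, because \<open>A'\<close> is a multiple of \<open>C\<close> and \<open>C'\<close> a
  multiple of \<open>A\<close>.\<close>

lemma wronskian: "c1 x * a2 x - c2 x * a1 x = 1"
proof -
  have "((\<lambda>x. c1 x * a2 x - c2 x * a1 x) has_real_derivative 0) (at x)" for x
    by (auto intro!: derivative_eq_intros deriv_a1 deriv_a2 deriv_c1 deriv_c2 simp: algebra_simps)
  then have "c1 x * a2 x - c2 x * a1 x = c1 0 * a2 0 - c2 0 * a1 0"
    by (rule DERIV_isconst_all[rule_format])
  then show ?thesis by (simp add: init)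
qed

lemma diag: "Z x x = 1" "Yp x x = 0" "Yq x x = 0" "Vp x x = 0"
  using wronskian[of x] by (simp_all add: Z_def Yp_def Yq_def Vp_def)

lemma deriv_Z_p: "((\<lambda>p. Z p q) has_real_derivative - kap * exp (f p) * Yp p q) (at p within S)"
  unfolding Z_def Yp_def
  by (auto intro!: derivative_eq_intros has_field_derivative_at_within[OF deriv_a1]
    has_field_derivative_at_within[OF deriv_a2] simp: algebra_simps)

lemma deriv_Z_q: "((\<lambda>q. Z p q) has_real_derivative kap * exp (h q) * Yq p q) (at q within S)"
  unfolding Z_def Yq_def
  by (auto intro!: derivative_eq_intros has_field_derivative_at_within[OF deriv_c1]
    has_field_derivative_at_within[OF deriv_c2] simp: algebra_simps)

lemma deriv_Yp_p: "((\<lambda>p. Yp p q) has_real_derivative kap * exp (h p) * Z p q) (at p within S)"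
  unfolding Z_def Yp_def
  by (auto intro!: derivative_eq_intros has_field_derivative_at_within[OF deriv_c1]
    has_field_derivative_at_within[OF deriv_c2] simp: algebra_simps)

lemma deriv_Yp_q: "((\<lambda>q. Yp p q) has_real_derivative kap * exp (h q) * (a1 q * c2 p - a2 q * c1 p)) (at q within S)"
  unfolding Yp_def
  by (auto intro!: derivative_eq_intros has_field_derivative_at_within[OF deriv_c1]
    has_field_derivative_at_within[OF deriv_c2] simp: algebra_simps)

lemma deriv_Yq_q: "((\<lambda>q. Yq p q) has_real_derivative - kap * exp (f q) * Z p q) (at q within S)"
  unfolding Z_def Yq_def
  by (auto intro!: derivative_eq_intros has_field_derivative_at_within[OF deriv_a1]
    has_field_derivative_at_within[OF deriv_a2] simp: algebra_simps)

text \<open>The Pluecker relation for the four vectors \<open>(a1, a2)\<close>, \<open>(c1, c2)\<close> at \<open>p\<close> and \<open>q\<close>.\<close>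

lemma pluecker: "(a1 q * c2 p - a2 q * c1 p) * Z p q - Yp p q * Yq p q = - 1"
proof -
  have "(a1 q * c2 p - a2 q * c1 p) * Z p q - Yp p q * Yq p q
      = - ((c1 q * a2 q - c2 q * a1 q) * (c1 p * a2 p - c2 p * a1 p))"
    unfolding Z_def Yp_def Yq_def by algebra
  then show ?thesis by (simp add: wronskian)
qed

text \<open>The equation in characteristic form, \<open>v_pq = - e^v / 4\<close>. It is stated as a
  \<open>q\<close>-derivative of \<open>Vp\<close> so that \<open>e^f\<close>, frozen at
  \<open>p\<close>, is never differentiated.\<close>

lemma deriv_Vp_q:
  assumes "Z p q \<noteq> 0"
  shows "((\<lambda>q. Vp p q) has_real_derivative - E p q / 4) (at q within S)"
proof -
  let ?k = "2 * kap * exp (f p)"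
  have "((\<lambda>q. Vp p q) has_real_derivative
      (?k * (kap * exp (h q) * (a1 q * c2 p - a2 q * c1 p)) * Z p q
        - (?k * Yp p q) * (kap * exp (h q) * Yq p q)) / (Z p q * Z p q)) (at q within S)"
    unfolding Vp_def by (intro DERIV_divide DERIV_cmult deriv_Yp_q deriv_Z_q assms)
  moreover have "?k * (kap * exp (h q) * (a1 q * c2 p - a2 q * c1 p)) * Z p q
        - (?k * Yp p q) * (kap * exp (h q) * Yq p q)
      = 2 * (kap * kap) * (exp (f p) * exp (h q))
        * ((a1 q * c2 p - a2 q * c1 p) * Z p q - Yp p q * Yq p q)"
    by (simp add: algebra_simps)
  ultimately show ?thesis
    unfolding pluecker kap_square by (simp add: E_def exp_add power2_eq_square mult.commute)
qed

section \<open>Duhamel's formula for the explicit solution\<close>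

lemma exp_v: "Z (x + t) (x - t) > 0 \<Longrightarrow> exp (v x t) = E (x + t) (x - t)"
  unfolding v_def E_def by (simp add: exp_diff exp_double)

text \<open>Integrate \<open>v_pq = - e^v / 4\<close> over the characteristic triangle: the
  \<open>q\<close>-integral leaves \<open>Vp\<close> on the edge \<open>q = q0\<close>, and the
  \<open>p\<close>-integral of that leaves \<open>ln Z\<close> at the apex. The remaining boundary
  terms lie on the diagonal, where \<open>Vp\<close> and \<open>ln Z\<close> vanish.\<close>

lemma double_integral_E:
  fixes x t :: real
  defines "p0 \<equiv> x + t" and "q0 \<equiv> x - t"
  assumes t: "0 \<le> t" and pos: "\<And>p q. q0 \<le> q \<Longrightarrow> q \<le> p \<Longrightarrow> p \<le> p0 \<Longrightarrow> 0 < Z p q"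
  shows "set_integrable lborel {0..t} (\<lambda>\<tau>. LINT z:{q0 + \<tau>..p0 - \<tau>}|lborel. E (z + \<tau>) (z - \<tau>))"
    and "(LINT \<tau>:{0..t}|lborel. LINT z:{q0 + \<tau>..p0 - \<tau>}|lborel. E (z + \<tau>) (z - \<tau>)) = - 4 * ln (Z p0 q0)"
proof -
  \<comment> \<open>The triangle in the mixed coordinates \<open>p\<close> and
    \<open>\<tau>\<close>, with \<open>q = p - 2 * \<tau>\<close>. For fixed \<open>\<tau>\<close>
    the slice is a translate of Duhamel's slice; for fixed \<open>p\<close> it follows a
    characteristic.\<close>
  define K where "K = {(p, \<tau>). 0 \<le> \<tau> \<and> q0 + 2 * \<tau> \<le> p \<and> p \<le> p0}"
  define F where "F p \<tau> = indicator K (p, \<tau>) *\<^sub>R E p (p - 2 * \<tau>)" for p \<tau>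
  have "K \<subseteq> cbox (q0, 0) (p0, t)" by (auto simp: K_def p0_def q0_def)
  then have "bounded K" using bounded_cbox bounded_subset by blast
  moreover have "K = {z. 0 \<le> snd z} \<inter> {z. q0 + 2 * snd z \<le> fst z} \<inter> {z. fst z \<le> p0}"
    by (auto simp: K_def)
  moreover have "closed \<dots>" by (intro closed_Int closed_Collect_le continuous_intros)
  ultimately have K: "compact K" by (simp add: compact_eq_bounded_closed)
  have "Z (fst z) (fst z - 2 * snd z) \<noteq> 0" if "z \<in> K" for z
    using pos[of "fst z - 2 * snd z" "fst z"] that by (auto simp: K_def)
  then have "integrable lborel (\<lambda>z. indicator K z *\<^sub>R E (fst z) (fst z - 2 * snd z))"
    by (intro borel_integrable_compact K cont_VE_comp continuous_intros) auto
  then have int: "integrable (lborel \<Otimes>\<^sub>M lborel) (case_prod F)"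
    by (simp add: lborel_prod F_def[abs_def] case_prod_beta')
  have fub: "(\<integral>\<tau>. (\<integral>p. F p \<tau> \<partial>lborel) \<partial>lborel) = (\<integral>p. (\<integral>\<tau>. F p \<tau> \<partial>lborel) \<partial>lborel)"
    by (rule lborel_pair.Fubini_integral[OF int])
  have inner1: "(\<integral>p. F p \<tau> \<partial>lborel) = indicator {0..t} \<tau> *\<^sub>R (LINT z:{q0 + \<tau>..p0 - \<tau>}|lborel. E (z + \<tau>) (z - \<tau>))" for \<tau>
  proof -
    have "(\<integral>p. F p \<tau> \<partial>lborel) = (\<integral>z. F (\<tau> + 1 * z) \<tau> \<partial>lborel)"
      using lborel_integral_real_affine[of 1 "\<lambda>p. F p \<tau>" \<tau>] by simp
    also have "\<dots> = (\<integral>z. indicator {0..t} \<tau> *\<^sub>R (indicator {q0 + \<tau>..p0 - \<tau>} z *\<^sub>R E (z + \<tau>) (z - \<tau>)) \<partial>lborel)"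
      by (rule Bochner_Integration.integral_cong)
        (auto simp: F_def K_def indicator_def p0_def q0_def algebra_simps)
    finally show ?thesis by (simp add: set_lebesgue_integral_def)
  qed
  have inner2: "(\<integral>\<tau>. F p \<tau> \<partial>lborel) = indicator {q0..p0} p *\<^sub>R (2 * Vp p q0)" for p
  proof (cases "p \<in> {q0..p0}")
    case True
    have nz: "Z p (p - 2 * \<tau>) \<noteq> 0" if "0 \<le> \<tau>" "\<tau> \<le> (p - q0) / 2" for \<tau>
      using pos[of "p - 2 * \<tau>" p] that True by (simp add: field_simps)
    have "(\<integral>\<tau>. F p \<tau> \<partial>lborel) = (\<integral>\<tau>. indicator {0..(p - q0) / 2} \<tau> *\<^sub>R E p (p - 2 * \<tau>) \<partial>lborel)"
      using True by (intro Bochner_Integration.integral_cong)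
        (auto simp: F_def K_def indicator_def field_simps)
    \<comment> \<open>Along \<open>q = p - 2 * \<tau>\<close> the \<open>\<tau>\<close>-derivative
      of \<open>Vp\<close> is \<open>E / 2\<close>; hence the factor 2.\<close>
    also have "\<dots> = - 2 * - Vp p (p - 2 * ((p - q0) / 2)) - (- 2 * - Vp p (p - 2 * 0))"
    proof (rule integral_FTC_atLeastAtMost)
      fix \<tau> assume \<tau>: "0 \<le> \<tau>" "\<tau> \<le> (p - q0) / 2"
      have "((\<lambda>\<tau>. Vp p (p - 2 * \<tau>)) has_real_derivative (- E p (p - 2 * \<tau>) / 4) * (0 - 2 * 1)) (at \<tau> within {0..(p - q0) / 2})"
        by (rule DERIV_chain2[where f = "Vp p" and g = "\<lambda>\<tau>. p - 2 * \<tau>", OF deriv_Vp_q[OF nz[OF \<tau>]]]) (auto intro!: derivative_eq_intros)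
      from DERIV_cmult[OF this, of 2]
      show "((\<lambda>\<tau>. - 2 * - Vp p (p - 2 * \<tau>)) has_vector_derivative E p (p - 2 * \<tau>)) (at \<tau> within {0..(p - q0) / 2})"
        by (simp add: has_real_derivative_iff_has_vector_derivative)
    qed (use True nz in \<open>auto intro!: cont_VE_comp continuous_intros\<close>)
    also have "p - 2 * ((p - q0) / 2) = q0" by (simp add: field_simps)
    finally show ?thesis using True by (simp add: diag)
  next
    case False
    then have "F p \<tau> = 0" for \<tau> by (auto simp: F_def K_def)
    then show ?thesis using False by simp
  qed
  show "set_integrable lborel {0..t} (\<lambda>\<tau>. LINT z:{q0 + \<tau>..p0 - \<tau>}|lborel. E (z + \<tau>) (z - \<tau>))"
    using lborel_pair.integrable_snd[OF int] unfolding set_integrable_def inner1 .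
  have "(LINT \<tau>:{0..t}|lborel. LINT z:{q0 + \<tau>..p0 - \<tau>}|lborel. E (z + \<tau>) (z - \<tau>))
      = (\<integral>p. indicator {q0..p0} p *\<^sub>R (2 * Vp p q0) \<partial>lborel)"
    using fub unfolding inner1 inner2 by (simp add: set_lebesgue_integral_def)
  also have "\<dots> = - 4 * ln (Z p0 q0) - (- 4 * ln (Z q0 q0))"
  proof (rule integral_FTC_atLeastAtMost)
    show "q0 \<le> p0" using t by (simp add: p0_def q0_def)
    fix p assume p: "q0 \<le> p" "p \<le> p0"
    have Zp: "Z p q0 > 0" using pos[of q0 p] p by simp
    have "((\<lambda>p. ln (Z p q0)) has_real_derivative (1 / Z p q0) * (- kap * exp (f p) * Yp p q0)) (at p within {q0..p0})"
      by (rule DERIV_chain2[OF DERIV_ln_divide[OF Zp] deriv_Z_p])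
    from DERIV_cmult[OF this, of "-4"]
    show "((\<lambda>p. - 4 * ln (Z p q0)) has_vector_derivative 2 * Vp p q0) (at p within {q0..p0})"
      by (simp add: has_real_derivative_iff_has_vector_derivative Vp_def mult.assoc)
  next
    have "\<And>p. p \<in> {q0..p0} \<Longrightarrow> Z p q0 \<noteq> 0" using pos[of q0] by force
    then show "continuous_on {q0..p0} (\<lambda>p. 2 * Vp p q0)"
      by (intro cont_VE_comp continuous_intros) auto
  qed
  finally show "(LINT \<tau>:{0..t}|lborel. LINT z:{q0 + \<tau>..p0 - \<tau>}|lborel. E (z + \<tau>) (z - \<tau>)) = - 4 * ln (Z p0 q0)"
    by (simp add: diag)
qed

text \<open>Carries the double integral over to the completed measure; half of
  \<open>- 4 ln Z\<close> is the nonlinear term of \<open>v\<close>.\<close>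

lemma duhamel_v:
  assumes t: "0 \<le> t" and pos: "\<And>p q. x - t \<le> q \<Longrightarrow> q \<le> p \<Longrightarrow> p \<le> x + t \<Longrightarrow> 0 < Z p q"
  shows "\<forall>\<tau>\<in>{0..t}. set_integrable lebesgue {x - t + \<tau>..x + t - \<tau>} (\<lambda>z. exp (v z \<tau>))"
    and "set_integrable lebesgue {0..t} (\<lambda>\<tau>. LINT z:{x - t + \<tau>..x + t - \<tau>}|lebesgue. exp (v z \<tau>))"
    and "v x t = f (x + t) + h (x - t)
      + 1/2 * (LINT \<tau>:{0..t}|lebesgue. LINT z:{x - t + \<tau>..x + t - \<tau>}|lebesgue. exp (v z \<tau>))"
proof -
  have Zpos: "Z (z + \<tau>) (z - \<tau>) > 0" if "\<tau> \<in> {0..t}" "z \<in> {x - t + \<tau>..x + t - \<tau>}" for z \<tau>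
    using that by (intro pos) auto
  have Eint: "set_integrable lborel {x - t + \<tau>..x + t - \<tau>} (\<lambda>z. E (z + \<tau>) (z - \<tau>))" if "\<tau> \<in> {0..t}" for \<tau>
    using Zpos[OF that]
    by (intro borel_integrable_atLeastAtMost' cont_VE_comp continuous_intros) force
  have Eint': "set_integrable lebesgue {x - t + \<tau>..x + t - \<tau>} (\<lambda>z. E (z + \<tau>) (z - \<tau>))" 
    and Eeq: "(LINT z:{x - t + \<tau>..x + t - \<tau>}|lebesgue. E (z + \<tau>) (z - \<tau>))
      = (LINT z:{x - t + \<tau>..x + t - \<tau>}|lborel. E (z + \<tau>) (z - \<tau>))" if "\<tau> \<in> {0..t}" for \<tau>
    using Eint[OF that] unfolding set_integrable_def set_lebesgue_integral_def
    by (simp_all add: integrable_completion integral_completion)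
  have veq: "exp (v z \<tau>) = E (z + \<tau>) (z - \<tau>)" if "\<tau> \<in> {0..t}" "z \<in> {x - t + \<tau>..x + t - \<tau>}" for z \<tau>
    by (rule exp_v[OF Zpos[OF that]])
  show "\<forall>\<tau>\<in>{0..t}. set_integrable lebesgue {x - t + \<tau>..x + t - \<tau>} (\<lambda>z. exp (v z \<tau>))"
  proof
    fix \<tau> assume \<tau>: "\<tau> \<in> {0..t}"
    show "set_integrable lebesgue {x - t + \<tau>..x + t - \<tau>} (\<lambda>z. exp (v z \<tau>))"
      by (rule iffD2[OF set_integrable_cong[OF refl refl veq[OF \<tau>]] Eint'[OF \<tau>]])
  qed
  have inner: "(LINT z:{x - t + \<tau>..x + t - \<tau>}|lebesgue. exp (v z \<tau>))
      = (LINT z:{x - t + \<tau>..x + t - \<tau>}|lborel. E (z + \<tau>) (z - \<tau>))" if "\<tau> \<in> {0..t}" for \<tau>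
    by (rule trans[OF set_lebesgue_integral_cong Eeq[OF that]]) (use veq[OF that] in auto)
  note dbl = double_integral_E[OF t pos]
  have dbl': "set_integrable lebesgue {0..t} (\<lambda>\<tau>. LINT z:{x - t + \<tau>..x + t - \<tau>}|lborel. E (z + \<tau>) (z - \<tau>))"
    "(LINT \<tau>:{0..t}|lebesgue. LINT z:{x - t + \<tau>..x + t - \<tau>}|lborel. E (z + \<tau>) (z - \<tau>)) = - 4 * ln (Z (x + t) (x - t))"
    using dbl unfolding set_integrable_def set_lebesgue_integral_def[of _ "{0..t}"]
    by (simp_all add: integrable_completion integral_completion)
  show "set_integrable lebesgue {0..t} (\<lambda>\<tau>. LINT z:{x - t + \<tau>..x + t - \<tau>}|lebesgue. exp (v z \<tau>))"
    by (rule iffD2[OF set_integrable_cong[OF refl refl inner] dbl'(1)])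
  have "(LINT \<tau>:{0..t}|lebesgue. LINT z:{x - t + \<tau>..x + t - \<tau>}|lebesgue. exp (v z \<tau>)) = - 4 * ln (Z (x + t) (x - t))"
    by (rule trans[OF set_lebesgue_integral_cong dbl'(2)]) (use inner in auto)
  then show "v x t = f (x + t) + h (x - t)
      + 1/2 * (LINT \<tau>:{0..t}|lebesgue. LINT z:{x - t + \<tau>..x + t - \<tau>}|lebesgue. exp (v z \<tau>))"
    by (simp add: v_def)
qed

end

lemma liouville_exists:
  assumes "continuous_on UNIV f" "continuous_on UNIV h"
  shows "\<exists>a1 a2 c1 c2. liouville f h a1 a2 c1 c2"
proof -
  have c: "continuous_on UNIV (\<lambda>x. - kap * exp (f x))" "continuous_on UNIV (\<lambda>x. kap * exp (h x))"
    using assms by (auto intro!: continuous_intros)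
  obtain a1 c1 where "a1 0 = 0" "c1 0 = 1" "\<And>x. (a1 has_real_derivative - kap * exp (f x) * c1 x) (at x)"
    "\<And>x. (c1 has_real_derivative kap * exp (h x) * a1 x) (at x)"
    using linear_system_exists[OF c, of 0 1] by blast
  moreover obtain a2 c2 where "a2 0 = 1" "c2 0 = 0" "\<And>x. (a2 has_real_derivative - kap * exp (f x) * c2 x) (at x)"
    "\<And>x. (c2 has_real_derivative kap * exp (h x) * a2 x) (at x)"
    using linear_system_exists[OF c, of 1 0] by blast
  ultimately have "liouville f h a1 a2 c1 c2"
    using assms by (unfold_locales) auto
  then show ?thesis by blast
qed

section \<open>Uniqueness from Duhamel's formula\<close>

text \<open>For \<open>t \<ge> 0\<close> this is \<open>bcone x t 1\<close> with its apex put back: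
  boundedness and uniqueness are argued on the closed triangle, using Duhamel's formula at the apex
  itself.\<close>

definition tri :: "real \<Rightarrow> real \<Rightarrow> (real \<times> real) set" where
  "tri x t = {(\<xi>, \<tau>). 0 \<le> \<tau> \<and> \<bar>\<xi> - x\<bar> \<le> t - \<tau>}"

definition free_wave :: "(real \<Rightarrow> real) \<Rightarrow> (real \<Rightarrow> real) \<Rightarrow> real \<Rightarrow> real \<Rightarrow> real" where
  "free_wave u0 u1 x t = 1/2 * (u0 (x - t) + u0 (x + t)) + 1/2 * (LINT z:{x - t..x + t}|lebesgue. u1 z)"

lemma tri_mono:
  assumes "(y, s) \<in> tri x t" shows "tri y s \<subseteq> tri x t"
  using assms by (auto simp: tri_def)

lemma tri_slice:
  assumes "(y, s) \<in> tri x t" "\<tau> \<in> {0..s}"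
  shows "{y - s + \<tau>..y + s - \<tau>} \<subseteq> {x - t + \<tau>..x + t - \<tau>}" "\<tau> \<in> {0..t}"
  using assms by (auto simp: tri_def)

text \<open>The majorant is a gauge integral because its value will be supplied by the fundamental
  theorem of calculus.\<close>

lemma set_lint_bound:
  fixes F G :: "real \<Rightarrow> real"
  assumes F: "set_integrable lebesgue S F" and G: "(G has_integral g) S"
    and le: "\<And>x. x \<in> S \<Longrightarrow> \<bar>F x\<bar> \<le> G x"
  shows "\<bar>LINT x:S|lebesgue. F x\<bar> \<le> g"
proof -
  have "norm (integral S F) \<le> integral S G"
    using set_lebesgue_integral_eq_integral(1)[OF F] G le
    by (intro integral_norm_bound_integral) auto
  then show ?thesis using set_lebesgue_integral_eq_integral(2)[OF F] G by (simp add: integral_unique)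
qed

lemma set_lint_nonneg:
  fixes F :: "real \<Rightarrow> real"
  assumes "\<And>x. x \<in> S \<Longrightarrow> 0 \<le> F x"
  shows "0 \<le> (LINT x:S|lebesgue. F x)"
  unfolding set_lebesgue_integral_def using assms
  by (intro Bochner_Integration.integral_nonneg) (auto simp: indicator_def)

lemma set_lint_mono_set:
  fixes F G :: "real \<Rightarrow> real"
  assumes F: "set_integrable lebesgue S F" and G: "set_integrable lebesgue T G" and "S \<subseteq> T"
    and le: "\<And>x. x \<in> S \<Longrightarrow> F x \<le> G x" and nonneg: "\<And>x. x \<in> T \<Longrightarrow> 0 \<le> G x"
  shows "(LINT x:S|lebesgue. F x) \<le> (LINT x:T|lebesgue. G x)"
  using assms unfolding set_lebesgue_integral_def set_integrable_def
  by (intro Bochner_Integration.integral_mono) (auto simp: indicator_def)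

text \<open>The integrand \<open>e^w\<close> is positive, so the double integral below any point of
  the triangle is at most the one below the apex, which is a fixed finite number. A single
  evaluation of the formula thus controls \<open>w\<close> on the whole triangle.\<close>

lemma duhamel_bounded:
  assumes D: "\<And>y s. (y, s) \<in> tri x t \<Longrightarrow> duhamel u0 u1 w y s" and t: "0 \<le> t"
    and M: "\<And>y s. (y, s) \<in> tri x t \<Longrightarrow> \<bar>free_wave u0 u1 y s\<bar> \<le> M"
  shows "\<exists>N. \<forall>y s. (y, s) \<in> tri x t \<longrightarrow> \<bar>w y s\<bar> \<le> N"
proof -
  define I where "I y s = (LINT \<tau>:{0..s}|lebesgue. (LINT z:{y - s + \<tau>..y + s - \<tau>}|lebesgue. exp (w z \<tau>)))" for y s
  have apex: "(x, t) \<in> tri x t" using t by (simp add: tri_def)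
  have "\<bar>w y s\<bar> \<le> M + I x t" if P: "(y, s) \<in> tri x t" for y s
  proof -
    have w: "w y s = free_wave u0 u1 y s + 1/2 * I y s"
      using D[OF P] by (simp add: duhamel_def free_wave_def I_def)
    have "0 \<le> I y s" unfolding I_def by (intro set_lint_nonneg) auto
    moreover have "I y s \<le> I x t" unfolding I_def
    proof (rule set_lint_mono_set)
      fix \<tau> assume \<tau>: "\<tau> \<in> {0..s}"
      show "(LINT z:{y - s + \<tau>..y + s - \<tau>}|lebesgue. exp (w z \<tau>)) \<le> (LINT z:{x - t + \<tau>..x + t - \<tau>}|lebesgue. exp (w z \<tau>))"
        using D[OF P] D[OF apex] tri_slice[OF P \<tau>] \<tau>
        by (intro set_lint_mono_set) (auto simp: duhamel_def)
    qed (use D[OF P] D[OF apex] P in \<open>auto simp: duhamel_def tri_def intro!: set_lint_nonneg\<close>)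
    ultimately show ?thesis using M[OF P] unfolding w by (simp add: abs_le_iff)
  qed
  then show ?thesis by blast
qed

lemma exp_lipschitz:
  fixes a b :: real
  assumes "a \<le> N" "b \<le> N"
  shows "\<bar>exp a - exp b\<bar> \<le> exp N * \<bar>a - b\<bar>"
proof -
  have *: "exp a - exp b \<le> exp N * \<bar>a - b\<bar>" if "a \<le> N" "b \<le> a" for a b :: real
  proof -
    have "exp a - exp b = exp a * (1 - exp (b - a))" by (simp add: algebra_simps exp_diff)
    also have "\<dots> \<le> exp a * (a - b)" by (intro mult_left_mono) (use exp_ge_add_one_self[of "b - a"] in linarith, simp)
    also have "\<dots> \<le> exp N * (a - b)" using that by (intro mult_right_mono) auto
    finally show ?thesis using that by simp
  qed
  show ?thesis
  proof (cases "b \<le> a")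
    case True
    then show ?thesis using *[OF assms(1) True] by simp
  next
    case False
    then show ?thesis using *[OF assms(2), of a] by (simp add: abs_minus_commute)
  qed
qed

text \<open>A contraction in the norm with weight \<open>exp (- lam * s)\<close>: both solutions
  stay below a common \<open>N\<close> on the triangle, where \<open>exp\<close> is therefore
  Lipschitz, and each use of Duhamel's formula halves the distance.\<close>

lemma duhamel_unique:
  assumes D1: "\<And>y s. (y, s) \<in> tri x t \<Longrightarrow> duhamel u0 u1 w1 y s"
    and D2: "\<And>y s. (y, s) \<in> tri x t \<Longrightarrow> duhamel u0 u1 w2 y s" and t: "0 \<le> t"
    and M: "\<And>y s. (y, s) \<in> tri x t \<Longrightarrow> \<bar>free_wave u0 u1 y s\<bar> \<le> M"
    and P: "(y, s) \<in> tri x t"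
  shows "w1 y s = w2 y s"
proof -
  obtain N1 where N1: "\<And>y s. (y, s) \<in> tri x t \<Longrightarrow> \<bar>w1 y s\<bar> \<le> N1"
    using duhamel_bounded[OF D1 t M] by blast
  obtain N2 where N2: "\<And>y s. (y, s) \<in> tri x t \<Longrightarrow> \<bar>w2 y s\<bar> \<le> N2"
    using duhamel_bounded[OF D2 t M] by blast
  define N where "N = max N1 N2"
  have N: "w1 y s \<le> N" "w2 y s \<le> N" if "(y, s) \<in> tri x t" for y s
    using N1[OF that] N2[OF that] by (auto simp: N_def)
  \<comment> \<open>Slices have length at most \<open>2 * t\<close>, \<open>exp\<close> has
    Lipschitz constant \<open>exp N\<close>, and integrating \<open>exp (lam * \<tau>)\<close>
    divides by \<open>lam\<close>. This choice makes the resulting factor at most 1, so the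
    \<open>1/2\<close> in Duhamel's formula is the contraction; the \<open>+ 1\<close> covers
    \<open>t = 0\<close>.\<close>
  define lam where "lam = 2 * t * exp N + 1"
  have lam: "lam > 0" using t by (simp add: lam_def add_nonneg_pos)
  have step: "\<bar>w1 y s - w2 y s\<bar> \<le> (B / 2) * exp (lam * s)"
    if P: "(y, s) \<in> tri x t" and B: "0 \<le> B" and
      IH: "\<And>y s. (y, s) \<in> tri x t \<Longrightarrow> \<bar>w1 y s - w2 y s\<bar> \<le> B * exp (lam * s)" for y s B
  proof -
    define J where "J w \<tau> = (LINT z:{y - s + \<tau>..y + s - \<tau>}|lebesgue. exp (w z \<tau>))" for w :: "real \<Rightarrow> real \<Rightarrow> real" and \<tau>
    have s: "0 \<le> s" "s \<le> t" using P by (auto simp: tri_def)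
    note d1 = D1[OF P, unfolded duhamel_def] and d2 = D2[OF P, unfolded duhamel_def]
    have Jd: "\<bar>J w1 \<tau> - J w2 \<tau>\<bar> \<le> 2 * t * exp N * B * exp (lam * \<tau>)" if \<tau>: "\<tau> \<in> {0..s}" for \<tau>
    proof -
      have i: "set_integrable lebesgue {y - s + \<tau>..y + s - \<tau>} (\<lambda>z. exp (w1 z \<tau>))"
        "set_integrable lebesgue {y - s + \<tau>..y + s - \<tau>} (\<lambda>z. exp (w2 z \<tau>))"
        using d1 d2 \<tau> by auto
      let ?c = "exp N * (B * exp (lam * \<tau>))"
      have "\<bar>LINT z:{y - s + \<tau>..y + s - \<tau>}|lebesgue. exp (w1 z \<tau>) - exp (w2 z \<tau>)\<bar>
          \<le> measure lborel {y - s + \<tau>..y + s - \<tau>} *\<^sub>R ?c"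
      proof (rule set_lint_bound[OF set_integral_diff(1)[OF i] has_integral_const_real])
        fix z assume "z \<in> {y - s + \<tau>..y + s - \<tau>}"
        then have Q: "(z, \<tau>) \<in> tri x t" using P \<tau> by (auto simp: tri_def)
        have "\<bar>exp (w1 z \<tau>) - exp (w2 z \<tau>)\<bar> \<le> exp N * \<bar>w1 z \<tau> - w2 z \<tau>\<bar>"
          by (rule exp_lipschitz[OF N[OF Q]])
        also have "\<dots> \<le> ?c" using IH[OF Q] by (intro mult_left_mono) auto
        finally show "\<bar>exp (w1 z \<tau>) - exp (w2 z \<tau>)\<bar> \<le> ?c" .
      qed
      also have "measure lborel {y - s + \<tau>..y + s - \<tau>} *\<^sub>R ?c \<le> (2 * t) * ?c"
        using \<tau> s B unfolding real_scaleR_def by (intro mult_right_mono) auto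
      finally show ?thesis unfolding J_def using i by (simp add: mult.assoc)
    qed
    have "((\<lambda>\<tau>. 2 * t * exp N * B * exp (lam * \<tau>)) has_integral
        (2 * t * exp N * B * (exp (lam * s) / lam) - 2 * t * exp N * B * (exp (lam * 0) / lam))) {0..s}"
      using lam by (intro fundamental_theorem_of_calculus s)
        (auto simp flip: has_real_derivative_iff_has_vector_derivative intro!: derivative_eq_intros)
    from set_lint_bound[OF set_integral_diff(1) this Jd]
    have "\<bar>LINT \<tau>:{0..s}|lebesgue. J w1 \<tau> - J w2 \<tau>\<bar> \<le> 2 * t * exp N * B * (exp (lam * s) / lam) - 2 * t * exp N * B * (exp (lam * 0) / lam)"
      using d1 d2 by (auto simp: J_def)
    also have "\<dots> \<le> 2 * t * exp N * B * (exp (lam * s) / lam)"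
      using t B lam by auto
    also have "\<dots> = (2 * t * exp N / lam) * (B * exp (lam * s))" by simp
    also have "\<dots> \<le> 1 * (B * exp (lam * s))"
      using lam t B by (intro mult_right_mono) (auto simp: lam_def)
    finally have "\<bar>(LINT \<tau>:{0..s}|lebesgue. J w1 \<tau>) - (LINT \<tau>:{0..s}|lebesgue. J w2 \<tau>)\<bar> \<le> B * exp (lam * s)"
      using d1 d2 by (simp add: J_def)
    moreover have "w1 y s - w2 y s = 1/2 * ((LINT \<tau>:{0..s}|lebesgue. J w1 \<tau>) - (LINT \<tau>:{0..s}|lebesgue. J w2 \<tau>))"
      using d1 d2 unfolding J_def by (simp add: algebra_simps)
    then have "\<bar>w1 y s - w2 y s\<bar> = 1/2 * \<bar>(LINT \<tau>:{0..s}|lebesgue. J w1 \<tau>) - (LINT \<tau>:{0..s}|lebesgue. J w2 \<tau>)\<bar>"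
      by (simp only: abs_mult)
    ultimately have "\<bar>w1 y s - w2 y s\<bar> \<le> B * exp (lam * s) / 2" by simp
    then show ?thesis by simp
  qed
  have iter: "\<forall>y s. (y, s) \<in> tri x t \<longrightarrow> \<bar>w1 y s - w2 y s\<bar> \<le> (\<bar>N1 + N2\<bar> / 2 ^ n) * exp (lam * s)" for n
  proof (induction n)
    case 0
    show ?case
    proof (intro allI impI)
      fix y s assume Q: "(y, s) \<in> tri x t"
      have "\<bar>w1 y s - w2 y s\<bar> \<le> \<bar>w1 y s\<bar> + \<bar>w2 y s\<bar>" by (rule abs_triangle_ineq4)
      also have "\<dots> \<le> N1 + N2" by (rule add_mono[OF N1[OF Q] N2[OF Q]])
      also have "\<dots> \<le> \<bar>N1 + N2\<bar> * 1" by simp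
      also have "\<dots> \<le> \<bar>N1 + N2\<bar> * exp (lam * s)" using lam Q by (intro mult_left_mono) (auto simp: tri_def)
      finally show "\<bar>w1 y s - w2 y s\<bar> \<le> (\<bar>N1 + N2\<bar> / 2 ^ 0) * exp (lam * s)" by simp
    qed
  next
    case (Suc n)
    then show ?case using step[of _ _ "\<bar>N1 + N2\<bar> / 2 ^ n"] by (simp add: field_simps)
  qed
  have "(\<lambda>n. (\<bar>N1 + N2\<bar> / 2 ^ n) * exp (lam * s)) \<longlonglongrightarrow> 0"
    by (intro tendsto_mult_left_zero LIMSEQ_divide_realpow_zero) simp
  then have "\<bar>w1 y s - w2 y s\<bar> \<le> 0"
    using iter P by (intro tendsto_lowerbound[where F = sequentially]) auto
  then show ?thesis by simp
qed

section \<open>Test functions\<close>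

lemma set_lint_support:
  fixes F :: "real \<Rightarrow> real"
  assumes "\<And>x. x \<in> T \<Longrightarrow> x \<notin> S \<Longrightarrow> F x = 0" "S \<subseteq> T"
  shows "(LINT x:T|M. F x) = (LINT x:S|M. F x)"
    and "set_integrable M T F \<longleftrightarrow> set_integrable M S F"
proof -
  have "(\<lambda>x. indicator T x *\<^sub>R F x) = (\<lambda>x. indicator S x *\<^sub>R F x)"
    using assms by (auto simp: indicator_def fun_eq_iff)
  then show "(LINT x:T|M. F x) = (LINT x:S|M. F x)"
    and "set_integrable M T F \<longleftrightarrow> set_integrable M S F"
    by (simp_all only: set_lebesgue_integral_def set_integrable_def)
qed

lemma set_integrable_lebesgue_continuous:
  fixes F :: "real \<Rightarrow> real"
  assumes "continuous_on {a..b} F"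
  shows "set_integrable lebesgue {a..b} F"
  using borel_integrable_atLeastAtMost'[OF assms]
  by (simp add: set_integrable_def integrable_completion)

lemma set_integrable_mult_continuous:
  fixes F G :: "real \<Rightarrow> real"
  assumes F: "set_integrable lebesgue {a..b} F" and G: "continuous_on {a..b} G"
  shows "set_integrable lebesgue {a..b} (\<lambda>x. F x * G x)"
proof -
  have "bounded (G ` {a..b})"
    by (rule compact_imp_bounded[OF compact_continuous_image[OF G compact_Icc]])
  then obtain B where "\<forall>y\<in>G ` {a..b}. norm y \<le> B" unfolding bounded_iff by blast
  then have B: "\<And>x. x \<in> {a..b} \<Longrightarrow> \<bar>G x\<bar> \<le> B" by simp
  have m: "(\<lambda>x. indicator {a..b} x * F x) \<in> borel_measurable lebesgue"
    "(\<lambda>x. indicator {a..b} x * G x) \<in> borel_measurable lebesgue"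
    using F set_integrable_lebesgue_continuous[OF G]
    by (auto simp: set_integrable_def dest: borel_measurable_integrable)
  have "integrable lebesgue (\<lambda>x. B * (indicator {a..b} x * F x))"
    using F by (simp add: set_integrable_def)
  then show ?thesis unfolding set_integrable_def
  proof (rule Bochner_Integration.integrable_bound)
    have "(\<lambda>x. (indicator {a..b} x * F x) * (indicator {a..b} x * G x)) \<in> borel_measurable lebesgue"
      using m by (rule borel_measurable_times)
    then show "(\<lambda>x. indicator {a..b} x *\<^sub>R (F x * G x)) \<in> borel_measurable lebesgue"
      by (rule back_subst[of "\<lambda>f. f \<in> _"]) (auto simp: indicator_def)
    show "AE x in lebesgue. norm (indicator {a..b} x *\<^sub>R (F x * G x)) \<le> norm (B * (indicator {a..b} x * F x))"
    proof (rule AE_I2)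
      fix x
      show "norm (indicator {a..b} x *\<^sub>R (F x * G x)) \<le> norm (B * (indicator {a..b} x * F x))"
      proof (cases "x \<in> {a..b}")
        case True
        have "\<bar>F x\<bar> * \<bar>G x\<bar> \<le> \<bar>F x\<bar> * \<bar>B\<bar>"
          using order_trans[OF B[OF True] abs_ge_self] by (rule mult_left_mono) simp
        then show ?thesis using True by (simp add: abs_mult mult.commute)
      qed simp
    qed
  qed
qed

lemma set_lint_tendsto_bounded:
  fixes F :: "real \<Rightarrow> real" and G :: "nat \<Rightarrow> real \<Rightarrow> real"
  assumes F: "set_integrable lebesgue {a..b} F"
    and G: "\<And>n. continuous_on {a..b} (G n)" and B: "\<And>n x. x \<in> {a..b} \<Longrightarrow> \<bar>G n x\<bar> \<le> 1"
    and lim: "\<And>x. x \<in> {a<..<b} \<Longrightarrow> (\<lambda>n. G n x) \<longlonglongrightarrow> 1"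
  shows "(\<lambda>n. LINT x:{a..b}|lebesgue. F x * G n x) \<longlonglongrightarrow> (LINT x:{a..b}|lebesgue. F x)"
  unfolding set_lebesgue_integral_def
proof (rule integral_dominated_convergence[where w = "\<lambda>x. \<bar>indicator {a..b} x * F x\<bar>"])
  show "(\<lambda>x. indicator {a..b} x *\<^sub>R F x) \<in> borel_measurable lebesgue"
    "integrable lebesgue (\<lambda>x. \<bar>indicator {a..b} x * F x\<bar>)"
    using F by (auto simp: set_integrable_def)
  show "(\<lambda>x. indicator {a..b} x *\<^sub>R (F x * G n x)) \<in> borel_measurable lebesgue" for n
    using set_integrable_mult_continuous[OF F G] by (auto simp: set_integrable_def)
  show "AE x in lebesgue. norm (indicator {a..b} x *\<^sub>R (F x * G n x)) \<le> \<bar>indicator {a..b} x * F x\<bar>" for n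
    using B by (intro AE_I2) (auto simp: indicator_def abs_mult intro!: mult_left_le)
  have "AE x in lebesgue. x \<noteq> a" "AE x in lebesgue. x \<noteq> b"
    by (auto intro!: AE_completion AE_lborel_singleton)
  then show "AE x in lebesgue. (\<lambda>n. indicator {a..b} x *\<^sub>R (F x * G n x)) \<longlonglongrightarrow> indicator {a..b} x *\<^sub>R F x"
  proof eventually_elim
    case (elim x)
    show ?case
    proof (cases "x \<in> {a<..<b}")
      case True
      show ?thesis using tendsto_mult[OF tendsto_const[of "F x"] lim[OF True]] True by simp
    next
      case False
      then show ?thesis using elim by (auto simp: indicator_def)
    qed
  qed
qed

text \<open>The support is enlarged to an interval whose end points lie strictly outside it. The
  function and its derivative then both vanish at \<open>c\<close> and \<open>d\<close>, and
  integration by parts leaves no boundary terms.\<close>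

lemma test_functionE:
  assumes "test_function {l<..<r} \<phi>" "l < r"
  obtains c d D where "l < c" "c < d" "d < r"
    "\<And>x. (\<phi> has_real_derivative D x) (at x)" "continuous_on UNIV D"
    "\<And>x. x \<notin> {c<..<d} \<Longrightarrow> \<phi> x = 0" "\<And>x. x \<notin> {c<..<d} \<Longrightarrow> D x = 0" "deriv \<phi> = D"
proof -
  define K where "K = closure {x. \<phi> x \<noteq> 0}"
  obtain D where D: "\<And>x. (\<phi> has_real_derivative D x) (at x)" and cD: "continuous_on UNIV D"
    using assms unfolding test_function_def C1_differentiable_on_def
    by (auto simp: has_real_derivative_iff_has_vector_derivative)
  have K: "compact K" "K \<subseteq> {l<..<r}" using assms by (auto simp: test_function_def K_def)
  obtain c d where cd: "l < c" "c < d" "d < r" "K \<subseteq> {c<..<d}"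
  proof (cases "K = {}")
    case True
    show ?thesis using assms(2) True
      by (intro that[of "(2 * l + r) / 3" "(l + 2 * r) / 3"]) (auto simp: field_simps)
  next
    case False
    obtain m where m: "m \<in> K" "\<And>x. x \<in> K \<Longrightarrow> m \<le> x" using compact_attains_inf[OF K(1) False] by blast
    obtain M where M: "M \<in> K" "\<And>x. x \<in> K \<Longrightarrow> x \<le> M" using compact_attains_sup[OF K(1) False] by blast
    have b: "l < m" "M < r" using m(1) M(1) K(2) by auto
    have "m \<le> M" using m M by blast
    show ?thesis
    proof (rule that[of "(l + m) / 2" "(M + r) / 2"])
      show "K \<subseteq> {(l + m) / 2<..<(M + r) / 2}"
      proof
        fix x assume "x \<in> K"
        then show "x \<in> {(l + m) / 2<..<(M + r) / 2}" using m(2)[of x] M(2)[of x] b by (auto simp: field_simps)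
      qed
    qed (use b \<open>m \<le> M\<close> in \<open>auto simp: field_simps\<close>)
  qed
  have out: "\<phi> x = 0" if "x \<notin> K" for x using that closure_subset[of "{x. \<phi> x \<noteq> 0}"] unfolding K_def by blast
  show ?thesis
  proof (rule that[OF cd(1-3) D cD])
    fix x assume x: "x \<notin> {c<..<d}"
    then have xK: "x \<in> - K" using cd(4) by auto
    show "\<phi> x = 0" using xK out by auto
    have "eventually (\<lambda>y. y \<in> - K) (nhds x)"
      using xK by (intro eventually_nhds_in_open) (auto simp: K_def)
    then have "eventually (\<lambda>y. \<phi> y = 0) (nhds x)" by (rule eventually_mono) (use out in simp)
    then have "((\<lambda>y. 0) has_real_derivative D x) (at x)"
      using D[of x] by (subst (asm) DERIV_cong_ev[OF refl _ refl]) auto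
    then show "D x = 0" by (rule DERIV_unique[OF _ DERIV_const])
  next
    show "deriv \<phi> = D" by (rule ext) (rule DERIV_imp_deriv[OF D])
  qed
qed

lemma test_functionI:
  assumes D: "\<And>x. (\<phi> has_real_derivative D x) (at x)" "continuous_on UNIV D"
    and 0: "\<And>x. x \<notin> {c..d} \<Longrightarrow> \<phi> x = 0" and J: "{c..d} \<subseteq> J"
  shows "test_function J \<phi>"
proof -
  have sub: "closure {x. \<phi> x \<noteq> 0} \<subseteq> {c..d}" by (rule closure_minimal) (use 0 in blast, simp)
  have "compact (closure {x. \<phi> x \<noteq> 0})"
    unfolding compact_eq_bounded_closed using bounded_subset[OF _ sub] by auto
  then show ?thesis
    using D sub J unfolding test_function_def C1_differentiable_on_def
    by (auto simp: has_real_derivative_iff_has_vector_derivative)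
qed

lemma test_function_subset: "test_function J \<phi> \<Longrightarrow> J \<subseteq> J' \<Longrightarrow> test_function J' \<phi>"
  by (auto simp: test_function_def)

text \<open>The functions \<open>n k / (1 + n k)\<close> with \<open>k(x) = (x - a)\<^sup>2 (b - x)\<^sup>2\<close> on \<open>[a, b]\<close> increase to
  the indicator of \<open>(a, b)\<close>.\<close>

lemma test_functions_approx_interval:
  assumes "a < b" "{a..b} \<subseteq> J"
  obtains G :: "nat \<Rightarrow> real \<Rightarrow> real" where "\<And>n. test_function J (G n)" "\<And>n. continuous_on UNIV (G n)"
    "\<And>n x. \<bar>G n x\<bar> \<le> 1" "\<And>n x. x \<notin> {a..b} \<Longrightarrow> G n x = 0"
    "\<And>x. x \<in> {a<..<b} \<Longrightarrow> (\<lambda>n. G n x) \<longlonglongrightarrow> 1"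
proof -
  define m where "m x = max 0 ((x - a) * (b - x))" for x
  define dm where "dm x = 2 * m x * (a + b - 2 * x)" for x
  \<comment> \<open>The square of a positive part is continuously differentiable: at the kink its
    difference quotient is bounded by the increment.\<close>
  have m_sq: "((\<lambda>x. (m x)\<^sup>2) has_real_derivative dm x) (at x)" for x
  proof -
    let ?j = "\<lambda>x. (x - a) * (b - x)"
    have j: "(?j has_real_derivative (a + b - 2 * x)) (at x)" for x
      by (auto intro!: derivative_eq_intros simp: algebra_simps)
    have sq: "((\<lambda>y. (max 0 y)\<^sup>2) has_real_derivative 2 * max 0 y) (at y)" for y :: real
    proof -
      have "((\<lambda>z. (max 0 z)\<^sup>2) has_real_derivative 2 * max 0 y) (at y)" if "y > 0"
      proof -
        have "((\<lambda>z. z\<^sup>2) has_real_derivative 2 * max 0 y) (at y)"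
          using that by (auto intro!: derivative_eq_intros)
        moreover have "eventually (\<lambda>z. z > 0) (nhds y)"
          using that eventually_nhds_in_open[of "{0<..}" y] by simp
        then have "eventually (\<lambda>z. (max 0 z)\<^sup>2 = z\<^sup>2) (nhds y)" by eventually_elim simp
        ultimately show ?thesis by (subst DERIV_cong_ev[OF refl _ refl])
      qed
      moreover have "((\<lambda>z. (max 0 z)\<^sup>2) has_real_derivative 2 * max 0 y) (at y)" if "y < 0"
      proof -
        have "((\<lambda>z. 0) has_real_derivative 2 * max 0 y) (at y)"
          using that by (auto intro!: derivative_eq_intros)
        moreover have "eventually (\<lambda>z. z < 0) (nhds y)"
          using that eventually_nhds_in_open[of "{..<0}" y] by simp
        then have "eventually (\<lambda>z. (max 0 z)\<^sup>2 = 0) (nhds y)" by eventually_elim simp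
        ultimately show ?thesis by (subst DERIV_cong_ev[OF refl _ refl])
      qed
      moreover have "((\<lambda>z::real. (max 0 z)\<^sup>2) has_real_derivative 0) (at 0)"
      proof -
        have "((\<lambda>h::real. (max 0 h)\<^sup>2 / h) \<longlongrightarrow> 0) (at 0)"
        proof (rule Lim_null_comparison)
          show "eventually (\<lambda>h::real. norm ((max 0 h)\<^sup>2 / h) \<le> \<bar>h\<bar>) (at 0)"
            by (intro always_eventually) (auto simp: max_def power2_eq_square)
          show "((\<lambda>h::real. \<bar>h\<bar>) \<longlongrightarrow> 0) (at 0)" by (intro tendsto_eq_intros) auto
        qed
        then show ?thesis by (simp add: DERIV_def)
      qed
      ultimately show ?thesis by (cases "y = 0"; cases "y > 0") auto
    qed
    show ?thesis
      using DERIV_chain2[of "\<lambda>y. (max 0 y)\<^sup>2" "2 * max 0 (?j x)" ?j x, OF sq j]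
      by (simp add: m_def dm_def)
  qed
  have cm: "continuous_on UNIV m" "continuous_on UNIV dm"
    unfolding dm_def m_def by (intro continuous_intros)+
  define G where "G n x = real n * (m x)\<^sup>2 / (1 + real n * (m x)\<^sup>2)" for n x
  have den: "1 + real n * (m x)\<^sup>2 > 0" for n x by (intro add_pos_nonneg) auto
  have dG: "(G n has_real_derivative (real n * dm x) / (1 + real n * (m x)\<^sup>2)\<^sup>2) (at x)" for n x
  proof -
    have n: "((\<lambda>x. real n * (m x)\<^sup>2) has_real_derivative real n * dm x) (at x)"
      by (rule DERIV_cmult[OF m_sq])
    have "((\<lambda>x. 1 + real n * (m x)\<^sup>2) has_real_derivative 0 + real n * dm x) (at x)"
      by (rule DERIV_add[OF DERIV_const n])
    from DERIV_divide[OF n this] have "(G n has_real_derivative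
      (real n * dm x * (1 + real n * (m x)\<^sup>2) - real n * (m x)\<^sup>2 * (0 + real n * dm x))
        / ((1 + real n * (m x)\<^sup>2) * (1 + real n * (m x)\<^sup>2))) (at x)"
      unfolding G_def using den[of n x] by simp
    moreover have "real n * dm x * (1 + real n * (m x)\<^sup>2) - real n * (m x)\<^sup>2 * (0 + real n * dm x) = real n * dm x"
      by (simp add: algebra_simps)
    ultimately show ?thesis by (simp add: power2_eq_square)
  qed
  have cdG: "continuous_on UNIV (\<lambda>x. (real n * dm x) / (1 + real n * (m x)\<^sup>2)\<^sup>2)" for n
    using den[of n] by (intro continuous_intros cm) (auto simp: less_imp_neq[THEN not_sym])
  have m0: "m x = 0" if "x \<notin> {a..b}" for x
    using that assms(1) mult_nonneg_nonpos[of "x - a" "b - x"] mult_nonpos_nonneg[of "x - a" "b - x"]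
    by (auto simp: m_def max_def)
  have mpos: "m x > 0" if "x \<in> {a<..<b}" for x using that by (simp add: m_def less_max_iff_disj)
  have G0: "G n x = 0" if "x \<notin> {a..b}" for n x by (simp add: G_def m0[OF that])
  show ?thesis
  proof (rule that[of G])
    show "test_function J (G n)" for n by (rule test_functionI[OF dG cdG G0 assms(2)])
    show "continuous_on UNIV (G n)" for n
      using dG by (intro continuous_at_imp_continuous_on ballI) (blast intro: DERIV_isCont)
    show "\<bar>G n x\<bar> \<le> 1" for n x
      using den[of n x] unfolding G_def by (subst abs_of_nonneg) auto
    show "G n x = 0" if "x \<notin> {a..b}" for n x by (rule G0[OF that])
    show "(\<lambda>n. G n x) \<longlonglongrightarrow> 1" if "x \<in> {a<..<b}" for x
    proof -
      have "(m x)\<^sup>2 > 0" using mpos[OF that] by simp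
      then have "((\<lambda>n. real n * (m x)\<^sup>2 / (1 + real n * (m x)\<^sup>2)) \<longlonglongrightarrow> 1)"
        by real_asymp
      then show ?thesis by (simp add: G_def)
    qed
  qed
qed

section \<open>Weak derivatives and their uniqueness\<close>

text \<open>The compact intervals generate the Borel sets and are stable under intersection, so a
  density that integrates to 0 over all of them integrates to 0 over every Borel set, and is 0
  almost everywhere. The argument runs on a Borel version \<open>F\<close> of \<open>g\<close> cut
  off outside \<open>{A..B}\<close>.\<close>

lemma zero_integrals_imp_AE_zero:
  fixes g :: "real \<Rightarrow> real"
  assumes g: "set_integrable lebesgue {A..B} g"
    and 0: "\<And>a b. A \<le> a \<Longrightarrow> a < b \<Longrightarrow> b \<le> B \<Longrightarrow> (LINT x:{a..b}|lebesgue. g x) = 0"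
  shows "AE x in lebesgue. x \<in> {A..B} \<longrightarrow> g x = 0"
proof -
  let ?F = "\<lambda>x. indicator {A..B} x * g x"
  have intF: "integrable lebesgue ?F" using g by (simp add: set_integrable_def)
  then obtain F where F: "F \<in> borel_measurable lborel" "AE x in lborel. ?F x = F x"
    using completion_ex_borel_measurable_real borel_measurable_integrable by blast
  have AEF: "AE x in lebesgue. F x = ?F x" using AE_completion[OF F(2)] by eventually_elim simp
  have iF: "integrable lborel F"
    using intF F AEF by (subst integrable_completion[symmetric])
      (auto intro: integrable_cong_AE_imp simp: measurable_completion)
  have null: "integral {p..q} g = 0" if "\<not> p < q" for p q
    using that by (intro integral_unique has_integral_null_real) simp
  \<comment> \<open>Clipping to \<open>{A..B}\<close> leaves either a proper subinterval, covered by
    the hypothesis, or a set with at most one point.\<close>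
  have basic: "(LINT x:{a..b}|lborel. F x) = 0" for a b
  proof -
    have "(LINT x:{a..b}|lborel. F x) = (LINT x:{a..b}|lebesgue. F x)"
      unfolding set_lebesgue_integral_def using F by (subst integral_completion) auto
    also have "\<dots> = (LINT x:{a..b}|lebesgue. ?F x)"
      unfolding set_lebesgue_integral_def
    proof (rule integral_cong_AE)
      show "(\<lambda>x. indicat_real {a..b} x *\<^sub>R F x) \<in> borel_measurable lebesgue"
        using F by (intro measurable_completion) auto
      have "?F \<in> borel_measurable lebesgue" using intF by auto
      then show "(\<lambda>x. indicat_real {a..b} x *\<^sub>R ?F x) \<in> borel_measurable lebesgue"
        by (rule borel_measurable_scaleR[OF borel_measurable_indicator, rotated]) simp
    qed (use AEF in \<open>eventually_elim, simp\<close>)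
    also have "\<dots> = (LINT x:{max a A..min b B}|lebesgue. g x)"
      unfolding set_lebesgue_integral_def
      by (intro Bochner_Integration.integral_cong) (auto simp: indicator_def)
    also have "\<dots> = 0"
    proof (cases "max a A < min b B")
      case True
      then show ?thesis by (intro 0) auto
    next
      case False
      have "set_integrable lebesgue {max a A..min b B} g"
        by (rule set_integrable_subset[OF g]) auto
      note set_lebesgue_integral_eq_integral(2)[OF this]
      also have "integral {max a A..min b B} g = 0"
        using False by (rule null)
      finally show ?thesis .
    qed
    finally show ?thesis .
  qed
  have all: "(LINT x|lborel. F x) = 0"
  proof -
    have "(LINT x|lborel. F x) = (LINT x|lebesgue. F x)" using F by (simp add: integral_completion)
    also have "\<dots> = (LINT x|lebesgue. ?F x)"
      using intF F AEF by (intro integral_cong_AE) (auto simp: measurable_completion)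
    also have "\<dots> = (LINT x|lebesgue. indicator {A..B} x * ?F x)"
      by (intro Bochner_Integration.integral_cong) (auto simp: indicator_def)
    also have "\<dots> = (LINT x|lebesgue. indicator {A..B} x * F x)"
    proof (rule integral_cong_AE)
      have "?F \<in> borel_measurable lebesgue" using intF by auto
      then show "(\<lambda>x. indicat_real {A..B} x * ?F x) \<in> borel_measurable lebesgue"
        by (rule borel_measurable_times[OF borel_measurable_indicator, rotated]) simp
      show "(\<lambda>x. indicat_real {A..B} x * F x) \<in> borel_measurable lebesgue"
        using F by (intro measurable_completion) auto
    qed (use AEF in \<open>eventually_elim, simp\<close>)
    also have "\<dots> = (LINT x:{A..B}|lborel. F x)"
      unfolding set_lebesgue_integral_def using F by (subst integral_completion) auto
    finally show ?thesis using basic by simp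
  qed
  have "(LINT x:S|lborel. F x) = 0" if "S \<in> sets borel" for S
  proof -
    let ?G = "range (\<lambda>(a,b). {a..b::real})"
    have "Int_stable ?G" by (auto simp: Int_stable_def)
    moreover have "?G \<subseteq> Pow UNIV" by simp
    moreover have "S \<in> sigma_sets UNIV ?G" using that by (simp add: borel_eq_atLeastAtMost)
    ultimately show ?thesis
    proof (induction rule: sigma_sets_induct_disjoint)
      case (basic S) then show ?case using \<open>\<And>a b. (LINT x:{a..b}|lborel. F x) = 0\<close> by auto
    next
      case empty show ?case by (simp add: set_lebesgue_integral_def)
    next
      case (compl S)
      have S: "S \<in> sets borel" using compl(1) by (simp add: borel_eq_atLeastAtMost)
      have i: "set_integrable lborel S F" "set_integrable lborel (UNIV - S) F"
        unfolding set_integrable_def by (intro integrable_mult_indicator[OF _ iF]; use S in simp)+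
      have "(LINT x:S \<union> (UNIV - S)|lborel. F x) = (LINT x:S|lborel. F x) + (LINT x:UNIV - S|lborel. F x)"
        by (rule set_integral_Un[OF _ i]) auto
      then show ?case using compl all by (simp add: set_lebesgue_integral_def)
    next
      case (union S)
      have S: "S i \<in> sets lborel" for i using union(2) by (auto simp: borel_eq_atLeastAtMost)
      have "(LINT x:(\<Union>i. S i)|lborel. F x) = (\<Sum>i. LINT x:S i|lborel. F x)"
      proof (rule lebesgue_integral_countable_add[OF S])
        show "set_integrable lborel (\<Union>i. S i) F"
          unfolding set_integrable_def by (rule integrable_mult_indicator[OF _ iF]) (use S in auto)
      qed (use union(1) in \<open>auto simp: disjoint_family_on_def\<close>)
      then show ?case using union(3) by simp
    qed
  qed
  then have "AE x in lborel. F x = 0"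
    by (intro density_unique_real[OF iF]) auto
  from AE_completion[OF this] AEF show ?thesis
    by eventually_elim auto
qed

text \<open>The two shapes that occur: the whole line for the data, bounded intervals for sections
  of cones and for the similarity variable.\<close>

definition open_ivl :: "real set \<Rightarrow> bool" where
  "open_ivl J \<longleftrightarrow> J = UNIV \<or> (\<exists>l r. l < r \<and> J = {l<..<r})"

lemma open_ivl_simps [simp]: "open_ivl UNIV" "l < r \<Longrightarrow> open_ivl {l<..<r}"
  by (auto simp: open_ivl_def)

lemma test_function_ivlE:
  assumes "test_function J \<phi>" "open_ivl J"
  obtains c d D where "c < d" "{c..d} \<subseteq> J"
    "\<And>x. (\<phi> has_real_derivative D x) (at x)" "continuous_on UNIV D"
    "\<And>x. x \<notin> {c<..<d} \<Longrightarrow> \<phi> x = 0" "\<And>x. x \<notin> {c<..<d} \<Longrightarrow> D x = 0" "deriv \<phi> = D"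
proof -
  obtain l r where lr: "l < r" "{l<..<r} \<subseteq> J" "test_function {l<..<r} \<phi>"
  proof (cases "J = UNIV")
    case True
    have "bounded (closure {x. \<phi> x \<noteq> 0})"
      using assms(1) by (auto simp: test_function_def compact_imp_bounded)
    then obtain M where "\<forall>x\<in>closure {x. \<phi> x \<noteq> 0}. norm x \<le> M" unfolding bounded_iff by blast
    then have "closure {x. \<phi> x \<noteq> 0} \<subseteq> {-M..M}" by (auto simp: abs_le_iff)
    then have "closure {x. \<phi> x \<noteq> 0} \<subseteq> {- \<bar>M\<bar> - 1<..<\<bar>M\<bar> + 1}"
      by (rule order_trans) auto
    then show ?thesis using assms(1) True
      by (intro that[of "- \<bar>M\<bar> - 1" "\<bar>M\<bar> + 1"]) (auto simp: test_function_def)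
  next
    case False
    then show ?thesis using assms that by (auto simp: open_ivl_def)
  qed
  obtain c d D where *: "l < c" "c < d" "d < r"
    "\<And>x. (\<phi> has_real_derivative D x) (at x)" "continuous_on UNIV D"
    "\<And>x. x \<notin> {c<..<d} \<Longrightarrow> \<phi> x = 0" "\<And>x. x \<notin> {c<..<d} \<Longrightarrow> D x = 0" "deriv \<phi> = D"
    by (rule test_functionE[OF lr(3,1)]) blast
  have "{c..d} \<subseteq> J" using * lr by (auto intro!: subsetD[OF lr(2)])
  then show ?thesis using that * by blast
qed

text \<open>The fundamental lemma of the calculus of variations: testing with functions that
  increase to the indicator of an interval shows that all integrals over compact subintervals
  vanish.\<close>

lemma weak_zero_imp_AE_zero:
  assumes J: "open_ivl J" and g: "loc_integrable_on J g"
    and 0: "\<And>\<phi>. test_function J \<phi> \<Longrightarrow> (LINT x:J|lebesgue. g x * \<phi> x) = 0"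
  shows "AE x in lebesgue. x \<in> J \<longrightarrow> g x = 0"
proof -
  have sub: "AE x in lebesgue. x \<in> {A..B} \<longrightarrow> g x = 0" if AB: "{A..B} \<subseteq> J" for A B
  proof (rule zero_integrals_imp_AE_zero)
    show gi: "set_integrable lebesgue {A..B} g"
      using g AB by (auto simp: loc_integrable_on_def)
    fix a b assume ab: "A \<le> a" "a < b" "b \<le> B"
    have abJ: "{a..b} \<subseteq> J" using ab AB by auto
    obtain G where G: "\<And>n. test_function J (G n)" "\<And>n. continuous_on UNIV (G n)"
      "\<And>n x. \<bar>G n x\<bar> \<le> 1" "\<And>n x. x \<notin> {a..b} \<Longrightarrow> G n x = 0"
      "\<And>x. x \<in> {a<..<b} \<Longrightarrow> (\<lambda>n. G n x) \<longlonglongrightarrow> 1"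
      by (rule test_functions_approx_interval[OF ab(2) abJ]) blast
    have "(\<lambda>n. LINT x:{a..b}|lebesgue. g x * G n x) \<longlonglongrightarrow> (LINT x:{a..b}|lebesgue. g x)"
      using ab G by (intro set_lint_tendsto_bounded set_integrable_subset[OF gi])
        (auto intro: continuous_on_subset)
    moreover have "(LINT x:{a..b}|lebesgue. g x * G n x) = 0" for n
      using 0[OF G(1)[of n]] G(4) by (subst (asm) set_lint_support(1)[OF _ abJ]) auto
    ultimately show "(LINT x:{a..b}|lebesgue. g x) = 0" by (simp add: LIMSEQ_const_iff)
  qed
  \<comment> \<open>Countably many compact intervals exhaust \<open>J\<close>, so the exceptional
    null sets can be united.\<close>
  have "\<exists>A B :: nat \<Rightarrow> real. (\<forall>n. {A n..B n} \<subseteq> J) \<and> J \<subseteq> (\<Union>n. {A n..B n})"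
  proof (cases "J = UNIV")
    case True
    have "\<exists>n::nat. - real n \<le> x \<and> x \<le> real n" for x
    proof -
      obtain n where "\<bar>x\<bar> \<le> real n" using real_arch_simple by blast
      then show ?thesis by (intro exI[of _ n]) (auto simp: abs_le_iff)
    qed
    then show ?thesis using True by (intro exI[of _ "\<lambda>n. - real n"] exI[of _ real]) auto
  next
    case False
    then obtain l r where lr: "l < r" "J = {l<..<r}" using J by (auto simp: open_ivl_def)
    have "\<exists>n. l + 1 / Suc n \<le> x \<and> x \<le> r - 1 / Suc n" if "l < x" "x < r" for x
    proof -
      have "min (x - l) (r - x) > 0" using that by simp
      then obtain n where "1 / Suc n < min (x - l) (r - x)" using nat_approx_posE by blast
      then show ?thesis by (intro exI[of _ n]) auto
    qed
    then have cover: "J \<subseteq> (\<Union>n. {l + 1 / Suc n..r - 1 / Suc n})" using lr by auto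
    have inside: "{l + 1 / Suc n..r - 1 / Suc n} \<subseteq> J" for n
    proof
      fix x assume x: "x \<in> {l + 1 / Suc n..r - 1 / Suc n}"
      have "1 / real (Suc n) > 0" by simp
      then show "x \<in> J" using x unfolding lr(2) greaterThanLessThan_iff atLeastAtMost_iff by linarith
    qed
    show ?thesis using cover inside
      by (intro exI[of _ "\<lambda>n. l + 1 / Suc n"] exI[of _ "\<lambda>n. r - 1 / Suc n"]) simp
  qed
  then obtain A B :: "nat \<Rightarrow> real" where AB: "\<And>n. {A n..B n} \<subseteq> J" "J \<subseteq> (\<Union>n. {A n..B n})" by blast
  have "AE x in lebesgue. \<forall>n. x \<in> {A n..B n} \<longrightarrow> g x = 0"
    unfolding AE_all_countable using sub[OF AB(1)] by blast
  then show ?thesis by eventually_elim (use AB(2) in blast)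
qed

lemma test_set_integrable:
  assumes "open_ivl J" "loc_integrable_on J f" "test_function J \<phi>"
  shows "set_integrable lebesgue J (\<lambda>x. f x * \<phi> x)" "set_integrable lebesgue J (\<lambda>x. f x * deriv \<phi> x)"
proof -
  obtain c d D where *: "c < d" "{c..d} \<subseteq> J"
    "\<And>x. (\<phi> has_real_derivative D x) (at x)" "continuous_on UNIV D"
    "\<And>x. x \<notin> {c<..<d} \<Longrightarrow> \<phi> x = 0" "\<And>x. x \<notin> {c<..<d} \<Longrightarrow> D x = 0" "deriv \<phi> = D"
    by (rule test_function_ivlE[OF assms(3,1)]) blast
  have f: "set_integrable lebesgue {c..d} f" using assms(2) *(2) by (auto simp: loc_integrable_on_def)
  have c: "continuous_on UNIV \<phi>" using *(3) by (intro continuous_at_imp_continuous_on ballI DERIV_isCont)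
  show "set_integrable lebesgue J (\<lambda>x. f x * \<phi> x)"
    using set_integrable_mult_continuous[OF f continuous_on_subset[OF c]] *(5)
    by (subst set_lint_support(2)[OF _ *(2)]) auto
  show "set_integrable lebesgue J (\<lambda>x. f x * deriv \<phi> x)"
    using set_integrable_mult_continuous[OF f continuous_on_subset[OF *(4)]] *(6)
    unfolding *(7) by (subst set_lint_support(2)[OF _ *(2)]) auto
qed

section \<open>Calculus of weak space and time derivatives\<close>

lemma loc_integrable_on_add:
  "loc_integrable_on J f \<Longrightarrow> loc_integrable_on J g \<Longrightarrow> loc_integrable_on J (\<lambda>x. f x + g x)"
  by (auto simp: loc_integrable_on_def)

lemma loc_integrable_on_cmult:
  "loc_integrable_on J f \<Longrightarrow> loc_integrable_on J (\<lambda>x. c * f x)"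
  by (auto simp: loc_integrable_on_def)

lemma loc_integrable_on_subset:
  "loc_integrable_on J f \<Longrightarrow> J' \<subseteq> J \<Longrightarrow> loc_integrable_on J' f"
  by (auto simp: loc_integrable_on_def)

text \<open>This and its analogue in time make the choice in \<open>space_deriv\<close> and
  \<open>time_deriv\<close> harmless: the chosen function agrees almost everywhere with any
  derivative that can be written down.\<close>

lemma has_weak_deriv_unique:
  assumes J: "open_ivl J" and g: "has_weak_deriv J f g" "has_weak_deriv J f g'"
  shows "AE x in lebesgue. x \<in> J \<longrightarrow> g x = g' x"
proof -
  have l: "loc_integrable_on J g" "loc_integrable_on J g'" using g by (auto simp: has_weak_deriv_def)
  have "loc_integrable_on J (\<lambda>x. - 1 * g' x)" by (rule loc_integrable_on_cmult[OF l(2)])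
  then have "loc_integrable_on J (\<lambda>x. g x - g' x)" using loc_integrable_on_add[OF l(1)] by fastforce
  moreover have "(LINT x:J|lebesgue. (g x - g' x) * \<phi> x) = 0" if \<phi>: "test_function J \<phi>" for \<phi>
    using g \<phi> set_integral_diff(2)[OF test_set_integrable(1)[OF J l(1) \<phi>] test_set_integrable(1)[OF J l(2) \<phi>]]
    by (auto simp: has_weak_deriv_def left_diff_distrib)
  ultimately have "AE x in lebesgue. x \<in> J \<longrightarrow> g x - g' x = 0" by (rule weak_zero_imp_AE_zero[OF J])
  then show ?thesis by eventually_elim simp
qed

text \<open>For a fixed test function the pairing is an ordinary derivative, unique as soon as
  \<open>t\<close> is an accumulation point of \<open>A\<close>.\<close>

lemma has_time_deriv_unique:
  assumes J: "open_ivl J" and A: "at t within A \<noteq> bot"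
    and g: "has_time_deriv J A f t g" "has_time_deriv J A f t g'"
  shows "AE x in lebesgue. x \<in> J \<longrightarrow> g x = g' x"
proof -
  have l: "loc_integrable_on J g" "loc_integrable_on J g'" using g by (auto simp: has_time_deriv_def)
  have "loc_integrable_on J (\<lambda>x. - 1 * g' x)" by (rule loc_integrable_on_cmult[OF l(2)])
  then have "loc_integrable_on J (\<lambda>x. g x - g' x)" using loc_integrable_on_add[OF l(1)] by fastforce
  moreover have "(LINT x:J|lebesgue. (g x - g' x) * \<phi> x) = 0" if \<phi>: "test_function J \<phi>" for \<phi>
  proof -
    have "(LINT x:J|lebesgue. g x * \<phi> x) = (LINT x:J|lebesgue. g' x * \<phi> x)"
      using g \<phi> A by (auto simp: has_time_deriv_def has_field_derivative_iff intro: tendsto_unique[OF A])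
    then show ?thesis
      using set_integral_diff(2)[OF test_set_integrable(1)[OF J l(1) \<phi>] test_set_integrable(1)[OF J l(2) \<phi>]]
      by (auto simp: left_diff_distrib)
  qed
  ultimately have "AE x in lebesgue. x \<in> J \<longrightarrow> g x - g' x = 0" by (rule weak_zero_imp_AE_zero[OF J])
  then show ?thesis by eventually_elim simp
qed

lemma has_weak_deriv_add:
  assumes J: "open_ivl J" and f: "has_weak_deriv J f f'" "has_weak_deriv J g g'"
  shows "has_weak_deriv J (\<lambda>x. f x + g x) (\<lambda>x. f' x + g' x)"
  unfolding has_weak_deriv_def
proof (intro conjI allI impI)
  have l: "loc_integrable_on J f" "loc_integrable_on J g" "loc_integrable_on J f'" "loc_integrable_on J g'"
    using f by (auto simp: has_weak_deriv_def)
  then show "loc_integrable_on J (\<lambda>x. f x + g x)" "loc_integrable_on J (\<lambda>x. f' x + g' x)"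
    by (auto intro: loc_integrable_on_add)
  fix \<phi> assume \<phi>: "test_function J \<phi>"
  note i = test_set_integrable[OF J _ \<phi>]
  show "(LINT x:J|lebesgue. (f x + g x) * deriv \<phi> x) = - (LINT x:J|lebesgue. (f' x + g' x) * \<phi> x)"
    using f \<phi> set_integral_add(2)[OF i(2)[OF l(1)] i(2)[OF l(2)]] set_integral_add(2)[OF i(1)[OF l(3)] i(1)[OF l(4)]]
    by (auto simp: has_weak_deriv_def distrib_right)
qed

lemma has_weak_deriv_cmult:
  assumes "has_weak_deriv J f f'"
  shows "has_weak_deriv J (\<lambda>x. c * f x) (\<lambda>x. c * f' x)"
  using assms by (auto simp: has_weak_deriv_def mult.assoc intro: loc_integrable_on_cmult)

lemma has_time_deriv_add:
  assumes J: "open_ivl J" and f: "has_time_deriv J A f t f'" "has_time_deriv J A g t g'"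
  shows "has_time_deriv J A (\<lambda>x s. f x s + g x s) t (\<lambda>x. f' x + g' x)"
  unfolding has_time_deriv_def
proof (intro conjI allI impI)
  have l: "loc_integrable_on J f'" "loc_integrable_on J g'"
    using f by (auto simp: has_time_deriv_def)
  then show "loc_integrable_on J (\<lambda>x. f' x + g' x)" by (rule loc_integrable_on_add)
  fix \<phi> assume \<phi>: "test_function J \<phi>"
  let ?I = "\<lambda>f s. set_integrable lebesgue J (\<lambda>x. f x s * \<phi> x)"
  let ?L = "\<lambda>f s. LINT x:J|lebesgue. f x s * \<phi> x"
  have F: "?I f t" "?I g t" "\<forall>\<^sub>F s in at t within A. ?I f s" "\<forall>\<^sub>F s in at t within A. ?I g s"
    "(?L f has_real_derivative (LINT x:J|lebesgue. f' x * \<phi> x)) (at t within A)"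
    "(?L g has_real_derivative (LINT x:J|lebesgue. g' x * \<phi> x)) (at t within A)"
    using f \<phi> unfolding has_time_deriv_def by blast+
  show "?I (\<lambda>x s. f x s + g x s) t" using set_integral_add(1)[OF F(1,2)] by (simp add: distrib_right)
  show "\<forall>\<^sub>F s in at t within A. ?I (\<lambda>x s. f x s + g x s) s"
    using F(3,4) by eventually_elim (simp add: distrib_right set_integral_add(1))
  have eq: "?L f s + ?L g s = ?L (\<lambda>x s. f x s + g x s) s" if "?I f s" "?I g s" for s
    using set_integral_add(2)[OF that] by (simp add: distrib_right)
  have eq': "(LINT x:J|lebesgue. (f' x + g' x) * \<phi> x) = (LINT x:J|lebesgue. f' x * \<phi> x) + (LINT x:J|lebesgue. g' x * \<phi> x)"
    using set_integral_add(2)[OF test_set_integrable(1)[OF J l(1) \<phi>] test_set_integrable(1)[OF J l(2) \<phi>]]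
    by (simp add: distrib_right)
  have "\<forall>\<^sub>F s in at t within A. ?L f s + ?L g s = ?L (\<lambda>x s. f x s + g x s) s"
    using F(3,4) by eventually_elim (rule eq)
  then show "(?L (\<lambda>x s. f x s + g x s) has_real_derivative (LINT x:J|lebesgue. (f' x + g' x) * \<phi> x)) (at t within A)"
    unfolding eq' using DERIV_add[OF F(5,6)] eq[OF F(1,2)]
    by (subst (asm) has_field_derivative_cong_eventually) auto
qed

text \<open>Agreement is required near \<open>t\<close> only on compact parts of \<open>J\<close>:
  the sections of a backward cone shrink, and for \<open>s > t\<close> two solutions can be compared
  only on a smaller interval. This suffices because test functions have compact support.\<close>

lemma has_time_deriv_cong:
  assumes J: "open_ivl J" and f: "has_time_deriv J A f t f'"
    and eq: "\<And>c d. {c..d} \<subseteq> J \<Longrightarrow> \<forall>\<^sub>F s in at t within A. \<forall>x\<in>{c..d}. f x s = g x s"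
    and eqt: "\<And>x. x \<in> J \<Longrightarrow> f x t = g x t"
  shows "has_time_deriv J A g t f'"
  unfolding has_time_deriv_def
proof (intro conjI allI impI)
  show "loc_integrable_on J f'" using f by (auto simp: has_time_deriv_def)
  fix \<phi> assume \<phi>: "test_function J \<phi>"
  obtain c d D where *: "c < d" "{c..d} \<subseteq> J"
    "\<And>x. (\<phi> has_real_derivative D x) (at x)" "continuous_on UNIV D"
    "\<And>x. x \<notin> {c<..<d} \<Longrightarrow> \<phi> x = 0" "\<And>x. x \<notin> {c<..<d} \<Longrightarrow> D x = 0" "deriv \<phi> = D"
    by (rule test_function_ivlE[OF \<phi> J]) blast
  let ?I = "\<lambda>f s. set_integrable lebesgue J (\<lambda>x. f x s * \<phi> x)"
  let ?L = "\<lambda>f s. LINT x:J|lebesgue. f x s * \<phi> x"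
  have F: "?I f t" "\<forall>\<^sub>F s in at t within A. ?I f s"
    "(?L f has_real_derivative (LINT x:J|lebesgue. f' x * \<phi> x)) (at t within A)"
    using f \<phi> unfolding has_time_deriv_def by blast+
  have same: "(\<lambda>x. indicator J x *\<^sub>R (f x s * \<phi> x)) = (\<lambda>x. indicator J x *\<^sub>R (g x s * \<phi> x))"
    if "\<forall>x\<in>{c..d}. f x s = g x s" for s
  proof
    fix x show "indicator J x *\<^sub>R (f x s * \<phi> x) = indicator J x *\<^sub>R (g x s * \<phi> x)"
      using that *(5)[of x] by (cases "x \<in> {c<..<d}") auto
  qed
  have sameI: "?I f s \<longleftrightarrow> ?I g s" and sameL: "?L f s = ?L g s" if "\<forall>x\<in>{c..d}. f x s = g x s" for s
    unfolding set_integrable_def set_lebesgue_integral_def same[OF that] by auto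
  have t: "\<forall>x\<in>{c..d}. f x t = g x t" using eqt *(2) by auto
  show "?I g t" using sameI[OF t] F(1) by simp
  show "\<forall>\<^sub>F s in at t within A. ?I g s" using F(2) eq[OF *(2)] by eventually_elim (simp add: sameI)
  have "\<forall>\<^sub>F s in at t within A. ?L f s = ?L g s" using eq[OF *(2)] by eventually_elim (rule sameL)
  then show "(?L g has_real_derivative (LINT x:J|lebesgue. f' x * \<phi> x)) (at t within A)"
    using F(3) sameL[OF t] by (subst (asm) has_field_derivative_cong_eventually) auto
qed

section \<open>Weak derivatives of compositions\<close>

lemma set_integrable_bounded_borel:
  fixes F :: "real \<Rightarrow> real"
  assumes F: "F \<in> borel_measurable borel" and S: "S \<in> sets borel" "bounded S"
    and B: "\<And>x. x \<in> S \<Longrightarrow> \<bar>F x\<bar> \<le> B"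
  shows "set_integrable lborel S F" "set_integrable lebesgue S F"
proof -
  have "emeasure lborel S < \<infinity>" using emeasure_bounded_finite[OF S(2)] by simp
  then show 1: "set_integrable lborel S F"
    using F S B unfolding set_integrable_def
    by (intro integrableI_bounded_set_indicator[where B = B]) auto
  then show "set_integrable lebesgue S F"
    using F S unfolding set_integrable_def by (subst integrable_completion) auto
qed

lemma loc_integrable_on_bounded_borel:
  fixes F :: "real \<Rightarrow> real"
  assumes "F \<in> borel_measurable borel" "\<And>x. \<bar>F x\<bar> \<le> B" "continuous_on UNIV G"
  shows "loc_integrable_on J (\<lambda>x. F x * G x)"
  unfolding loc_integrable_on_def
proof (intro allI impI)
  fix K assume K: "compact K \<and> K \<subseteq> J"
  have "bounded (G ` K)" using K assms(3)
    by (intro compact_imp_bounded compact_continuous_image) (auto intro: continuous_on_subset)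
  then obtain C where C: "\<And>x. x \<in> K \<Longrightarrow> \<bar>G x\<bar> \<le> C" unfolding bounded_iff by auto
  have "\<bar>F x * G x\<bar> \<le> B * C" if "x \<in> K" for x
    using mult_mono[OF assms(2)[of x] C[OF that]] order_trans[OF abs_ge_zero assms(2)] by (auto simp: abs_mult)
  then show "set_integrable lebesgue K (\<lambda>x. F x * G x)"
    using K borel_measurable_times[OF assms(1) borel_measurable_continuous_onI[OF assms(3)]]
    by (intro set_integrable_bounded_borel) (auto simp: compact_imp_bounded compact_imp_closed borel_closed)
qed

lemma loc_integrable_on_continuous:
  fixes F :: "real \<Rightarrow> real"
  assumes "continuous_on J F"
  shows "loc_integrable_on J F"
  unfolding loc_integrable_on_def
proof (intro allI impI)
  fix K assume K: "compact K \<and> K \<subseteq> J"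
  have "integrable lborel (\<lambda>x. indicator K x *\<^sub>R F x)"
    using K assms by (intro borel_integrable_compact) (auto intro: continuous_on_subset)
  then show "set_integrable lebesgue K F"
    by (simp add: set_integrable_def integrable_completion)
qed

lemma has_weak_deriv_C1:
  assumes J: "open_ivl J" and F: "\<And>x. x \<in> J \<Longrightarrow> (F has_real_derivative F' x) (at x)"
    and F': "continuous_on J F'"
  shows "has_weak_deriv J F F'"
  unfolding has_weak_deriv_def
proof (intro conjI allI impI)
  have cF: "continuous_on J F" using F by (intro continuous_at_imp_continuous_on ballI DERIV_isCont)
  show l: "loc_integrable_on J F" "loc_integrable_on J F'"
    by (rule loc_integrable_on_continuous[OF cF], rule loc_integrable_on_continuous[OF F'])
  fix \<phi> assume \<phi>: "test_function J \<phi>"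
  obtain c d D where *: "c < d" "{c..d} \<subseteq> J"
    "\<And>x. (\<phi> has_real_derivative D x) (at x)" "continuous_on UNIV D"
    "\<And>x. x \<notin> {c<..<d} \<Longrightarrow> \<phi> x = 0" "\<And>x. x \<notin> {c<..<d} \<Longrightarrow> D x = 0" "deriv \<phi> = D"
    by (rule test_function_ivlE[OF \<phi> J]) blast
  note i = test_set_integrable[OF J _ \<phi>]
  have "(LINT x:J|lebesgue. F x * deriv \<phi> x) + (LINT x:J|lebesgue. F' x * \<phi> x)
      = (LINT x:J|lebesgue. F x * deriv \<phi> x + F' x * \<phi> x)"
    using set_integral_add(2)[OF i(2)[OF l(1)] i(1)[OF l(2)]] by simp
  also have "\<dots> = (LINT x:{c..d}|lebesgue. F x * D x + F' x * \<phi> x)"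
    using *(5,6) unfolding *(7) by (intro set_lint_support(1) *(2)) auto
  also have "\<dots> = integral {c..d} (\<lambda>x. F x * D x + F' x * \<phi> x)"
  proof (rule set_lebesgue_integral_eq_integral(2))
    have "continuous_on {c..d} \<phi>" using *(3) by (intro continuous_at_imp_continuous_on ballI DERIV_isCont)
    then show "set_integrable lebesgue {c..d} (\<lambda>x. F x * D x + F' x * \<phi> x)"
      using *(2,4) cF F' by (intro set_integrable_lebesgue_continuous continuous_intros)
       (auto intro: continuous_on_subset)
  qed
  also have "\<dots> = F d * \<phi> d - F c * \<phi> c"
  proof (intro integral_unique fundamental_theorem_of_calculus)
    fix x assume "x \<in> {c..d}"
    then have "(F has_real_derivative F' x) (at x)" using *(2) F by blast
    from DERIV_mult[OF this *(3)]
    show "((\<lambda>x. F x * \<phi> x) has_vector_derivative F x * D x + F' x * \<phi> x) (at x within {c..d})"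
      by (auto simp: has_real_derivative_iff_has_vector_derivative[symmetric] algebra_simps intro: has_field_derivative_at_within)
  qed (use *(1) in simp)
  finally show "(LINT x:J|lebesgue. F x * deriv \<phi> x) = - (LINT x:J|lebesgue. F' x * \<phi> x)"
    using *(5)[of c] *(5)[of d] by simp
qed

text \<open>By the tube lemma the domain \<open>W\<close> contains a product of a time window with
  the support of the test function; on it one may differentiate under the integral.\<close>

lemma has_time_deriv_C1:
  fixes F F' :: "real \<Rightarrow> real \<Rightarrow> real"
  assumes J: "open_ivl J" and W: "open W" and JW: "\<And>x. x \<in> J \<Longrightarrow> (t, x) \<in> W"
    and F: "\<And>x s. (s, x) \<in> W \<Longrightarrow> ((\<lambda>s. F x s) has_real_derivative F' x s) (at s)"
    and cF: "continuous_on W (\<lambda>(s, x). F x s)" and cF': "continuous_on W (\<lambda>(s, x). F' x s)"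
  shows "has_time_deriv J A F t (\<lambda>x. F' x t)"
  unfolding has_time_deriv_def
proof (intro conjI allI impI)
  have slice: "continuous_on S (\<lambda>x. F x s)" "continuous_on S (\<lambda>x. F' x s)" if "{s} \<times> S \<subseteq> W" for s S
  proof -
    have "continuous_on S (Pair s)" "Pair s ` S \<subseteq> W" using that by (auto intro!: continuous_intros)
    then show "continuous_on S (\<lambda>x. F x s)" "continuous_on S (\<lambda>x. F' x s)"
      using continuous_on_compose2[OF cF, of S "Pair s"] continuous_on_compose2[OF cF', of S "Pair s"] by auto
  qed
  show "loc_integrable_on J (\<lambda>x. F' x t)"
    using JW by (intro loc_integrable_on_continuous slice) auto
  fix \<phi> assume \<phi>: "test_function J \<phi>"
  obtain c d D where *: "c < d" "{c..d} \<subseteq> J"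
    "\<And>x. (\<phi> has_real_derivative D x) (at x)" "continuous_on UNIV D"
    "\<And>x. x \<notin> {c<..<d} \<Longrightarrow> \<phi> x = 0" "\<And>x. x \<notin> {c<..<d} \<Longrightarrow> D x = 0" "deriv \<phi> = D"
    by (rule test_function_ivlE[OF \<phi> J]) blast
  have c\<phi>: "continuous_on S \<phi>" for S using *(3) by (intro continuous_at_imp_continuous_on ballI DERIV_isCont)
  have "{t} \<times> {c..d} \<subseteq> W" using JW *(2) by auto
  from Elementary_Topology.tube_lemma[OF compact_Icc W this]
  obtain X where X: "t \<in> X" "open X" "X \<times> {c..d} \<subseteq> W" by blast
  obtain e where e: "0 < e" "ball t e \<subseteq> X" using X(1,2) unfolding open_contains_ball by blast
  have U: "ball t e \<times> {c..d} \<subseteq> W" using e X by auto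
  have int: "set_integrable lebesgue J (\<lambda>x. F x s * \<phi> x)"
    and eq: "(LINT x:J|lebesgue. F x s * \<phi> x) = integral (cbox c d) (\<lambda>x. F x s * \<phi> x)"
    and int': "(LINT x:J|lebesgue. F' x s * \<phi> x) = integral (cbox c d) (\<lambda>x. F' x s * \<phi> x)" if "s \<in> ball t e" for s
  proof -
    have "{s} \<times> {c..d} \<subseteq> W" using that U by auto
    then have i: "set_integrable lebesgue {c..d} (\<lambda>x. F x s * \<phi> x)" "set_integrable lebesgue {c..d} (\<lambda>x. F' x s * \<phi> x)"
      using c\<phi> by (auto intro!: set_integrable_lebesgue_continuous continuous_intros slice)
    have z: "F x s * \<phi> x = 0" "F' x s * \<phi> x = 0" if "x \<notin> {c..d}" for x using *(5)[of x] that by auto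
    show "set_integrable lebesgue J (\<lambda>x. F x s * \<phi> x)"
      using i(1) z by (subst set_lint_support(2)[OF _ *(2)]) auto
    show "(LINT x:J|lebesgue. F x s * \<phi> x) = integral (cbox c d) (\<lambda>x. F x s * \<phi> x)"
      using set_lebesgue_integral_eq_integral(2)[OF i(1)] z by (subst set_lint_support(1)[OF _ *(2)]) auto
    show "(LINT x:J|lebesgue. F' x s * \<phi> x) = integral (cbox c d) (\<lambda>x. F' x s * \<phi> x)"
      using set_lebesgue_integral_eq_integral(2)[OF i(2)] z by (subst set_lint_support(1)[OF _ *(2)]) auto
  qed
  have t: "t \<in> ball t e" using e by simp
  show "set_integrable lebesgue J (\<lambda>x. F x t * \<phi> x)" by (rule int[OF t])
  have ev: "\<forall>\<^sub>F s in at t within A. s \<in> ball t e"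
    using e(1) eventually_at_ball[of e t A] by (auto elim: eventually_mono)
  then show "\<forall>\<^sub>F s in at t within A. set_integrable lebesgue J (\<lambda>x. F x s * \<phi> x)"
    by eventually_elim (rule int)
  have "((\<lambda>s. integral (cbox c d) (\<lambda>x. F x s * \<phi> x)) has_real_derivative
      integral (cbox c d) (\<lambda>x. F' x t * \<phi> x)) (at t within ball t e)"
  proof (rule leibniz_rule_field_derivative)
    fix s x assume sx: "s \<in> ball t e" "x \<in> cbox c d"
    then have "(s, x) \<in> W" using U by auto
    from DERIV_cmult_right[OF F[OF this], of "\<phi> x"]
    show "((\<lambda>s. F x s * \<phi> x) has_real_derivative F' x s * \<phi> x) (at s within ball t e)"
      by (rule has_field_derivative_at_within)
  next
    fix s assume s: "s \<in> ball t e"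
    have "{s} \<times> {c..d} \<subseteq> W" using s U by auto
    then show "(\<lambda>x. F x s * \<phi> x) integrable_on cbox c d"
      using c\<phi> by (intro integrable_continuous continuous_intros slice) auto
  next
    have "continuous_on (ball t e \<times> cbox c d) (\<lambda>z. (case z of (s, x) \<Rightarrow> F' x s) * \<phi> (snd z))"
      by (intro continuous_intros continuous_on_subset[OF cF'] continuous_on_compose2[OF c\<phi>[of UNIV]]) (use U in auto)
    then show "continuous_on (ball t e \<times> cbox c d) (\<lambda>(s, x). F' x s * \<phi> x)"
      by (simp add: split_beta)
  qed (use e in auto)
  then have "((\<lambda>s. integral (cbox c d) (\<lambda>x. F x s * \<phi> x)) has_real_derivative
      integral (cbox c d) (\<lambda>x. F' x t * \<phi> x)) (at t)"
    using e(1) by (simp add: at_within_open[OF t open_ball])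
  then have D: "((\<lambda>s. integral (cbox c d) (\<lambda>x. F x s * \<phi> x)) has_real_derivative
      (LINT x:J|lebesgue. F' x t * \<phi> x)) (at t within A)"
    unfolding int'[OF t] by (rule has_field_derivative_at_within)
  have "\<forall>\<^sub>F s in at t within A. integral (cbox c d) (\<lambda>x. F x s * \<phi> x) = (LINT x:J|lebesgue. F x s * \<phi> x)"
    using ev by eventually_elim (simp add: eq)
  then show "((\<lambda>s. LINT x:J|lebesgue. F x s * \<phi> x) has_real_derivative
      (LINT x:J|lebesgue. F' x t * \<phi> x)) (at t within A)"
    using D eq[OF t] by (subst (asm) has_field_derivative_cong_eventually) auto
qed

lemma lint_affine_test:
  fixes k :: "real \<Rightarrow> real"
  assumes m: "0 < m" and J: "{c..d} \<subseteq> J" and 0: "\<And>x. x \<notin> {c..d} \<Longrightarrow> k (b + m * x) = 0"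
  shows "(LINT \<eta>|lebesgue. k \<eta>) = m * (LINT x:J|lebesgue. k (b + m * x))"
proof -
  have "(LINT \<eta>|lebesgue. k \<eta>) = m * (LINT x|lebesgue. k (b + m * x))"
    using lebesgue_integral_real_affine[of m k b] m by simp
  also have "(LINT x|lebesgue. k (b + m * x)) = (LINT x:J|lebesgue. k (b + m * x))"
    unfolding set_lebesgue_integral_def
  proof (rule Bochner_Integration.integral_cong)
    fix x show "k (b + m * x) = indicat_real J x *\<^sub>R k (b + m * x)"
      using 0[of x] J by (cases "x \<in> {c..d}") auto
  qed simp
  finally show ?thesis .
qed

text \<open>Substitution turns the test function \<open>\<phi>\<close> into
  \<open>\<phi> ((\<eta> - b) / m)\<close>, again a test function, so that the weak derivative of
  \<open>f\<close> on the whole line applies.\<close>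

lemma has_weak_deriv_affine:
  assumes J: "open_ivl J" and f: "continuous_on UNIV f" "has_weak_deriv UNIV f g"
    and g: "g \<in> borel_measurable borel" "\<And>x. \<bar>g x\<bar> \<le> M" and m: "0 < m"
  shows "has_weak_deriv J (\<lambda>x. f (b + m * x)) (\<lambda>x. m * g (b + m * x))"
  unfolding has_weak_deriv_def
proof (intro conjI allI impI)
  have "continuous_on UNIV (\<lambda>x. f (b + m * x))"
    by (rule continuous_on_compose2[OF f(1)]) (auto intro!: continuous_intros)
  then show "loc_integrable_on J (\<lambda>x. f (b + m * x))"
    by (intro loc_integrable_on_continuous) (auto intro: continuous_on_subset)
  have "loc_integrable_on J (\<lambda>x. g (b + m * x) * m)"
    using g by (intro loc_integrable_on_bounded_borel) (auto intro: measurable_compose[OF _ g(1)])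
  then show "loc_integrable_on J (\<lambda>x. m * g (b + m * x))" by (simp add: mult.commute)
  fix \<phi> assume \<phi>: "test_function J \<phi>"
  obtain c d D where *: "c < d" "{c..d} \<subseteq> J"
    "\<And>x. (\<phi> has_real_derivative D x) (at x)" "continuous_on UNIV D"
    "\<And>x. x \<notin> {c<..<d} \<Longrightarrow> \<phi> x = 0" "\<And>x. x \<notin> {c<..<d} \<Longrightarrow> D x = 0" "deriv \<phi> = D"
    by (rule test_function_ivlE[OF \<phi> J]) blast
  define \<psi> where "\<psi> \<eta> = \<phi> ((\<eta> - b) / m)" for \<eta>
  have d\<psi>: "(\<psi> has_real_derivative D ((\<eta> - b) / m) / m) (at \<eta>)" for \<eta>
  proof -
    have "(\<psi> has_real_derivative D ((\<eta> - b) / m) * (1 / m)) (at \<eta>)"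
      unfolding \<psi>_def by (rule DERIV_chain2[OF *(3)]) (use m in \<open>auto intro!: derivative_eq_intros\<close>)
    then show ?thesis by simp
  qed
  have zero: "\<phi> ((b + m * x - b) / m) = \<phi> x" "D ((b + m * x - b) / m) = D x" for x
    using m by simp_all
  have "test_function UNIV \<psi>"
  proof (rule test_functionI[OF d\<psi>])
    show "continuous_on UNIV (\<lambda>\<eta>. D ((\<eta> - b) / m) / m)"
      by (intro continuous_intros continuous_on_compose2[OF *(4)]) (use m in auto)
    fix \<eta> assume "\<eta> \<notin> {b + m * c..b + m * d}"
    then have "(\<eta> - b) / m \<notin> {c<..<d}" using m by (auto simp: field_simps)
    then show "\<psi> \<eta> = 0" unfolding \<psi>_def by (rule *(5))
  qed simp
  then have "(LINT \<eta>:UNIV|lebesgue. f \<eta> * deriv \<psi> \<eta>) = - (LINT \<eta>:UNIV|lebesgue. g \<eta> * \<psi> \<eta>)"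
    using f(2) by (auto simp: has_weak_deriv_def)
  moreover have "deriv \<psi> = (\<lambda>\<eta>. D ((\<eta> - b) / m) / m)" using d\<psi> by (intro ext DERIV_imp_deriv)
  ultimately have E: "(LINT \<eta>|lebesgue. f \<eta> * (D ((\<eta> - b) / m) / m)) = - (LINT \<eta>|lebesgue. g \<eta> * \<phi> ((\<eta> - b) / m))"
    by (simp add: set_lebesgue_integral_def \<psi>_def)
  have out: "\<phi> x = 0" "D x = 0" if "x \<notin> {c..d}" for x using that *(5,6)[of x] by auto
  have "(LINT \<eta>|lebesgue. f \<eta> * (D ((\<eta> - b) / m) / m)) = m * (LINT x:J|lebesgue. f (b + m * x) * (D ((b + m * x - b) / m) / m))"
    by (rule lint_affine_test[OF m *(2)]) (use zero out in auto)
  moreover have "(LINT \<eta>|lebesgue. g \<eta> * \<phi> ((\<eta> - b) / m)) = m * (LINT x:J|lebesgue. g (b + m * x) * \<phi> ((b + m * x - b) / m))"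
    by (rule lint_affine_test[OF m *(2)]) (use zero out in auto)
  ultimately show "(LINT x:J|lebesgue. f (b + m * x) * deriv \<phi> x) = - (LINT x:J|lebesgue. m * g (b + m * x) * \<phi> x)"
    using E m unfolding zero *(7) by (simp add: mult.assoc)
qed

text \<open>\<open>f\<close> need not be differentiable anywhere in particular, so the moving
  argument \<open>b s + m s * x\<close> is made the integration variable. The time dependence then
  sits in the smooth weight, where it may be differentiated. The factor \<open>m\<close> is 1 for
  the original variables and \<open>exp (- s)\<close> for the similarity variables.\<close>

lemma has_time_deriv_affine:
  assumes J: "open_ivl J" and f: "continuous_on UNIV f" "has_weak_deriv UNIV f g"
    and g: "g \<in> borel_measurable borel" "\<And>x. \<bar>g x\<bar> \<le> M"
    and b: "\<And>s. (b has_real_derivative b' s) (at s)" "continuous_on UNIV b'"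
    and m: "\<And>s. (m has_real_derivative m' s) (at s)" "continuous_on UNIV m'" "\<And>s. 0 < m s"
  shows "has_time_deriv J A (\<lambda>x s. f (b s + m s * x)) t (\<lambda>x. g (b t + m t * x) * (b' t + m' t * x))"
  unfolding has_time_deriv_def
proof (intro conjI allI impI)
  show "loc_integrable_on J (\<lambda>x. g (b t + m t * x) * (b' t + m' t * x))"
    using g by (intro loc_integrable_on_bounded_borel) (auto intro: measurable_compose[OF _ g(1)] continuous_intros)
  fix \<phi> assume \<phi>: "test_function J \<phi>"
  obtain c d D where *: "c < d" "{c..d} \<subseteq> J"
    "\<And>x. (\<phi> has_real_derivative D x) (at x)" "continuous_on UNIV D"
    "\<And>x. x \<notin> {c<..<d} \<Longrightarrow> \<phi> x = 0" "\<And>x. x \<notin> {c<..<d} \<Longrightarrow> D x = 0" "deriv \<phi> = D"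
    by (rule test_function_ivlE[OF \<phi> J]) blast
  have c\<phi>: "continuous_on UNIV \<phi>" using *(3) by (intro continuous_at_imp_continuous_on ballI DERIV_isCont)
  have cb: "continuous_on UNIV b" and cm: "continuous_on UNIV m"
    using b(1) m(1) by (auto intro!: continuous_at_imp_continuous_on DERIV_isCont)
  note cc = continuous_on_compose2[OF cb] continuous_on_compose2[OF cm] continuous_on_compose2[OF b(2)]
    continuous_on_compose2[OF m(2)] continuous_on_compose2[OF c\<phi>] continuous_on_compose2[OF *(4)]
    continuous_on_compose2[OF f(1)]
  show int: "set_integrable lebesgue J (\<lambda>x. f (b s + m s * x) * \<phi> x)" for s
    using *(5) by (subst set_lint_support(2)[OF _ *(2)])
     (auto intro!: set_integrable_lebesgue_continuous continuous_intros cc)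
  then show "\<forall>\<^sub>F s in at t within A. set_integrable lebesgue J (\<lambda>x. f (b s + m s * x) * \<phi> x)" by simp
  define X where "X s \<eta> = (\<eta> - b s) / m s" for s \<eta>
  define dX where "dX s \<eta> = ((0 - b' s) * m s - (\<eta> - b s) * m' s) / (m s * m s)" for s \<eta>
  define W where "W s \<eta> = \<phi> (X s \<eta>) / m s" for s \<eta>
  define dW where "dW s \<eta> = (D (X s \<eta>) * dX s \<eta> * m s - \<phi> (X s \<eta>) * m' s) / (m s * m s)" for s \<eta>
  have mnz: "m s \<noteq> 0" for s using m(3)[of s] by simp
  have Xd: "((\<lambda>s. X s \<eta>) has_real_derivative dX s \<eta>) (at s)" for s \<eta>
    unfolding X_def dX_def by (intro DERIV_divide DERIV_diff DERIV_const b m mnz)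
  have Wd: "((\<lambda>s. W s \<eta>) has_real_derivative dW s \<eta>) (at s)" for s \<eta>
    unfolding W_def dW_def by (intro DERIV_divide DERIV_chain2[OF *(3)] Xd m mnz)
  have Xinv: "X s (b s + m s * x) = x" for s x using mnz[of s] by (simp add: X_def)
  have out: "\<phi> x = 0" "D x = 0" if "x \<notin> {c..d}" for x using that *(5,6)[of x] by auto
  \<comment> \<open>One interval containing the transported supports for all times within 1 of
    \<open>t\<close>, so that the domain of integration stays fixed.\<close>
  have "bounded ((\<lambda>(s, x). b s + m s * x) ` ({t - 1..t + 1} \<times> {c..d}))"
    unfolding split_beta by (intro compact_imp_bounded compact_continuous_image compact_Times compact_Icc continuous_intros cc) auto
  then obtain N where "\<forall>y\<in>(\<lambda>(s, x). b s + m s * x) ` ({t - 1..t + 1} \<times> {c..d}). norm y \<le> N" unfolding bounded_iff by blast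
  then have N: "\<bar>b s + m s * x\<bar> \<le> N" if "s \<in> {t - 1..t + 1}" "x \<in> {c..d}" for s x using that by force
  have supp: "X s \<eta> \<notin> {c..d}" if "s \<in> {t - 1..t + 1}" "\<eta> \<notin> {-N..N}" for s \<eta>
  proof
    assume "X s \<eta> \<in> {c..d}"
    from N[OF that(1) this] have "\<bar>\<eta>\<bar> \<le> N" using mnz[of s] by (simp add: X_def)
    then show False using that(2) by (auto simp: abs_le_iff)
  qed
  have cW: "continuous_on UNIV (\<lambda>\<eta>. f \<eta> * W s \<eta>)" "continuous_on UNIV (\<lambda>\<eta>. f \<eta> * dW s \<eta>)" for s
    unfolding W_def dW_def X_def dX_def using mnz by (intro continuous_intros cc f(1); auto)+
  have I: "(LINT x:J|lebesgue. f (b s + m s * x) * \<phi> x) = integral (cbox (-N) N) (\<lambda>\<eta>. f \<eta> * W s \<eta>)"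
    if s: "s \<in> {t - 1..t + 1}" for s
  proof -
    have "(LINT \<eta>|lebesgue. f \<eta> * W s \<eta>) = m s * (LINT x:J|lebesgue. f (b s + m s * x) * W s (b s + m s * x))"
      by (rule lint_affine_test[OF m(3) *(2)]) (use out in \<open>auto simp: W_def Xinv\<close>)
    also have "\<dots> = (LINT x:J|lebesgue. f (b s + m s * x) * \<phi> x)"
      unfolding W_def Xinv using mnz[of s] by simp
    finally have "(LINT x:J|lebesgue. f (b s + m s * x) * \<phi> x) = (LINT \<eta>:UNIV|lebesgue. f \<eta> * W s \<eta>)"
      by (simp add: set_lebesgue_integral_def)
    also have "\<dots> = (LINT \<eta>:{-N..N}|lebesgue. f \<eta> * W s \<eta>)"
      by (rule set_lint_support(1)) (use supp[OF s] out in \<open>auto simp: W_def\<close>)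
    also have "\<dots> = integral {-N..N} (\<lambda>\<eta>. f \<eta> * W s \<eta>)"
      by (intro set_lebesgue_integral_eq_integral(2) set_integrable_lebesgue_continuous continuous_on_subset[OF cW(1)]) simp
    finally show ?thesis by simp
  qed
  have "((\<lambda>s. integral (cbox (-N) N) (\<lambda>\<eta>. f \<eta> * W s \<eta>)) has_real_derivative
      integral (cbox (-N) N) (\<lambda>\<eta>. f \<eta> * dW t \<eta>)) (at t within {t - 1..t + 1})"
  proof (rule leibniz_rule_field_derivative)
    show "((\<lambda>s. f \<eta> * W s \<eta>) has_real_derivative f \<eta> * dW s \<eta>) (at s within {t - 1..t + 1})" for s \<eta>
      by (rule has_field_derivative_at_within[OF DERIV_cmult[OF Wd]])
    show "(\<lambda>\<eta>. f \<eta> * W s \<eta>) integrable_on cbox (-N) N" for s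
      by (intro integrable_continuous continuous_on_subset[OF cW(1)]) simp
    have "continuous_on ({t - 1..t + 1} \<times> cbox (-N) N) (\<lambda>z. f (snd z) * dW (fst z) (snd z))"
      unfolding dW_def X_def dX_def by (intro continuous_intros cc) (use mnz in auto)
    then show "continuous_on ({t - 1..t + 1} \<times> cbox (-N) N) (\<lambda>(s, \<eta>). f \<eta> * dW s \<eta>)"
      by (simp add: split_beta)
  qed auto
  then have der: "((\<lambda>s. integral (cbox (-N) N) (\<lambda>\<eta>. f \<eta> * W s \<eta>)) has_real_derivative
      integral (cbox (-N) N) (\<lambda>\<eta>. f \<eta> * dW t \<eta>)) (at t)"
    by (subst (asm) at_within_interior) auto
  \<comment> \<open>\<open>W\<close> is the test function transported by
    \<open>x \<mapsto> b s + m s * x\<close>: a density moving with velocity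
    \<open>b' + m' * x\<close>. \<open>\<psi>\<close> is its flux, and \<open>dW = - \<psi>'\<close>
    the continuity equation, which converts the time derivative into a weak derivative of
    \<open>f\<close>.\<close>
  define \<psi> where "\<psi> \<eta> = \<phi> (X t \<eta>) * (b' t + m' t * X t \<eta>) / m t" for \<eta>
  have X\<eta>: "(X t has_real_derivative 1 / m t) (at \<eta>)" for \<eta>
    unfolding X_def using mnz[of t] by (auto intro!: derivative_eq_intros)
  have d\<psi>: "(\<psi> has_real_derivative - dW t \<eta>) (at \<eta>)" for \<eta>
  proof -
    have "(\<psi> has_real_derivative (\<phi> (X t \<eta>) * (0 + m' t * (1 / m t)) + D (X t \<eta>) * (1 / m t) * (b' t + m' t * X t \<eta>)) / m t) (at \<eta>)"
      unfolding \<psi>_def by (intro DERIV_cdivide DERIV_mult' DERIV_add DERIV_cmult DERIV_const X\<eta> DERIV_chain2[OF *(3)])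
    moreover have "(\<phi> (X t \<eta>) * (0 + m' t * (1 / m t)) + D (X t \<eta>) * (1 / m t) * (b' t + m' t * X t \<eta>)) / m t = - dW t \<eta>"
    proof -
      have dX: "dX t \<eta> = - (b' t + m' t * X t \<eta>) / m t"
        unfolding dX_def X_def using mnz[of t] by (simp add: field_simps)
      show ?thesis unfolding dW_def dX using mnz[of t] by (simp add: field_simps)
    qed
    ultimately show ?thesis by simp
  qed
  have t: "t \<in> {t - 1..t + 1}" by simp
  have "test_function UNIV \<psi>"
  proof (rule test_functionI[OF d\<psi>])
    show "continuous_on UNIV (\<lambda>\<eta>. - dW t \<eta>)"
      unfolding dW_def X_def dX_def by (intro continuous_intros cc) (use mnz in auto)
    show "\<psi> \<eta> = 0" if "\<eta> \<notin> {-N..N}" for \<eta>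
      using out(1)[OF supp[OF t that]] by (simp add: \<psi>_def)
  qed simp
  then have "(LINT \<eta>:UNIV|lebesgue. f \<eta> * deriv \<psi> \<eta>) = - (LINT \<eta>:UNIV|lebesgue. g \<eta> * \<psi> \<eta>)"
    using f(2) by (auto simp: has_weak_deriv_def)
  moreover have "deriv \<psi> = (\<lambda>\<eta>. - dW t \<eta>)" using d\<psi> by (intro ext DERIV_imp_deriv)
  ultimately have E: "(LINT \<eta>|lebesgue. f \<eta> * dW t \<eta>) = (LINT \<eta>|lebesgue. g \<eta> * \<psi> \<eta>)"
    by (simp add: set_lebesgue_integral_def)
  have "(LINT \<eta>:UNIV|lebesgue. f \<eta> * dW t \<eta>) = (LINT \<eta>:{-N..N}|lebesgue. f \<eta> * dW t \<eta>)"
    by (rule set_lint_support(1)) (use supp[OF t] out in \<open>auto simp: dW_def\<close>)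
  also have "\<dots> = integral {-N..N} (\<lambda>\<eta>. f \<eta> * dW t \<eta>)"
    by (intro set_lebesgue_integral_eq_integral(2) set_integrable_lebesgue_continuous continuous_on_subset[OF cW(2)]) simp
  finally have 1: "(LINT \<eta>|lebesgue. f \<eta> * dW t \<eta>) = integral {-N..N} (\<lambda>\<eta>. f \<eta> * dW t \<eta>)"
    by (simp add: set_lebesgue_integral_def)
  have "(LINT \<eta>|lebesgue. g \<eta> * \<psi> \<eta>) = m t * (LINT x:J|lebesgue. g (b t + m t * x) * \<psi> (b t + m t * x))"
    by (rule lint_affine_test[OF m(3) *(2)]) (use out in \<open>auto simp: \<psi>_def Xinv\<close>)
  also have "\<dots> = (LINT x:J|lebesgue. g (b t + m t * x) * (b' t + m' t * x) * \<phi> x)"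
    unfolding \<psi>_def Xinv using mnz[of t] by (simp add: mult_ac)
  finally have 2: "integral (cbox (-N) N) (\<lambda>\<eta>. f \<eta> * dW t \<eta>) = (LINT x:J|lebesgue. g (b t + m t * x) * (b' t + m' t * x) * \<phi> x)"
    using 1 E by simp
  have "\<forall>\<^sub>F s in at t within A. s \<in> ball t 1"
    using eventually_at_ball[of 1 t A] by (auto elim: eventually_mono)
  then have "\<forall>\<^sub>F s in at t within A. integral (cbox (-N) N) (\<lambda>\<eta>. f \<eta> * W s \<eta>) = (LINT x:J|lebesgue. f (b s + m s * x) * \<phi> x)"
    by eventually_elim (rule I[symmetric], auto simp: dist_real_def)
  then show "((\<lambda>s. LINT x:J|lebesgue. f (b s + m s * x) * \<phi> x) has_real_derivative
      (LINT x:J|lebesgue. g (b t + m t * x) * (b' t + m' t * x) * \<phi> x)) (at t within A)"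
    using has_field_derivative_at_within[OF der, of A] I[OF t] unfolding 2
    by (subst (asm) has_field_derivative_cong_eventually) auto
qed

section \<open>Continuity in mean square\<close>

lemma square_sum_le: "(a + b)\<^sup>2 \<le> 2 * a\<^sup>2 + 2 * (b::real)\<^sup>2"
  using zero_le_power2[of "a - b"] by (simp add: power2_eq_square algebra_simps)

lemma L2_on_add:
  assumes f: "L2_on J f" and g: "L2_on J g"
  shows "L2_on J (\<lambda>x. f x + c * g x)"
proof -
  have m: "(\<lambda>x. indicator J x *\<^sub>R f x) \<in> borel_measurable lebesgue" "(\<lambda>x. indicator J x *\<^sub>R g x) \<in> borel_measurable lebesgue"
    using f g by (auto simp: L2_on_def set_borel_measurable_def)
  have eq: "(\<lambda>x. indicator J x *\<^sub>R (f x + c * g x)) = (\<lambda>x. indicator J x *\<^sub>R f x + c * (indicator J x *\<^sub>R g x))"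
    by (auto simp: indicator_def)
  have 1: "(\<lambda>x. indicator J x *\<^sub>R (f x + c * g x)) \<in> borel_measurable lebesgue"
    unfolding eq by (intro borel_measurable_add borel_measurable_times borel_measurable_const m)
  have "integrable lebesgue (\<lambda>x. 2 * (indicator J x *\<^sub>R (f x)\<^sup>2) + 2 * (c\<^sup>2 * (indicator J x *\<^sub>R (g x)\<^sup>2)))"
    using f g by (intro Bochner_Integration.integrable_add integrable_mult_right) (auto simp: L2_on_def set_integrable_def)
  then have "integrable lebesgue (\<lambda>x. indicator J x *\<^sub>R (f x + c * g x)\<^sup>2)"
  proof (rule Bochner_Integration.integrable_bound)
    have "(\<lambda>x. (indicator J x *\<^sub>R (f x + c * g x))\<^sup>2) \<in> borel_measurable lebesgue"
      by (rule borel_measurable_power[OF 1])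
    then show "(\<lambda>x. indicator J x *\<^sub>R (f x + c * g x)\<^sup>2) \<in> borel_measurable lebesgue"
      by (rule back_subst[of "\<lambda>f. f \<in> _"]) (auto simp: indicator_def)
    show "AE x in lebesgue. norm (indicator J x *\<^sub>R (f x + c * g x)\<^sup>2)
        \<le> norm (2 * (indicator J x *\<^sub>R (f x)\<^sup>2) + 2 * (c\<^sup>2 * (indicator J x *\<^sub>R (g x)\<^sup>2)))"
      using square_sum_le[of "f _" "c * g _"] by (intro AE_I2) (auto simp: indicator_def power_mult_distrib)
  qed
  then show ?thesis using 1 by (simp add: L2_on_def set_borel_measurable_def set_integrable_def)
qed

lemma L2_on_diff: "L2_on J f \<Longrightarrow> L2_on J g \<Longrightarrow> L2_on J (\<lambda>x. f x - g x)"
  using L2_on_add[of J f g "-1"] by simp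

lemma L2_on_subset:
  assumes f: "L2_on J f" and J': "J' \<subseteq> J" "J' \<in> sets lebesgue"
  shows "L2_on J' f"
proof -
  have "(\<lambda>x. indicator J x *\<^sub>R f x) \<in> borel_measurable lebesgue"
    using f by (auto simp: L2_on_def set_borel_measurable_def)
  from borel_measurable_scaleR[OF borel_measurable_indicator[OF J'(2)] this]
  have "(\<lambda>x. indicator J' x *\<^sub>R (indicator J x *\<^sub>R f x)) \<in> borel_measurable lebesgue" .
  then have "(\<lambda>x. indicator J' x *\<^sub>R f x) \<in> borel_measurable lebesgue"
    by (rule back_subst[of "\<lambda>f. f \<in> _"]) (use J' in \<open>auto simp: indicator_def fun_eq_iff\<close>)
  then show ?thesis using f J' by (auto simp: L2_on_def set_borel_measurable_def intro: set_integrable_subset)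
qed

lemma L2_on_bounded_borel:
  fixes F :: "real \<Rightarrow> real"
  assumes F: "F \<in> borel_measurable borel" and S: "S \<in> sets borel" "bounded S"
    and B: "\<And>x. x \<in> S \<Longrightarrow> \<bar>F x\<bar> \<le> B"
  shows "L2_on S F"
proof -
  have "(F x)\<^sup>2 \<le> B\<^sup>2" if "x \<in> S" for x using power_mono[OF B[OF that], of 2] by simp
  then have "set_integrable lebesgue S (\<lambda>x. (F x)\<^sup>2)"
    using F S by (intro set_integrable_bounded_borel(2)[where B = "B\<^sup>2"]) auto
  moreover have "(\<lambda>x. indicator S x *\<^sub>R F x) \<in> borel_measurable lebesgue"
    using F S by (intro measurable_completion) (auto intro!: borel_measurable_scaleR)
  ultimately show ?thesis by (simp add: L2_on_def set_borel_measurable_def)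
qed

lemma L2_on_continuous:
  fixes F :: "real \<Rightarrow> real"
  assumes F: "continuous_on {a..b} F" and S: "S \<subseteq> {a..b}" "S \<in> sets lebesgue"
  shows "L2_on S F"
proof (rule L2_on_subset[OF _ S])
  show "L2_on {a..b} F"
    using set_integrable_lebesgue_continuous[OF F] set_integrable_lebesgue_continuous[of a b "\<lambda>x. (F x)\<^sup>2"] F
    by (auto simp: L2_on_def set_borel_measurable_def set_integrable_def intro: continuous_on_power dest: borel_measurable_integrable)
qed

text \<open>Continuity of translation in mean square: compare \<open>g\<close> with a continuous
  function before and after the shift, and use uniform continuity for that function.\<close>

lemma L2_translation:
  fixes g :: "real \<Rightarrow> real"
  assumes g: "g \<in> borel_measurable borel" and M: "\<And>x. \<bar>g x\<bar> \<le> M"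
  shows "((\<lambda>k. LINT x:{a..b}|lborel. (g (x + k) - g x)\<^sup>2) \<longlongrightarrow> 0) (nhds 0)"
proof (cases "a \<le> b")
  case False
  then show ?thesis by (simp add: set_lebesgue_integral_def)
next
  case ab: True
  have M0: "0 \<le> M" using order_trans[OF abs_ge_zero M] .
  have "g measurable_on UNIV"
    using g by (intro lebesgue_measurable_imp_measurable_on) (auto intro: measurable_completion)
  then obtain N G where N: "negligible N" "\<And>n. continuous_on UNIV (G n)" "\<And>x. x \<notin> N \<Longrightarrow> (\<lambda>n::nat. G n x) \<longlonglongrightarrow> g x"
    by (auto simp: measurable_on_def)
  \<comment> \<open>Truncation keeps the limit, since \<open>g\<close> itself takes values in
    \<open>[-M, M]\<close>, and provides a common majorant for dominated convergence.\<close>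
  define H where "H n x = max (- M) (min M (G n x))" for n x
  have cH: "continuous_on UNIV (H n)" for n unfolding H_def by (intro continuous_intros N)
  have HM: "\<bar>H n x\<bar> \<le> M" for n x using M0 by (auto simp: H_def)
  have Hlim: "(\<lambda>n. H n x) \<longlonglongrightarrow> g x" if "x \<notin> N" for x
  proof -
    have "(\<lambda>n. H n x) \<longlonglongrightarrow> max (- M) (min M (g x))"
      unfolding H_def by (intro tendsto_intros N(3) that)
    moreover have "max (- M) (min M (g x)) = g x" using M[of x] by (auto simp: abs_le_iff)
    ultimately show ?thesis by simp
  qed
  have mH: "H n \<in> borel_measurable borel" for n using cH by (rule borel_measurable_continuous_onI)
  \<comment> \<open>The interval is widened by 1 on each side so as to contain all translates of
    \<open>{a..b}\<close> by at most 1.\<close>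
  let ?e = "\<lambda>n. LINT x:{a - 1..b + 1}|lborel. (H n x - g x)\<^sup>2"
  have sqb: "(u - w)\<^sup>2 \<le> (2 * M)\<^sup>2" if "\<bar>u\<bar> \<le> M" "\<bar>w\<bar> \<le> M" for u w :: real
  proof -
    have "\<bar>u - w\<bar> \<le> 2 * M" using abs_triangle_ineq4[of u w] that by simp
    from power_mono[OF this, of 2] show ?thesis by simp
  qed
  have e: "?e \<longlonglongrightarrow> 0"
  proof -
    have "?e \<longlonglongrightarrow> (LINT x:{a - 1..b + 1}|lborel. (0::real))"
      unfolding set_lebesgue_integral_def
    proof (rule integral_dominated_convergence[where w = "\<lambda>x. indicator {a - 1..b + 1} x * (2 * M)\<^sup>2"])
      show "AE x in lborel. (\<lambda>n. indicat_real {a - 1..b + 1} x *\<^sub>R (H n x - g x)\<^sup>2) \<longlonglongrightarrow> indicat_real {a - 1..b + 1} x *\<^sub>R 0"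
      proof -
        have "AE x in lebesgue. x \<notin> N" using N(1) by (simp add: negligible_iff_null_sets AE_not_in)
        then have "AE x in lborel. x \<notin> N" by (simp add: AE_completion_iff)
        then show ?thesis
        proof eventually_elim
          case (elim x)
          have "(\<lambda>n. indicat_real {a - 1..b + 1} x *\<^sub>R (H n x - g x)\<^sup>2) \<longlonglongrightarrow> indicat_real {a - 1..b + 1} x *\<^sub>R (g x - g x)\<^sup>2"
            by (intro tendsto_intros Hlim elim)
          then show ?case by simp
        qed
      qed
      show "AE x in lborel. norm (indicat_real {a - 1..b + 1} x *\<^sub>R (H n x - g x)\<^sup>2) \<le> indicator {a - 1..b + 1} x * (2 * M)\<^sup>2" for n
        using sqb[OF HM M] by (intro AE_I2) (auto simp: indicator_def)
      show "integrable lborel (\<lambda>x. indicat_real {a - 1..b + 1} x * (2 * M)\<^sup>2)"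
        using borel_integrable_atLeastAtMost'[of "a - 1" "b + 1" "\<lambda>_. (2 * M)\<^sup>2"] by (simp add: set_integrable_def)
    qed (use mH g in auto)
    then show ?thesis by simp
  qed
  have int: "set_integrable lborel {l..r} (\<lambda>x. (F1 x - F2 x)\<^sup>2)"
    if "F1 \<in> borel_measurable borel" "F2 \<in> borel_measurable borel" "\<And>x. \<bar>F1 x\<bar> \<le> M" "\<And>x. \<bar>F2 x\<bar> \<le> M" for F1 F2 :: "real \<Rightarrow> real" and l r
    using that sqb by (intro set_integrable_bounded_borel(1)[where B = "(2 * M)\<^sup>2"]) auto
  have shift: "(LINT x:{a..b}|lborel. (H n (x + k) - g (x + k))\<^sup>2) \<le> ?e n" if "\<bar>k\<bar> \<le> 1" for n k
  proof -
    have "(LINT x:{a - 1..b + 1}|lborel. (H n x - g x)\<^sup>2) = (LINT x|lborel. indicat_real {a - 1..b + 1} (k + x) *\<^sub>R (H n (k + x) - g (k + x))\<^sup>2)"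
      unfolding set_lebesgue_integral_def
      using lborel_integral_real_affine[of 1 "\<lambda>x. indicat_real {a - 1..b + 1} x *\<^sub>R (H n x - g x)\<^sup>2" k] by simp
    also have "\<dots> \<ge> (LINT x:{a..b}|lborel. (H n (x + k) - g (x + k))\<^sup>2)"
      unfolding set_lebesgue_integral_def
    proof (rule Bochner_Integration.integral_mono)
      have mk: "(\<lambda>x. H n (x + k)) \<in> borel_measurable borel" "(\<lambda>x. g (x + k)) \<in> borel_measurable borel"
        by (rule measurable_compose[OF _ mH] measurable_compose[OF _ g]; simp)+
      show "integrable lborel (\<lambda>x. indicat_real {a..b} x *\<^sub>R (H n (x + k) - g (x + k))\<^sup>2)"
        using int[OF mk, of a b] HM M by (simp add: set_integrable_def)
      have "integrable lborel (\<lambda>x. indicat_real {a - 1..b + 1} x *\<^sub>R (H n x - g x)\<^sup>2)"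
        using int[OF mH g HM M] by (simp add: set_integrable_def)
      from lborel_integrable_real_affine[OF this, of 1 k]
      show "integrable lborel (\<lambda>x. indicat_real {a - 1..b + 1} (k + x) *\<^sub>R (H n (k + x) - g (k + x))\<^sup>2)" by simp
      show "indicat_real {a..b} x *\<^sub>R (H n (x + k) - g (x + k))\<^sup>2 \<le> indicat_real {a - 1..b + 1} (k + x) *\<^sub>R (H n (k + x) - g (k + x))\<^sup>2" for x
        using that by (auto simp: indicator_def add.commute abs_le_iff)
    qed
    finally show ?thesis .
  qed
  show ?thesis
  proof (rule tendstoI)
    fix eps :: real assume eps: "0 < eps"
    have "\<forall>\<^sub>F n in sequentially. ?e n < eps / 12"
      by (rule order_tendstoD(2)[OF e]) (use eps in simp)
    then obtain n where n: "?e n < eps / 12" by (auto simp: eventually_sequentially)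
    \<comment> \<open>The final bound is \<open>8 * ?e n + 4 * \<eta> * (b - a)\<close>; the choices
      make the first part less than two thirds of \<open>eps\<close> and the second at most one
      third. The \<open>+ 1\<close> avoids a zero denominator when \<open>a = b\<close>.\<close>
    define \<eta> where "\<eta> = eps / (12 * (b - a + 1))"
    have \<eta>: "\<eta> > 0" using eps ab by (simp add: \<eta>_def)
    have "uniformly_continuous_on {a - 1..b + 1} (H n)"
      by (intro compact_uniformly_continuous continuous_on_subset[OF cH]) auto
    then obtain d where d: "d > 0" "\<And>x y. x \<in> {a - 1..b + 1} \<Longrightarrow> y \<in> {a - 1..b + 1} \<Longrightarrow> dist y x < d \<Longrightarrow> dist (H n y) (H n x) < sqrt \<eta>"
      using \<eta> unfolding uniformly_continuous_on_def by (metis real_sqrt_gt_zero)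
    have "\<forall>\<^sub>F k in nhds (0::real). \<bar>k\<bar> < min d 1"
      using eventually_nhds_in_open[of "ball 0 (min d 1)" "0::real"] d(1) by (auto simp: dist_real_def)
    then show "\<forall>\<^sub>F k in nhds 0. dist (LINT x:{a..b}|lborel. (g (x + k) - g x)\<^sup>2) 0 < eps"
    proof eventually_elim
      case (elim k)
      have mk: "(\<lambda>x. H n (x + k)) \<in> borel_measurable borel" "(\<lambda>x. g (x + k)) \<in> borel_measurable borel"
        by (rule measurable_compose[OF _ mH] measurable_compose[OF _ g]; simp)+
      let ?A = "\<lambda>x. (H n (x + k) - g (x + k))\<^sup>2" and ?C = "\<lambda>x. (H n x - g x)\<^sup>2" and ?L = "\<lambda>x. (g (x + k) - g x)\<^sup>2"
      have iA: "set_integrable lborel {a..b} ?A" and iC: "set_integrable lborel {a..b} ?C" and iL: "set_integrable lborel {a..b} ?L"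
        using int[OF mk] int[OF mH g] int[OF mk(2) g] HM M by auto
      have ic: "set_integrable lborel {a..b} (\<lambda>x. 4 * \<eta>)" by (rule borel_integrable_atLeastAtMost') simp
      have i4: "set_integrable lborel {a..b} (\<lambda>x. 4 * ?A x + 4 * ?C x)"
        using iA iC by (intro set_integral_add set_integrable_mult_right) auto
      have "(LINT x:{a..b}|lborel. ?L x) \<le> (LINT x:{a..b}|lborel. (4 * ?A x + 4 * ?C x) + 4 * \<eta>)"
      proof (rule set_integral_mono[OF iL])
        show "set_integrable lborel {a..b} (\<lambda>x. (4 * ?A x + 4 * ?C x) + 4 * \<eta>)"
          using i4 ic by (rule set_integral_add(1))
        fix x assume x: "x \<in> {a..b}"
        have "dist (H n (x + k)) (H n x) < sqrt \<eta>"
          using elim x by (intro d(2)) (auto simp: dist_real_def)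
        then have "\<bar>H n (x + k) - H n x\<bar> \<le> sqrt \<eta>" by (simp add: dist_real_def)
        from power_mono[OF this, of 2] have H2: "(H n (x + k) - H n x)\<^sup>2 \<le> \<eta>" using \<eta> by simp
        have "?L x = ((g (x + k) - H n (x + k)) + ((H n (x + k) - H n x) + (H n x - g x)))\<^sup>2" by simp
        also have "\<dots> \<le> 2 * (g (x + k) - H n (x + k))\<^sup>2 + 2 * ((H n (x + k) - H n x) + (H n x - g x))\<^sup>2"
          by (rule square_sum_le)
        also have "\<dots> \<le> 2 * ?A x + 2 * (2 * (H n (x + k) - H n x)\<^sup>2 + 2 * ?C x)"
          using square_sum_le[of "H n (x + k) - H n x" "H n x - g x"] power2_commute[of "g (x + k)" "H n (x + k)"] by simp
        also have "\<dots> \<le> (4 * ?A x + 4 * ?C x) + 4 * \<eta>"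
        proof -
          have "2 * A + 2 * (2 * B + 2 * C) \<le> (4 * A + 4 * C) + 4 * \<eta>" if "B \<le> \<eta>" "0 \<le> A" for A B C :: real
            using that by simp
          from this[OF H2 zero_le_power2] show ?thesis .
        qed
        finally show "?L x \<le> (4 * ?A x + 4 * ?C x) + 4 * \<eta>" .
      qed
      also have "\<dots> = 4 * (LINT x:{a..b}|lborel. ?A x) + 4 * (LINT x:{a..b}|lborel. ?C x) + 4 * \<eta> * (b - a)"
      proof -
        have "(LINT x:{a..b}|lborel. 4 * \<eta>) = 4 * \<eta> * (b - a)"
          using ab by (simp add: set_lebesgue_integral_def)
        moreover have "(LINT x:{a..b}|lborel. 4 * ?A x + 4 * ?C x) = 4 * (LINT x:{a..b}|lborel. ?A x) + 4 * (LINT x:{a..b}|lborel. ?C x)"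
          using iA iC by (subst set_integral_add(2)) auto
        ultimately show ?thesis using set_integral_add(2)[OF i4 ic] by simp
      qed
      also have "\<dots> \<le> 4 * ?e n + 4 * ?e n + eps / 3"
      proof -
        have "(LINT x:{a..b}|lborel. ?A x) \<le> ?e n" using elim by (intro shift) auto
        moreover have "(LINT x:{a..b}|lborel. ?C x) \<le> ?e n" using shift[of 0 n] by simp
        moreover have "4 * \<eta> * (b - a) \<le> eps / 3" using eps ab by (simp add: \<eta>_def field_simps)
        ultimately show ?thesis by linarith
      qed
      also have "\<dots> < eps" using n by simp
      finally have "(LINT x:{a..b}|lborel. ?L x) < eps" .
      moreover have "0 \<le> (LINT x:{a..b}|lborel. ?L x)"
        unfolding set_lebesgue_integral_def by (intro Bochner_Integration.integral_nonneg) auto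
      ultimately show ?case by (simp add: dist_real_def)
    qed
  qed
qed

lemma cont_L2_coneI:
  assumes "\<And>t. 0 \<le> t \<Longrightarrow> t < t0 \<Longrightarrow> L2_on (ball x0 (t0 - t)) (\<lambda>x. f x t)"
    and "\<And>t1 t. 0 \<le> t \<Longrightarrow> t \<le> t1 \<Longrightarrow> t1 < t0 \<Longrightarrow>
      ((\<lambda>s. LINT x:ball x0 (t0 - t1)|lebesgue. (f x s - f x t)\<^sup>2) \<longlongrightarrow> 0) (at t within {0..t1})"
  shows "cont_L2_cone x0 t0 f"
  unfolding cont_L2_cone_def
proof (intro conjI ballI)
  fix t1 t assume "t1 \<in> {0..<t0}" "t \<in> {0..t1}"
  then have "((\<lambda>s. sqrt (LINT x:ball x0 (t0 - t1)|lebesgue. (f x s - f x t)\<^sup>2)) \<longlongrightarrow> sqrt 0) (at t within {0..t1})"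
    by (intro tendsto_real_sqrt assms(2)) auto
  then show "((\<lambda>s. L2_norm_on (ball x0 (t0 - t1)) (\<lambda>x. f x s - f x t)) \<longlongrightarrow> 0) (at t within {0..t1})"
    by (simp add: L2_norm_on_def)
qed (use assms(1) in auto)

lemma cont_L2_coneD:
  assumes "cont_L2_cone x0 t0 f"
  shows "0 \<le> t \<Longrightarrow> t < t0 \<Longrightarrow> L2_on (ball x0 (t0 - t)) (\<lambda>x. f x t)"
    and "0 \<le> t \<Longrightarrow> t \<le> t1 \<Longrightarrow> t1 < t0 \<Longrightarrow>
      ((\<lambda>s. LINT x:ball x0 (t0 - t1)|lebesgue. (f x s - f x t)\<^sup>2) \<longlongrightarrow> 0) (at t within {0..t1})"
proof -
  show "0 \<le> t \<Longrightarrow> t < t0 \<Longrightarrow> L2_on (ball x0 (t0 - t)) (\<lambda>x. f x t)"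
    using assms by (auto simp: cont_L2_cone_def)
  assume t: "0 \<le> t" "t \<le> t1" "t1 < t0"
  then have "((\<lambda>s. L2_norm_on (ball x0 (t0 - t1)) (\<lambda>x. f x s - f x t)) \<longlongrightarrow> 0) (at t within {0..t1})"
    using assms by (auto simp: cont_L2_cone_def)
  then have "((\<lambda>s. (L2_norm_on (ball x0 (t0 - t1)) (\<lambda>x. f x s - f x t))\<^sup>2) \<longlongrightarrow> 0\<^sup>2) (at t within {0..t1})"
    by (intro tendsto_power)
  then show "((\<lambda>s. LINT x:ball x0 (t0 - t1)|lebesgue. (f x s - f x t)\<^sup>2) \<longlongrightarrow> 0) (at t within {0..t1})"
    by (simp add: L2_norm_on_def set_lint_nonneg)
qed

lemma cont_L2_cone_add:
  assumes f: "cont_L2_cone x0 t0 f" and g: "cont_L2_cone x0 t0 g"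
  shows "cont_L2_cone x0 t0 (\<lambda>x t. f x t + g x t)"
proof (rule cont_L2_coneI)
  show "L2_on (ball x0 (t0 - t)) (\<lambda>x. f x t + g x t)" if "0 \<le> t" "t < t0" for t
    using L2_on_add[OF cont_L2_coneD(1)[OF f that] cont_L2_coneD(1)[OF g that], of 1] by simp
  fix t1 t assume t: "0 \<le> t" "t \<le> t1" "t1 < t0"
  let ?B = "ball x0 (t0 - t1)"
  have l2: "L2_on ?B (\<lambda>x. k x s)" if k: "cont_L2_cone x0 t0 k" and s: "s \<in> {0..t1}" for k s
    by (rule L2_on_subset[OF cont_L2_coneD(1)[OF k, of s]]) (use s t in \<open>auto simp: dist_real_def\<close>)
  show "((\<lambda>s. LINT x:?B|lebesgue. (f x s + g x s - (f x t + g x t))\<^sup>2) \<longlongrightarrow> 0) (at t within {0..t1})"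
  proof (rule tendsto_sandwich[OF _ _ tendsto_const])
    show "\<forall>\<^sub>F s in at t within {0..t1}. 0 \<le> (LINT x:?B|lebesgue. (f x s + g x s - (f x t + g x t))\<^sup>2)"
      by (auto intro!: always_eventually set_lint_nonneg)
    have "\<forall>\<^sub>F s in at t within {0..t1}. s \<in> {0..t1}" by (simp add: eventually_at_filter)
    then show "\<forall>\<^sub>F s in at t within {0..t1}. (LINT x:?B|lebesgue. (f x s + g x s - (f x t + g x t))\<^sup>2)
      \<le> 2 * (LINT x:?B|lebesgue. (f x s - f x t)\<^sup>2) + 2 * (LINT x:?B|lebesgue. (g x s - g x t)\<^sup>2)"
    proof eventually_elim
      case (elim s)
      have tt: "t \<in> {0..t1}" using t by simp
      have i: "set_integrable lebesgue ?B (\<lambda>x. (f x s - f x t)\<^sup>2)" "set_integrable lebesgue ?B (\<lambda>x. (g x s - g x t)\<^sup>2)"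
        using L2_on_diff[OF l2[OF f elim] l2[OF f tt]] L2_on_diff[OF l2[OF g elim] l2[OF g tt]] by (auto simp: L2_on_def)
      have "L2_on ?B (\<lambda>x. (f x s - f x t) + 1 * (g x s - g x t))"
        by (intro L2_on_add L2_on_diff l2 f g elim tt)
      then have i0: "set_integrable lebesgue ?B (\<lambda>x. (f x s + g x s - (f x t + g x t))\<^sup>2)"
        by (simp add: L2_on_def algebra_simps)
      have "(LINT x:?B|lebesgue. (f x s + g x s - (f x t + g x t))\<^sup>2)
          \<le> (LINT x:?B|lebesgue. 2 * (f x s - f x t)\<^sup>2 + 2 * (g x s - g x t)\<^sup>2)"
      proof (rule set_integral_mono[OF i0])
        show "(f x s + g x s - (f x t + g x t))\<^sup>2 \<le> 2 * (f x s - f x t)\<^sup>2 + 2 * (g x s - g x t)\<^sup>2" for x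
          using square_sum_le[of "f x s - f x t" "g x s - g x t"] by (simp add: algebra_simps)
      qed (use i in \<open>auto intro!: set_integral_add(1)\<close>)
      also have "\<dots> = 2 * (LINT x:?B|lebesgue. (f x s - f x t)\<^sup>2) + 2 * (LINT x:?B|lebesgue. (g x s - g x t)\<^sup>2)"
        using i by (subst set_integral_add(2)) auto
      finally show ?case .
    qed
    show "((\<lambda>s. 2 * (LINT x:?B|lebesgue. (f x s - f x t)\<^sup>2) + 2 * (LINT x:?B|lebesgue. (g x s - g x t)\<^sup>2)) \<longlongrightarrow> 0) (at t within {0..t1})"
      using tendsto_add[OF tendsto_mult_right_zero[OF cont_L2_coneD(2)[OF f t], of 2] tendsto_mult_right_zero[OF cont_L2_coneD(2)[OF g t], of 2]] by simp
  qed
qed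

lemma cont_L2_cone_translate:
  fixes g :: "real \<Rightarrow> real"
  assumes g: "g \<in> borel_measurable borel" and M: "\<And>x. \<bar>g x\<bar> \<le> M"
  shows "cont_L2_cone x0 t0 (\<lambda>x t. g (x + \<sigma> * t))"
proof (rule cont_L2_coneI)
  have mg: "(\<lambda>x. g (x + c)) \<in> borel_measurable borel" for c by (rule measurable_compose[OF _ g]) simp
  show "L2_on (ball x0 (t0 - t)) (\<lambda>x. g (x + \<sigma> * t))" for t
    using M by (intro L2_on_bounded_borel[OF mg]) auto
  fix t1 t assume t: "0 \<le> t" "t \<le> t1" "t1 < t0"
  let ?G = "\<lambda>x. g (x + \<sigma> * t)"
  have "((\<lambda>s. \<sigma> * (s - t)) \<longlongrightarrow> \<sigma> * (t - t)) (at t within {0..t1})" by (intro tendsto_intros)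
  then have lim: "filterlim (\<lambda>s. \<sigma> * (s - t)) (nhds 0) (at t within {0..t1})" by simp
  have conv: "((\<lambda>s. LINT x:{x0 - (t0 - t1)..x0 + (t0 - t1)}|lborel. (?G (x + \<sigma> * (s - t)) - ?G x)\<^sup>2) \<longlongrightarrow> 0) (at t within {0..t1})"
    using filterlim_compose[OF L2_translation[OF mg M] lim] .
  have le: "(LINT x:ball x0 (t0 - t1)|lebesgue. (g (x + \<sigma> * s) - g (x + \<sigma> * t))\<^sup>2)
      \<le> (LINT x:{x0 - (t0 - t1)..x0 + (t0 - t1)}|lborel. (?G (x + \<sigma> * (s - t)) - ?G x)\<^sup>2)" for s
  proof -
    let ?F = "\<lambda>x. (g (x + \<sigma> * s) - g (x + \<sigma> * t))\<^sup>2" and ?I = "{x0 - (t0 - t1)..x0 + (t0 - t1)}"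
    have mF: "?F \<in> borel_measurable borel" using mg by auto
    have b: "\<bar>?F x\<bar> \<le> (2 * M)\<^sup>2" for x
    proof -
      have "\<bar>g (x + \<sigma> * s) - g (x + \<sigma> * t)\<bar> \<le> 2 * M"
        using abs_triangle_ineq4[of "g (x + \<sigma> * s)" "g (x + \<sigma> * t)"] M[of "x + \<sigma> * s"] M[of "x + \<sigma> * t"] by simp
      from power_mono[OF this, of 2] show ?thesis by simp
    qed
    have "(LINT x:ball x0 (t0 - t1)|lebesgue. ?F x) \<le> (LINT x:?I|lebesgue. ?F x)"
      using b by (intro set_lint_mono_set set_integrable_bounded_borel(2)[OF mF]) (auto simp: dist_real_def)
    also have "\<dots> = (LINT x:?I|lborel. ?F x)"
      unfolding set_lebesgue_integral_def using mF by (intro integral_completion) auto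
    also have "\<dots> = (LINT x:?I|lborel. (?G (x + \<sigma> * (s - t)) - ?G x)\<^sup>2)"
      by (simp add: algebra_simps)
    finally show ?thesis .
  qed
  show "((\<lambda>s. LINT x:ball x0 (t0 - t1)|lebesgue. (g (x + \<sigma> * s) - g (x + \<sigma> * t))\<^sup>2) \<longlongrightarrow> 0) (at t within {0..t1})"
    by (rule tendsto_sandwich[OF _ _ tendsto_const conv]) (auto intro!: always_eventually set_lint_nonneg le)
qed

text \<open>The apex is missing from \<open>bcone\<close>, so \<open>f\<close> may be unbounded
  there. For \<open>t1 < t0\<close>, however, the rectangle over the common section is compact and
  contained in the cone, and \<open>f\<close> is uniformly continuous on it.\<close>

lemma cont_L2_cone_continuous:
  assumes f: "continuous_on (bcone x0 t0 1) (\<lambda>(x, t). f x t)"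
  shows "cont_L2_cone x0 t0 f"
proof (rule cont_L2_coneI)
  fix t assume t: "0 \<le> t" "t < t0"
  have "continuous_on {x0 - (t0 - t)..x0 + (t0 - t)} (\<lambda>x. f x t)"
    using t by (intro continuous_on_compose2[OF f, of _ "\<lambda>x. (x, t)", simplified] continuous_intros) (auto simp: bcone_def)
  then show "L2_on (ball x0 (t0 - t)) (\<lambda>x. f x t)"
    by (rule L2_on_continuous) (auto simp: dist_real_def)
next
  fix t1 t assume t: "0 \<le> t" "t \<le> t1" "t1 < t0"
  let ?r = "t0 - t1" let ?B = "ball x0 ?r"
  let ?K = "{x0 - ?r..x0 + ?r} \<times> {0..t1}"
  have K: "?K \<subseteq> bcone x0 t0 1" using t by (auto simp: bcone_def)
  have sub: "?B \<subseteq> {x0 - ?r..x0 + ?r}" by (auto simp: dist_real_def)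
  have "uniformly_continuous_on ?K (\<lambda>(x, t). f x t)"
    by (intro compact_uniformly_continuous continuous_on_subset[OF f K] compact_Times compact_Icc)
  then have uc: "\<And>e. e > 0 \<Longrightarrow> \<exists>d>0. \<forall>z\<in>?K. \<forall>z'\<in>?K. dist z' z < d \<longrightarrow> dist (case z' of (x, t) \<Rightarrow> f x t) (case z of (x, t) \<Rightarrow> f x t) < e"
    unfolding uniformly_continuous_on_def by blast
  show "((\<lambda>s. LINT x:?B|lebesgue. (f x s - f x t)\<^sup>2) \<longlongrightarrow> 0) (at t within {0..t1})"
  proof (rule tendstoI)
    fix e :: real assume e: "0 < e"
    define \<eta> where "\<eta> = e / (2 * (2 * ?r))"
    have \<eta>: "\<eta> > 0" using e t by (simp add: \<eta>_def)
    obtain d where d: "d > 0" "\<And>z z'. z \<in> ?K \<Longrightarrow> z' \<in> ?K \<Longrightarrow> dist z' z < d \<Longrightarrow> dist (case z' of (x, t) \<Rightarrow> f x t) (case z of (x, t) \<Rightarrow> f x t) < sqrt \<eta>"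
      using uc[of "sqrt \<eta>"] \<eta> by auto
    have "\<forall>\<^sub>F s in at t within {0..t1}. s \<in> {0..t1} \<and> dist s t < d"
      unfolding eventually_at using d(1) by blast
    then show "\<forall>\<^sub>F s in at t within {0..t1}. dist (LINT x:?B|lebesgue. (f x s - f x t)\<^sup>2) 0 < e"
    proof eventually_elim
      case (elim s)
      have cs: "continuous_on {x0 - ?r..x0 + ?r} (\<lambda>x. f x s')" if "s' \<in> {0..t1}" for s'
        using K that by (intro continuous_on_compose2[OF f, of _ "\<lambda>x. (x, s')", simplified] continuous_intros) auto
      have tt: "t \<in> {0..t1}" using t by simp
      have l: "set_integrable lebesgue ?B (\<lambda>x. (f x s - f x t)\<^sup>2)"
        using L2_on_diff[OF L2_on_continuous[OF cs sub] L2_on_continuous[OF cs[OF tt] sub]] elim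
        by (auto simp: L2_on_def)
      have "(LINT x:?B|lebesgue. (f x s - f x t)\<^sup>2) \<le> (LINT x:{x0 - ?r..x0 + ?r}|lebesgue. \<eta>)"
      proof (rule set_lint_mono_set[OF l])
        show "set_integrable lebesgue {x0 - ?r..x0 + ?r} (\<lambda>x. \<eta>)" by (rule set_integrable_lebesgue_continuous) simp
        show "?B \<subseteq> {x0 - ?r..x0 + ?r}" by (auto simp: dist_real_def)
        fix x assume "x \<in> ?B"
        then have "x \<in> {x0 - ?r..x0 + ?r}" by (auto simp: dist_real_def)
        then have "dist (f x s) (f x t) < sqrt \<eta>"
          using d(2)[of "(x, t)" "(x, s)"] elim tt by (simp add: dist_Pair_Pair)
        then have "\<bar>f x s - f x t\<bar> \<le> sqrt \<eta>" by (simp add: dist_real_def)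
        from power_mono[OF this, of 2] show "(f x s - f x t)\<^sup>2 \<le> \<eta>" using \<eta> by simp
      qed (use \<eta> in simp)
      also have "\<dots> = 2 * ?r * \<eta>" using t by (simp add: set_lebesgue_integral_def)
      also have "\<dots> = e / 2"
      proof -
        have half: "2 * r * (e / (2 * (2 * r))) = e / 2" if "r > 0" for r :: real using that by simp
        show ?thesis unfolding \<eta>_def by (rule half) (use t in simp)
      qed
      also have "\<dots> < e" using e by simp
      finally show ?case
        using set_lint_nonneg[of ?B "\<lambda>x. (f x s - f x t)\<^sup>2"] by (simp add: dist_real_def)
    qed
  qed
qed

section \<open>The maximal domain\<close>

text \<open>The Liouville functions tied to the data: \<open>f\<close> and \<open>h\<close> are the
  two travelling parts of the free wave. Their weak derivatives are Borel and bounded everywhere,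
  not almost everywhere, so that they may be composed with any affine map.\<close>

locale liouville_wave = liouville f h a1 a2 c1 c2
  for f h a1 a2 c1 c2 :: "real \<Rightarrow> real" +
  fixes g1 g2 u0 u1 :: "real \<Rightarrow> real" and M :: real
  assumes weak_f: "has_weak_deriv UNIV f g1" and weak_h: "has_weak_deriv UNIV h g2"
    and g1: "g1 \<in> borel_measurable borel" "\<And>x. \<bar>g1 x\<bar> \<le> M"
    and g2: "g2 \<in> borel_measurable borel" "\<And>x. \<bar>g2 x\<bar> \<le> M"
    and free: "\<And>x t. 0 \<le> t \<Longrightarrow> free_wave u0 u1 x t = f (x + t) + h (x - t)"
begin

text \<open>Positivity on the whole triangle, in characteristic coordinates. Positivity at the apex
  alone would be too weak: for constant \<open>f = h\<close>, \<open>Z\<close> is a cosine of a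
  multiple of \<open>p - q\<close> and becomes positive again beyond its first zero.\<close>

definition good :: "real \<Rightarrow> real \<Rightarrow> bool" where
  "good x t \<longleftrightarrow> (\<forall>p q. x - t \<le> q \<longrightarrow> q \<le> p \<longrightarrow> p \<le> x + t \<longrightarrow> 0 < Z p q)"

lemma good_iff_tri: "good x t \<longleftrightarrow> (\<forall>(y, s)\<in>tri x t. 0 < Z (y + s) (y - s))"
proof
  assume "good x t"
  then show "\<forall>(y, s)\<in>tri x t. 0 < Z (y + s) (y - s)" by (auto simp: good_def tri_def)
next
  assume *: "\<forall>(y, s)\<in>tri x t. 0 < Z (y + s) (y - s)"
  show "good x t" unfolding good_def
  proof (intro allI impI)
    fix p q assume pq: "x - t \<le> q" "q \<le> p" "p \<le> x + t"
    have "\<bar>(p + q) / 2 - x\<bar> \<le> t - (p - q) / 2" using pq by (intro abs_leI) (auto simp: add_divide_distrib diff_divide_distrib)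
    then have "((p + q) / 2, (p - q) / 2) \<in> tri x t" using pq by (simp add: tri_def)
    with * have "0 < Z ((p + q) / 2 + (p - q) / 2) ((p + q) / 2 - (p - q) / 2)" by blast
    moreover have "(p + q) / 2 + (p - q) / 2 = p" "(p + q) / 2 - (p - q) / 2 = q" by (auto simp: field_simps)
    ultimately show "0 < Z p q" by simp
  qed
qed

lemma good_mono: "good x t \<Longrightarrow> (y, s) \<in> tri x t \<Longrightarrow> good y s"
  unfolding good_iff_tri using tri_mono by blast

text \<open>The triangle is compact and \<open>Z > 0\<close> an open condition. This provides the
  strictly larger \<open>t'\<close> that the definition of the maximal domain asks for.\<close>

lemma good_extend:
  assumes "good x t"
  shows "\<exists>t'>t. good x t'"
proof -
  let ?P = "\<lambda>t. {z. x - t \<le> snd z \<and> snd z \<le> fst z \<and> fst z \<le> x + t}"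
  define W where "W = {z. 0 < Z (fst z) (snd z)}"
  have W: "open W" unfolding W_def by (intro open_Collect_less continuous_intros)
  have "?P t \<subseteq> cbox (x - t, x - t) (x + t, x + t)" by auto
  then have "bounded (?P t)" using bounded_cbox bounded_subset by blast
  moreover have "closed (?P t)" by (intro closed_Collect_conj closed_Collect_le continuous_intros)
  ultimately have K: "compact (?P t)" by (simp add: compact_eq_bounded_closed)
  have sub: "?P t \<subseteq> W" using assms by (auto simp: good_def W_def)
  show ?thesis
  proof (cases "0 \<le> t")
    case False
    then show ?thesis by (intro exI[of _ "t / 2"]) (auto simp: good_def)
  next
    case t: True
    obtain e where e: "0 < e" "(\<Union>z\<in>?P t. ball z e) \<subseteq> W"
      using compact_subset_open_imp_ball_epsilon_subset[OF K W sub] by blast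
    have "0 < Z p q" if pq: "x - (t + e / 3) \<le> q" "q \<le> p" "p \<le> x + (t + e / 3)" for p q
    proof -
      \<comment> \<open>Clamping to \<open>[x - t, x + t]\<close> is monotone, so it respects
        \<open>q \<le> p\<close>; it moves each coordinate by at most \<open>e / 3\<close> and the
        pair by less than \<open>e\<close>.\<close>
      define cl where "cl z = max (x - t) (min (x + t) z)" for z
      have "(cl p, cl q) \<in> ?P t" using pq t by (auto simp: cl_def)
      moreover have "\<bar>p - cl p\<bar> \<le> e / 3" "\<bar>q - cl q\<bar> \<le> e / 3" using pq t e(1) by (auto simp: cl_def max_def min_def abs_if)
      then have "dist (cl p, cl q) (p, q) < e"
        using norm_Pair_le[of "cl p - p" "cl q - q"] e(1) by (simp add: dist_norm abs_minus_commute)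
      ultimately have "(p, q) \<in> (\<Union>z\<in>?P t. ball z e)" by (intro UN_I[of "(cl p, cl q)"]) (auto simp: mem_ball)
      then have "(p, q) \<in> W" by (rule subsetD[OF e(2)])
      then show ?thesis by (simp add: W_def)
    qed
    then have "good x (t + e / 3)" unfolding good_def by blast
    then show ?thesis using e(1) by (intro exI[of _ "t + e / 3"]) auto
  qed
qed

lemma duhamel_good:
  assumes "0 \<le> t" "good x t"
  shows "duhamel u0 u1 v x t"
proof -
  have pos: "\<And>p q. x - t \<le> q \<Longrightarrow> q \<le> p \<Longrightarrow> p \<le> x + t \<Longrightarrow> 0 < Z p q"
    using assms(2) by (auto simp: good_def)
  note d = duhamel_v[OF assms(1) pos]
  show ?thesis unfolding duhamel_def
    using d free[OF assms(1), of x] by (simp add: free_wave_def)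
qed

section \<open>Comparison of arbitrary solutions with the explicit one\<close>

lemma free_bounded: "\<exists>B. \<forall>y s. (y, s) \<in> tri x t \<longrightarrow> \<bar>free_wave u0 u1 y s\<bar> \<le> B"
proof -
  have "bounded (f ` {x - t..x + t})" "bounded (h ` {x - t..x + t})"
    by (intro compact_imp_bounded compact_continuous_image compact_Icc continuous_on_subset[OF cont_f] continuous_on_subset[OF cont_h]; simp)+
  then obtain F H where FH: "\<forall>y\<in>f ` {x - t..x + t}. norm y \<le> F" "\<forall>y\<in>h ` {x - t..x + t}. norm y \<le> H"
    unfolding bounded_iff by blast
  have "\<bar>free_wave u0 u1 y s\<bar> \<le> F + H" if "(y, s) \<in> tri x t" for y s
  proof -
    have "y + s \<in> {x - t..x + t}" "y - s \<in> {x - t..x + t}" "0 \<le> s" using that by (auto simp: tri_def)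
    then have "\<bar>f (y + s)\<bar> \<le> F" "\<bar>h (y - s)\<bar> \<le> H" "free_wave u0 u1 y s = f (y + s) + h (y - s)"
      using FH free[of s y] by auto
    then show ?thesis using order_trans[OF abs_triangle_ineq add_mono] by simp
  qed
  then show ?thesis by blast
qed

lemma solution_eq_v:
  assumes D: "\<And>y s. (y, s) \<in> tri x t \<Longrightarrow> duhamel u0 u1 w y s" and t: "0 \<le> t" and g: "good x t"
  shows "w x t = v x t"
proof -
  obtain B where B: "\<And>y s. (y, s) \<in> tri x t \<Longrightarrow> \<bar>free_wave u0 u1 y s\<bar> \<le> B" using free_bounded by blast
  have "duhamel u0 u1 v y s" if "(y, s) \<in> tri x t" for y s
    using that good_mono[OF g that] by (intro duhamel_good) (auto simp: tri_def)
  note E = this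
  show ?thesis
    by (rule duhamel_unique[OF D E t B]) (use t in \<open>auto simp: tri_def\<close>)
qed

text \<open>At an earliest zero of \<open>Z\<close> the explicit solution tends to infinity, whereas Duhamel's
  formula at that point bounds every solution from above on the backward cone.\<close>

lemma duhamel_imp_good:
  assumes D: "\<And>y s. (y, s) \<in> tri x t \<Longrightarrow> duhamel u0 u1 w y s" and t: "0 \<le> t"
  shows "good x t"
proof (rule ccontr)
  assume "\<not> good x t"
  define S where "S = {z \<in> tri x t. Z (fst z + snd z) (fst z - snd z) \<le> 0}"
  obtain y s where "(y, s) \<in> tri x t" "\<not> 0 < Z (y + s) (y - s)"
    using \<open>\<not> good x t\<close> unfolding good_iff_tri by blast
  then have "(y, s) \<in> S" by (simp add: S_def)
  then have S0: "S \<noteq> {}" by blast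
  have tri': "tri x t = {z. 0 \<le> snd z \<and> \<bar>fst z - x\<bar> \<le> t - snd z}" by (auto simp: tri_def)
  have "tri x t \<subseteq> cbox (x - t, 0) (x + t, t)" by (auto simp: tri_def)
  then have "bounded (tri x t)" by (rule bounded_subset[OF bounded_cbox])
  then have "bounded S" by (rule bounded_subset) (auto simp: S_def)
  moreover have "S = {z. (0 \<le> snd z \<and> \<bar>fst z - x\<bar> \<le> t - snd z) \<and> Z (fst z + snd z) (fst z - snd z) \<le> 0}"
    by (simp add: S_def tri')
  moreover have "closed {z. (0 \<le> snd z \<and> \<bar>fst z - x\<bar> \<le> t - snd z) \<and> Z (fst z + snd z) (fst z - snd z) \<le> 0}"
    by (intro closed_Collect_conj closed_Collect_le continuous_intros)
  ultimately have "compact S" by (simp add: compact_eq_bounded_closed)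
  from continuous_attains_inf[OF this S0 continuous_on_snd[OF continuous_on_id]]
  obtain z where z: "z \<in> S" "\<And>z'. z' \<in> S \<Longrightarrow> snd z \<le> snd z'" by blast
  define y1 s1 where "y1 = fst z" and "s1 = snd z"
  have P1: "(y1, s1) \<in> tri x t" and Z1: "Z (y1 + s1) (y1 - s1) \<le> 0" using z(1) by (auto simp: S_def y1_def s1_def)
  have s1: "s1 > 0"
  proof -
    have "s1 \<noteq> 0" using Z1 diag(1)[of y1] by auto
    then show ?thesis using P1 by (auto simp: tri_def)
  qed
  have before: "Z (y + s) (y - s) > 0" if "(y, s) \<in> tri y1 s1" "s < s1" for y s
    using that z(2)[of "(y, s)"] tri_mono[OF P1] by (force simp: S_def s1_def)
  have gd: "good y1 \<tau>" if "\<tau> < s1" for \<tau>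
    unfolding good_iff_tri using before that by (auto simp: tri_def)
  have sub: "(y, s) \<in> tri x t" if "(y, s) \<in> tri y1 s1" for y s using tri_mono[OF P1] that by blast
  obtain B where B: "\<And>y s. (y, s) \<in> tri x t \<Longrightarrow> \<bar>free_wave u0 u1 y s\<bar> \<le> B" using free_bounded by blast
  obtain N where N: "\<And>y s. (y, s) \<in> tri x t \<Longrightarrow> \<bar>w y s\<bar> \<le> N"
    using duhamel_bounded[OF D t B] by blast
  \<comment> \<open>Below the first zero \<open>w\<close> coincides with
    \<open>v = f + h - 2 ln Z\<close>; since \<open>v \<le> N\<close> and
    \<open>f + h \<ge> - B\<close>, the logarithm of \<open>Z\<close> is at least
    \<open>(- B - N) / 2\<close>, uniformly up to \<open>s1\<close>.\<close>
  have lower: "exp ((- B - N) / 2) \<le> Z (y1 + \<tau>) (y1 - \<tau>)" if \<tau>: "0 \<le> \<tau>" "\<tau> < s1" for \<tau>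
  proof -
    have Q: "(y1, \<tau>) \<in> tri y1 s1" using \<tau> by (simp add: tri_def)
    have "w y1 \<tau> = v y1 \<tau>"
      using D sub tri_mono[OF Q] gd[OF \<tau>(2)] \<tau>(1) by (intro solution_eq_v) blast+
    then have "v y1 \<tau> \<le> N" using N[OF sub[OF Q]] by simp
    moreover have "- B \<le> f (y1 + \<tau>) + h (y1 - \<tau>)" using B[OF sub[OF Q]] free[OF \<tau>(1), of y1] by simp
    ultimately have "(- B - N) / 2 \<le> ln (Z (y1 + \<tau>) (y1 - \<tau>))" by (simp add: v_def)
    then have "exp ((- B - N) / 2) \<le> exp (ln (Z (y1 + \<tau>) (y1 - \<tau>)))" by (rule exp_le_cancel_iff[THEN iffD2])
    also have "\<dots> = Z (y1 + \<tau>) (y1 - \<tau>)" by (rule exp_ln[OF before[OF Q \<tau>(2)]])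
    finally show ?thesis .
  qed
  have "((\<lambda>\<tau>. Z (y1 + \<tau>) (y1 - \<tau>)) \<longlongrightarrow> Z (y1 + s1) (y1 - s1)) (at s1 within {0..<s1})"
  proof -
    have "continuous_on UNIV (\<lambda>\<tau>. Z (y1 + \<tau>) (y1 - \<tau>))" by (intro continuous_intros)
    then have "isCont (\<lambda>\<tau>. Z (y1 + \<tau>) (y1 - \<tau>)) s1" by (simp add: continuous_on_eq_continuous_at)
    then show ?thesis unfolding isCont_def by (rule tendsto_within_subset) simp
  qed
  moreover have "\<forall>\<^sub>F \<tau> in at s1 within {0..<s1}. exp ((- B - N) / 2) \<le> Z (y1 + \<tau>) (y1 - \<tau>)"
    using lower by (auto simp: eventually_at_filter)
  moreover have "at s1 within {0..<s1} \<noteq> bot"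
    using s1 by (subst at_within_eq_bot_iff) (auto simp: closure_atLeastLessThan)
  ultimately have "exp ((- B - N) / 2) \<le> Z (y1 + s1) (y1 - s1)" by (intro tendsto_lowerbound)
  then show False using Z1 exp_gt_zero[of "(- B - N) / 2"] by linarith
qed

section \<open>Weak derivatives and energy regularity of the explicit solution\<close>

definition vx :: "real \<Rightarrow> real \<Rightarrow> real" where
  "vx x t = g1 (x + t) + g2 (x - t) + (Vp (x + t) (x - t) + Vq (x + t) (x - t))"
definition vt :: "real \<Rightarrow> real \<Rightarrow> real" where
  "vt x t = g1 (x + t) - g2 (x - t) + (Vp (x + t) (x - t) - Vq (x + t) (x - t))"

lemma deriv_lnZ_comp:
  assumes p: "(p has_real_derivative p') (at x)" and q: "(q has_real_derivative q') (at x)"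
    and Z: "0 < Z (p x) (q x)"
  shows "((\<lambda>x. - 2 * ln (Z (p x) (q x))) has_real_derivative Vp (p x) (q x) * p' + Vq (p x) (q x) * q') (at x)"
proof -
  have ac: "((\<lambda>x. k (r x)) has_real_derivative dk (r x) * r') (at x)"
    if "\<And>y. (k has_real_derivative dk y) (at y)" "(r has_real_derivative r') (at x)" for k dk r :: "real \<Rightarrow> real" and r'
    by (rule DERIV_chain2[OF that])
  have "((\<lambda>x. Z (p x) (q x)) has_real_derivative
      (- kap * exp (f (p x)) * Yp (p x) (q x)) * p' + (kap * exp (h (q x)) * Yq (p x) (q x)) * q') (at x)"
    unfolding Z_def Yp_def Yq_def
    by (rule derivative_eq_intros ac[OF deriv_a1 p] ac[OF deriv_a2 p] ac[OF deriv_c1 q] ac[OF deriv_c2 q] refl)+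
      (simp add: algebra_simps)
  from DERIV_cmult[OF DERIV_chain2[OF DERIV_ln_divide[OF Z] this], of "-2"]
  show ?thesis using Z by (simp add: Vp_def Vq_def field_simps)
qed

lemma has_weak_deriv_v:
  assumes J: "open_ivl J" and pos: "\<And>x. x \<in> J \<Longrightarrow> 0 < Z (x + t) (x - t)"
  shows "has_weak_deriv J (\<lambda>x. v x t) (\<lambda>x. vx x t)"
proof -
  have 1: "has_weak_deriv J (\<lambda>x. f (x + t)) (\<lambda>x. g1 (x + t))"
    using has_weak_deriv_affine[OF J cont_f weak_f g1, of 1 t] by (simp add: add.commute)
  have 2: "has_weak_deriv J (\<lambda>x. h (x - t)) (\<lambda>x. g2 (x - t))"
    using has_weak_deriv_affine[OF J cont_h weak_h g2, of 1 "- t"] by (simp add: add.commute)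
  have 3: "has_weak_deriv J (\<lambda>x. - 2 * ln (Z (x + t) (x - t))) (\<lambda>x. Vp (x + t) (x - t) + Vq (x + t) (x - t))"
  proof (rule has_weak_deriv_C1[OF J])
    fix x assume "x \<in> J"
    have "((\<lambda>x. x + t) has_real_derivative 1) (at x)" "((\<lambda>x. x - t) has_real_derivative 1) (at x)"
      by (auto intro!: derivative_eq_intros)
    from deriv_lnZ_comp[OF this pos[OF \<open>x \<in> J\<close>]]
    show "((\<lambda>x. - 2 * ln (Z (x + t) (x - t))) has_real_derivative Vp (x + t) (x - t) + Vq (x + t) (x - t)) (at x)" by simp
  next
    show "continuous_on J (\<lambda>x. Vp (x + t) (x - t) + Vq (x + t) (x - t))"
      using pos by (intro continuous_on_add cont_VE_comp continuous_intros) force+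
  qed
  show ?thesis
    using has_weak_deriv_add[OF J has_weak_deriv_add[OF J 1 2] 3] by (simp add: v_def vx_def)
qed

text \<open>General \<open>P\<close> and \<open>Q\<close> serve both the original variables, where
  they are \<open>x + t\<close> and \<open>x - t\<close>, and the similarity variables.\<close>

lemma has_time_deriv_lnZ:
  assumes J: "open_ivl J" and pos: "\<And>x. x \<in> J \<Longrightarrow> 0 < Z (P t x) (Q t x)"
    and P: "\<And>s x. ((\<lambda>s. P s x) has_real_derivative P' s x) (at s)"
    and Q: "\<And>s x. ((\<lambda>s. Q s x) has_real_derivative Q' s x) (at s)"
    and cP: "continuous_on UNIV (\<lambda>(s, x). P s x)" "continuous_on UNIV (\<lambda>(s, x). P' s x)"
    and cQ: "continuous_on UNIV (\<lambda>(s, x). Q s x)" "continuous_on UNIV (\<lambda>(s, x). Q' s x)"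
  shows "has_time_deriv J A (\<lambda>x s. - 2 * ln (Z (P s x) (Q s x))) t
    (\<lambda>x. Vp (P t x) (Q t x) * P' t x + Vq (P t x) (Q t x) * Q' t x)"
proof -
  have c: "continuous_on S (\<lambda>z. P (fst z) (snd z))" "continuous_on S (\<lambda>z. P' (fst z) (snd z))"
    "continuous_on S (\<lambda>z. Q (fst z) (snd z))" "continuous_on S (\<lambda>z. Q' (fst z) (snd z))" for S
    using cP cQ by (auto simp: split_beta intro: continuous_on_subset)
  define W where "W = {z. 0 < Z (P (fst z) (snd z)) (Q (fst z) (snd z))}"
  have W: "open W" unfolding W_def by (intro open_Collect_less continuous_intros c)
  have WZ: "Z (P (fst z) (snd z)) (Q (fst z) (snd z)) > 0" if "z \<in> W" for z using that by (simp add: W_def)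
  have WZ': "Z (P (fst z) (snd z)) (Q (fst z) (snd z)) \<noteq> 0" if "z \<in> W" for z using WZ[OF that] by simp
  show ?thesis
  proof (rule has_time_deriv_C1[OF J W, where F' = "\<lambda>x s. Vp (P s x) (Q s x) * P' s x + Vq (P s x) (Q s x) * Q' s x"])
    show "(t, x) \<in> W" if "x \<in> J" for x using pos[OF that] by (simp add: W_def)
    show "((\<lambda>s. - 2 * ln (Z (P s x) (Q s x))) has_real_derivative Vp (P s x) (Q s x) * P' s x + Vq (P s x) (Q s x) * Q' s x) (at s)"
      if "(s, x) \<in> W" for s x
      using WZ[OF that] by (intro deriv_lnZ_comp P Q) simp
    have "continuous_on W (\<lambda>z. - 2 * ln (Z (P (fst z) (snd z)) (Q (fst z) (snd z))))"
      using WZ' by (intro continuous_intros c) auto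
    then show "continuous_on W (\<lambda>(s, x). - 2 * ln (Z (P s x) (Q s x)))" by (simp add: split_beta)
    have "continuous_on W (\<lambda>z. Vp (P (fst z) (snd z)) (Q (fst z) (snd z)) * P' (fst z) (snd z) + Vq (P (fst z) (snd z)) (Q (fst z) (snd z)) * Q' (fst z) (snd z))"
      using WZ' by (intro continuous_on_add continuous_on_mult cont_VE_comp c) auto
    then show "continuous_on W (\<lambda>(s, x). Vp (P s x) (Q s x) * P' s x + Vq (P s x) (Q s x) * Q' s x)" by (simp add: split_beta)
  qed
qed

lemma has_time_deriv_v:
  assumes J: "open_ivl J" and pos: "\<And>x. x \<in> J \<Longrightarrow> 0 < Z (x + t) (x - t)"
  shows "has_time_deriv J A v t (\<lambda>x. vt x t)"
proof -
  have d: "((\<lambda>s. s) has_real_derivative 1) (at s)" "((\<lambda>s. - s) has_real_derivative - 1) (at s)"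
    "((\<lambda>s. 1) has_real_derivative 0) (at s)" for s :: real
    by (auto intro!: derivative_eq_intros)
  have 1: "has_time_deriv J A (\<lambda>x s. f (x + s)) t (\<lambda>x. g1 (x + t))"
    using has_time_deriv_affine[OF J cont_f weak_f g1, of "\<lambda>s. s" "\<lambda>_. 1" "\<lambda>_. 1" "\<lambda>_. 0" A t, OF d(1) _ d(3)]
    by (simp add: add.commute)
  have 2: "has_time_deriv J A (\<lambda>x s. h (x - s)) t (\<lambda>x. - g2 (x - t))"
    using has_time_deriv_affine[OF J cont_h weak_h g2, of "\<lambda>s. - s" "\<lambda>_. - 1" "\<lambda>_. 1" "\<lambda>_. 0" A t, OF d(2) _ d(3)]
    by (simp add: add.commute)
  have 3: "has_time_deriv J A (\<lambda>x s. - 2 * ln (Z (x + s) (x - s))) t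
      (\<lambda>x. Vp (x + t) (x - t) * 1 + Vq (x + t) (x - t) * - 1)"
    by (rule has_time_deriv_lnZ[OF J, where P = "\<lambda>s x. x + s" and Q = "\<lambda>s x. x - s" and P' = "\<lambda>_ _. 1" and Q' = "\<lambda>_ _. - 1"])
      (use pos in \<open>auto intro!: derivative_eq_intros continuous_intros simp: split_beta\<close>)
  have "has_time_deriv J A (\<lambda>x s. f (x + s) + h (x - s) + - 2 * ln (Z (x + s) (x - s))) t
      (\<lambda>x. g1 (x + t) + - g2 (x - t) + (Vp (x + t) (x - t) * 1 + Vq (x + t) (x - t) * - 1))"
    by (rule has_time_deriv_add[OF J has_time_deriv_add[OF J 1 2] 3])
  moreover have "(\<lambda>x s. f (x + s) + h (x - s) + - 2 * ln (Z (x + s) (x - s))) = v"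
    by (simp add: v_def fun_eq_iff)
  ultimately show ?thesis by (simp add: vt_def)
qed

text \<open>The derivatives of \<open>v\<close> split into travelling waves of bounded Borel
  functions, which are continuous in time by continuity of translation in mean square, and terms in
  \<open>Vp\<close>, \<open>Vq\<close>, which are continuous where \<open>Z\<close> does not
  vanish.\<close>

lemma solution_v:
  assumes t0: "0 < t0" and pos: "\<And>x t. (x, t) \<in> bcone x0 t0 1 \<Longrightarrow> 0 < Z (x + t) (x - t)"
  shows "solution_on_cone u0 u1 v x0 t0"
proof -
  have gd: "good x t" if "(x, t) \<in> bcone x0 t0 1" for x t
  proof -
    have "tri x t \<subseteq> bcone x0 t0 1" using that by (auto simp: bcone_def tri_def)
    then show ?thesis using pos by (auto simp: good_iff_tri)
  qed
  have du: "\<forall>(x, t)\<in>bcone x0 t0 1. duhamel u0 u1 v x t"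
    using gd duhamel_good by (auto simp: bcone_def)
  have nz: "Z (fst z + snd z) (fst z - snd z) \<noteq> 0" if "z \<in> bcone x0 t0 1" for z
    using pos[of "fst z" "snd z"] that by simp
  have cV: "continuous_on (bcone x0 t0 1) (\<lambda>z. Vp (fst z + snd z) (fst z - snd z))"
    "continuous_on (bcone x0 t0 1) (\<lambda>z. Vq (fst z + snd z) (fst z - snd z))"
    using nz by (intro cont_VE_comp continuous_intros; blast)+
  have c0: "cont_L2_cone x0 t0 v"
  proof (rule cont_L2_cone_continuous)
    have "continuous_on (bcone x0 t0 1) (\<lambda>z. f (fst z + snd z) + h (fst z - snd z) - 2 * ln (Z (fst z + snd z) (fst z - snd z)))"
      using nz by (intro continuous_intros) auto
    then show "continuous_on (bcone x0 t0 1) (\<lambda>(x, t). v x t)" by (simp add: v_def split_beta)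
  qed
  note tr1 = cont_L2_cone_translate[OF g1, of x0 t0 1] and tr2 = cont_L2_cone_translate[OF g2, of x0 t0 "-1"]
  have tr2': "cont_L2_cone x0 t0 (\<lambda>x t. - g2 (x + - 1 * t))"
    using cont_L2_cone_translate[of "\<lambda>x. - g2 x" M x0 t0 "-1"] g2 by simp
  have cx: "cont_L2_cone x0 t0 vx"
  proof -
    have "cont_L2_cone x0 t0 (\<lambda>x t. Vp (x + t) (x - t) + Vq (x + t) (x - t))"
      using continuous_on_add[OF cV] by (intro cont_L2_cone_continuous) (simp add: split_beta)
    from cont_L2_cone_add[OF cont_L2_cone_add[OF tr1 tr2] this] show ?thesis by (simp add: vx_def[abs_def])
  qed
  have ct: "cont_L2_cone x0 t0 vt"
  proof -
    have "cont_L2_cone x0 t0 (\<lambda>x t. Vp (x + t) (x - t) - Vq (x + t) (x - t))"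
      using continuous_on_diff[OF cV] by (intro cont_L2_cone_continuous) (simp add: split_beta)
    from cont_L2_cone_add[OF cont_L2_cone_add[OF tr1 tr2'] this] show ?thesis by (simp add: vt_def[abs_def])
  qed
  have "has_weak_deriv (ball x0 (t0 - t)) (\<lambda>x. v x t) (\<lambda>x. vx x t)"
    "has_time_deriv (ball x0 (t0 - t)) {0..<t0} v t (\<lambda>x. vt x t)" if "t \<in> {0..<t0}" for t
  proof -
    have J: "ball x0 (t0 - t) = {x0 - (t0 - t)<..<x0 + (t0 - t)}" by (rule ball_eq_greaterThanLessThan)
    have J': "open_ivl (ball x0 (t0 - t))" unfolding J using that by (intro open_ivl_simps) simp
    have p: "0 < Z (x + t) (x - t)" if "x \<in> ball x0 (t0 - t)" for x
      using that \<open>t \<in> {0..<t0}\<close> by (intro pos) (auto simp: bcone_def dist_real_def)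
    show "has_weak_deriv (ball x0 (t0 - t)) (\<lambda>x. v x t) (\<lambda>x. vx x t)"
      by (rule has_weak_deriv_v[OF J' p])
    show "has_time_deriv (ball x0 (t0 - t)) {0..<t0} v t (\<lambda>x. vt x t)"
      by (rule has_time_deriv_v[OF J' p])
  qed
  then have "energy_regular x0 t0 v"
    unfolding energy_regular_def using c0 cx ct by (intro exI[of _ vx] exI[of _ vt]) blast
  then show ?thesis using du by (simp add: solution_on_cone_def)
qed

text \<open>A solution by any function forces \<open>Z > 0\<close>. Conversely, the triangle can be
  enlarged a little, and there the explicit function is a solution.\<close>

lemma max_domain_eq: "max_domain u0 u1 = {(x, t). 0 \<le> t \<and> good x t}"
proof (intro set_eqI iffI)
  fix z assume "z \<in> max_domain u0 u1"
  then obtain x t t' w where z: "z = (x, t)" "0 \<le> t" "t < t'" "solution_on_cone u0 u1 w x t'"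
    by (auto simp: max_domain_def)
  have "duhamel u0 u1 w y s" if "(y, s) \<in> tri x t" for y s
  proof -
    have "(y, s) \<in> bcone x t' 1" using z that by (auto simp: tri_def bcone_def)
    then show ?thesis using z(4) by (auto simp: solution_on_cone_def)
  qed
  note du = this
  show "z \<in> {(x, t). 0 \<le> t \<and> good x t}" using z(1,2) duhamel_imp_good[OF du z(2)] by simp
next
  fix z assume "z \<in> {(x, t). 0 \<le> t \<and> good x t}"
  then obtain x t where z: "z = (x, t)" "0 \<le> t" "good x t" by auto
  obtain t' where t': "t' > t" "good x t'" using good_extend[OF z(3)] by blast
  have "solution_on_cone u0 u1 v x t'"
    using t' z by (intro solution_v) (auto simp: good_iff_tri bcone_def tri_def)
  then show "z \<in> max_domain u0 u1" using z t' by (auto simp: max_domain_def)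
qed

lemma maximal_solution_eq_v:
  assumes u: "maximal_solution u0 u1 u" and d: "(x, t) \<in> max_domain u0 u1"
  shows "u x t = v x t"
proof -
  obtain t' w where t: "0 \<le> t" "t < t'" "solution_on_cone u0 u1 w x t'"
    using d by (auto simp: max_domain_def)
  have "0 < t'" using t by linarith
  then have u': "solution_on_cone u0 u1 u x t'" using u t(3) unfolding maximal_solution_def by blast
  have "duhamel u0 u1 u y s" if "(y, s) \<in> tri x t" for y s
  proof -
    have "(y, s) \<in> bcone x t' 1" using t that by (auto simp: tri_def bcone_def)
    then show ?thesis using u' by (auto simp: solution_on_cone_def)
  qed
  moreover have "good x t" using d by (simp add: max_domain_eq)
  ultimately show ?thesis using t(1) by (intro solution_eq_v)
qed

end

section \<open>Bounds in the backward cone\<close>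

text \<open>\<open>Y\<close> increases from 0. If it has reached \<open>c / 2\<close> at
  \<open>s\<close> it stays above, and \<open>X\<close> falls at rate at least
  \<open>m * c / 2\<close> down to its zero at \<open>L\<close>. Otherwise \<open>X s\<close> itself
  is at least \<open>c / 2\<close>, which is enough because \<open>L - s \<le> R\<close>.\<close>

lemma linear_decay:
  fixes X Y :: "real \<Rightarrow> real"
  assumes X: "\<And>s. (X has_real_derivative - g s * Y s) (at s)"
    and Y: "\<And>s. (Y has_real_derivative k s * X s) (at s)"
    and g: "\<And>s. 0 \<le> s \<Longrightarrow> s \<le> L \<Longrightarrow> m \<le> g s" and m: "0 < m"
    and k: "\<And>s. 0 \<le> s \<Longrightarrow> s \<le> L \<Longrightarrow> 0 \<le> k s" and X0: "\<And>s. 0 \<le> s \<Longrightarrow> s \<le> L \<Longrightarrow> 0 \<le> X s"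
    and Y0: "Y 0 = 0" and XL: "X L = 0"
    and c: "0 < c" "\<And>s. 0 \<le> s \<Longrightarrow> s \<le> L \<Longrightarrow> c \<le> \<bar>X s\<bar> + \<bar>Y s\<bar>"
    and R: "L \<le> R" "0 < R" and s: "0 \<le> s" "s \<le> L"
  shows "c / 2 * min m (1 / R) * (L - s) \<le> X s"
proof -
  have mono: "Y r \<le> Y r'" if "0 \<le> r" "r \<le> r'" "r' \<le> L" for r r'
  proof (rule DERIV_nonneg_imp_nondecreasing[OF that(2)])
    fix z assume "r \<le> z" "z \<le> r'"
    then have "0 \<le> k z * X z" using that k X0 by simp
    then show "\<exists>y. (Y has_real_derivative y) (at z) \<and> 0 \<le> y" using Y by blast
  qed
  have Ypos: "0 \<le> Y r" if "0 \<le> r" "r \<le> L" for r using mono[of 0 r] that Y0 by simp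
  show ?thesis
  proof (cases "c / 2 \<le> Y s")
    case True
    have "X L + m * (c / 2) * L \<le> X s + m * (c / 2) * s"
    proof (rule DERIV_nonpos_imp_nonincreasing[OF s(2), of "\<lambda>r. X r + m * (c / 2) * r"])
      fix r assume r: "s \<le> r" "r \<le> L"
      have "((\<lambda>r. X r + m * (c / 2) * r) has_real_derivative - g r * Y r + m * (c / 2)) (at r)"
        by (intro DERIV_add[OF X] DERIV_cmult_Id)
      moreover have "m * (c / 2) \<le> g r * Y r"
        using g[of r] r s m c(1) mono[of s r] True by (intro mult_mono) auto
      then have "- g r * Y r + m * (c / 2) \<le> 0" by simp
      ultimately show "\<exists>y. ((\<lambda>r. X r + m * (c / 2) * r) has_real_derivative y) (at r) \<and> y \<le> 0" by blast
    qed
    then have "m * (c / 2) * (L - s) \<le> X s" using XL by (simp add: algebra_simps)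
    moreover have "c / 2 * min m (1 / R) * (L - s) \<le> c / 2 * m * (L - s)"
      using s c(1) by (intro mult_right_mono mult_left_mono) auto
    ultimately show ?thesis by (simp add: mult_ac)
  next
    case False
    then have "c / 2 \<le> X s" using c(2)[OF s] Ypos[OF s] X0[OF s] by simp
    moreover have "c / 2 * min m (1 / R) * (L - s) \<le> c / 2 * (1 / R) * R"
      using s c(1) R by (intro mult_mono mult_left_mono) auto
    ultimately show ?thesis using R by simp
  qed
qed

section \<open>Mean-square bounds that do not depend on the representative\<close>

lemma L2_on_AE_cong:
  assumes g: "L2_on J g" and J: "J \<in> sets lebesgue" and ae: "AE x in lebesgue. x \<in> J \<longrightarrow> g x = g' x"
  shows "L2_on J g'"
proof -
  have m: "(\<lambda>x. indicator J x *\<^sub>R g x) \<in> borel_measurable lebesgue" and i: "integrable lebesgue (\<lambda>x. indicator J x *\<^sub>R (g x)\<^sup>2)"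
    using g by (auto simp: L2_on_def set_borel_measurable_def set_integrable_def)
  have "AE x in lebesgue. indicator J x *\<^sub>R g x = indicator J x *\<^sub>R g' x"
    using ae by eventually_elim (auto simp: indicator_def)
  from borel_measurable_AE[OF m this] have m': "(\<lambda>x. indicator J x *\<^sub>R g' x) \<in> borel_measurable lebesgue" .
  have ae2: "AE x in lebesgue. indicator J x *\<^sub>R (g x)\<^sup>2 = indicator J x *\<^sub>R (g' x)\<^sup>2"
    using ae by eventually_elim (auto simp: indicator_def)
  have "integrable lebesgue (\<lambda>x. indicator J x *\<^sub>R (g' x)\<^sup>2)"
    by (rule integrable_cong_AE_imp[OF i borel_measurable_AE[OF borel_measurable_integrable[OF i] ae2] ae2])
  then show ?thesis using m' by (simp add: L2_on_def set_borel_measurable_def set_integrable_def)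
qed

lemma L2_bound_AE:
  fixes g1 g2 k1 k2 :: "real \<Rightarrow> real"
  assumes lr: "l \<le> r" and g: "g1 \<in> borel_measurable borel" "g2 \<in> borel_measurable borel"
    and K: "\<And>x. x \<in> {l<..<r} \<Longrightarrow> \<bar>g1 x\<bar> \<le> K" "\<And>x. x \<in> {l<..<r} \<Longrightarrow> \<bar>g2 x\<bar> \<le> K"
    and ae: "AE x in lebesgue. x \<in> {l<..<r} \<longrightarrow> k1 x = g1 x" "AE x in lebesgue. x \<in> {l<..<r} \<longrightarrow> k2 x = g2 x"
  shows "L2_on {l<..<r} k1" "L2_on {l<..<r} k2"
    "(LINT x:{l<..<r}|lebesgue. (k1 x)\<^sup>2 + (k2 x)\<^sup>2) \<le> 2 * K\<^sup>2 * (r - l)"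
proof -
  have ae'1: "AE x in lebesgue. x \<in> {l<..<r} \<longrightarrow> g1 x = k1 x" using ae(1) by eventually_elim simp
  have ae'2: "AE x in lebesgue. x \<in> {l<..<r} \<longrightarrow> g2 x = k2 x" using ae(2) by eventually_elim simp
  have J: "{l<..<r} \<in> sets borel" "bounded {l<..<r}" "{l<..<r} \<in> sets lebesgue" by simp_all
  show L1: "L2_on {l<..<r} k1"
    by (rule L2_on_AE_cong[OF L2_on_bounded_borel[OF g(1) J(1,2) K(1)] J(3) ae'1])
  show L2: "L2_on {l<..<r} k2"
    by (rule L2_on_AE_cong[OF L2_on_bounded_borel[OF g(2) J(1,2) K(2)] J(3) ae'2])
  have "set_integrable lebesgue {l<..<r} (\<lambda>x. (k1 x)\<^sup>2 + (k2 x)\<^sup>2)"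
    using L1 L2 by (intro set_integral_add(1)) (auto simp: L2_on_def)
  moreover have c: "set_integrable lebesgue {l<..<r} (\<lambda>x. 2 * K\<^sup>2)"
    by (rule set_integrable_bounded_borel(2)[where B = "2 * K\<^sup>2"]) auto
  ultimately have "(LINT x:{l<..<r}|lebesgue. (k1 x)\<^sup>2 + (k2 x)\<^sup>2) \<le> (LINT x:{l<..<r}|lebesgue. 2 * K\<^sup>2)"
  proof (rule set_integral_mono_AE)
    show "AE x\<in>{l<..<r} in lebesgue. (k1 x)\<^sup>2 + (k2 x)\<^sup>2 \<le> 2 * K\<^sup>2"
      using ae
    proof eventually_elim
      case (elim x)
      show ?case
      proof
        assume x: "x \<in> {l<..<r}"
        have "(g1 x)\<^sup>2 \<le> K\<^sup>2" "(g2 x)\<^sup>2 \<le> K\<^sup>2"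
          using power_mono[OF K(1)[OF x], of 2] power_mono[OF K(2)[OF x], of 2] by auto
        then show "(k1 x)\<^sup>2 + (k2 x)\<^sup>2 \<le> 2 * K\<^sup>2" using elim x by simp
      qed
    qed
  qed
  also have "\<dots> = 2 * K\<^sup>2 * (r - l)"
    using lr by (simp add: set_lebesgue_integral_def)
  finally show "(LINT x:{l<..<r}|lebesgue. (k1 x)\<^sup>2 + (k2 x)\<^sup>2) \<le> 2 * K\<^sup>2 * (r - l)" .
qed

lemma has_weak_deriv_cong:
  assumes "\<And>x. x \<in> J \<Longrightarrow> f x = g x" and f: "has_weak_deriv J f f'"
  shows "has_weak_deriv J g f'"
proof -
  have 1: "set_integrable lebesgue K f = set_integrable lebesgue K g" if "K \<subseteq> J" for K
    using that assms(1) by (intro set_integrable_cong) auto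
  have 2: "(LINT x:J|lebesgue. f x * k x) = (LINT x:J|lebesgue. g x * k x)" for k
    unfolding set_lebesgue_integral_def
    using assms(1) by (intro Bochner_Integration.integral_cong) (auto simp: indicator_def)
  show ?thesis using f 1 2 by (auto simp: has_weak_deriv_def loc_integrable_on_def)
qed

context liouville_wave begin

section \<open>Constants from bounds of the data on \<open>[-R, R]\<close>\<close>

lemma bounds_exist:
  "\<exists>B\<ge>1. \<forall>x. \<bar>x\<bar> \<le> R \<longrightarrow> \<bar>f x\<bar> \<le> B \<and> \<bar>h x\<bar> \<le> B \<and> \<bar>a1 x\<bar> \<le> B \<and> \<bar>a2 x\<bar> \<le> B \<and> \<bar>c1 x\<bar> \<le> B \<and> \<bar>c2 x\<bar> \<le> B"
proof -
  have "\<exists>B. \<forall>x. \<bar>x\<bar> \<le> R \<longrightarrow> \<bar>k x\<bar> \<le> B" if k: "continuous_on UNIV k" for k :: "real \<Rightarrow> real"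
  proof -
    have "bounded (k ` {-R..R})"
      by (intro compact_imp_bounded compact_continuous_image continuous_on_subset[OF k]) auto
    then obtain B where "\<forall>y\<in>k ` {-R..R}. norm y \<le> B" unfolding bounded_iff by blast
    then show ?thesis by (intro exI[of _ B]) (auto simp: abs_le_iff)
  qed
  note ex = this
  obtain B1 where B1: "\<forall>x. \<bar>x\<bar> \<le> R \<longrightarrow> \<bar>f x\<bar> \<le> B1" using ex[OF cont_f] by blast
  obtain B2 where B2: "\<forall>x. \<bar>x\<bar> \<le> R \<longrightarrow> \<bar>h x\<bar> \<le> B2" using ex[OF cont_h] by blast
  obtain B3 where B3: "\<forall>x. \<bar>x\<bar> \<le> R \<longrightarrow> \<bar>a1 x\<bar> \<le> B3" using ex[OF cont_acc(1)] by blast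
  obtain B4 where B4: "\<forall>x. \<bar>x\<bar> \<le> R \<longrightarrow> \<bar>a2 x\<bar> \<le> B4" using ex[OF cont_acc(2)] by blast
  obtain B5 where B5: "\<forall>x. \<bar>x\<bar> \<le> R \<longrightarrow> \<bar>c1 x\<bar> \<le> B5" using ex[OF cont_acc(3)] by blast
  obtain B6 where B6: "\<forall>x. \<bar>x\<bar> \<le> R \<longrightarrow> \<bar>c2 x\<bar> \<le> B6" using ex[OF cont_acc(4)] by blast
  define B where "B = Max {1, B1, B2, B3, B4, B5, B6}"
  have "1 \<le> B" "B1 \<le> B" "B2 \<le> B" "B3 \<le> B" "B4 \<le> B" "B5 \<le> B" "B6 \<le> B"
    unfolding B_def by (rule Max_ge, simp, simp)+
  then show ?thesis using B1 B2 B3 B4 B5 B6 by (intro exI[of _ B]) (meson order_trans)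
qed

text \<open>Cramer's rule for a basis of determinant 1: \<open>Z\<close> and \<open>- Yp\<close> are
  the coordinates of the vector \<open>C\<close> at \<open>q\<close> in the basis of
  \<open>C\<close> and \<open>A\<close> at \<open>p\<close>, and \<open>Z\<close> and
  \<open>- Yq\<close> those of \<open>A\<close> at \<open>p\<close> in the basis of \<open>A\<close>
  and \<open>C\<close> at \<open>q\<close>.\<close>

lemma basis_expansion:
  "c1 q = Z p q * c1 p - Yp p q * a1 p" "c2 q = Z p q * c2 p - Yp p q * a2 p"
  "a1 p = Z p q * a1 q - Yq p q * c1 q" "a2 p = Z p q * a2 q - Yq p q * c2 q"
proof -
  have "Z p q * c1 p - Yp p q * a1 p = c1 q * (c1 p * a2 p - c2 p * a1 p)"
    "Z p q * c2 p - Yp p q * a2 p = c2 q * (c1 p * a2 p - c2 p * a1 p)"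
    "Z p q * a1 q - Yq p q * c1 q = a1 p * (c1 q * a2 q - c2 q * a1 q)"
    "Z p q * a2 q - Yq p q * c2 q = a2 p * (c1 q * a2 q - c2 q * a1 q)"
    unfolding Z_def Yp_def Yq_def by algebra+
  then show "c1 q = Z p q * c1 p - Yp p q * a1 p" "c2 q = Z p q * c2 p - Yp p q * a2 p"
    "a1 p = Z p q * a1 q - Yq p q * c1 q" "a2 p = Z p q * a2 q - Yq p q * c2 q"
    by (simp_all add: wronskian)
qed

context
  fixes R B :: real
  assumes B1: "1 \<le> B" and R0: "0 < R"
    and B: "\<And>x. \<bar>x\<bar> \<le> R \<Longrightarrow> \<bar>f x\<bar> \<le> B \<and> \<bar>h x\<bar> \<le> B \<and> \<bar>a1 x\<bar> \<le> B \<and> \<bar>a2 x\<bar> \<le> B \<and> \<bar>c1 x\<bar> \<le> B \<and> \<bar>c2 x\<bar> \<le> B"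
begin

text \<open>If both coordinates were small, so would be the vector, contradicting the determinant 1
  that it forms with a vector of entries at most \<open>B\<close>.\<close>

lemma nondegenerate:
  assumes "\<bar>p\<bar> \<le> R" "\<bar>q\<bar> \<le> R"
  shows "1 / (4 * B\<^sup>2) \<le> \<bar>Z p q\<bar> + \<bar>Yp p q\<bar>" "1 / (4 * B\<^sup>2) \<le> \<bar>Z p q\<bar> + \<bar>Yq p q\<bar>"
proof -
  have lin: "\<bar>x * y - z * w\<bar> \<le> (\<bar>x\<bar> + \<bar>z\<bar>) * B" if "\<bar>y\<bar> \<le> B" "\<bar>w\<bar> \<le> B" for x y z w :: real
  proof -
    have "\<bar>x * y - z * w\<bar> \<le> \<bar>x\<bar> * \<bar>y\<bar> + \<bar>z\<bar> * \<bar>w\<bar>"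
      using abs_triangle_ineq4[of "x * y" "z * w"] by (simp add: abs_mult)
    also have "\<dots> \<le> \<bar>x\<bar> * B + \<bar>z\<bar> * B" using that by (intro add_mono mult_left_mono) auto
    finally show ?thesis by (simp add: algebra_simps)
  qed
  \<comment> \<open>The determinant gives \<open>1 \<le> 2 * S * B\<^sup>2\<close>; the constant
    claimed leaves a factor 2 to spare.\<close>
  have one: "1 / (4 * B\<^sup>2) \<le> S" if "\<bar>x\<bar> \<le> S * B" "\<bar>z\<bar> \<le> S * B" "\<bar>y\<bar> \<le> B" "\<bar>w\<bar> \<le> B" "x * y - z * w = 1" for x y z w S :: real
  proof -
    have "1 \<le> (\<bar>x\<bar> + \<bar>z\<bar>) * B" using lin[OF that(3,4), of x z] that(5) by simp
    also have "\<dots> \<le> (S * B + S * B) * B" using that B1 by (intro mult_right_mono add_mono) auto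
    finally have *: "1 \<le> 2 * S * B\<^sup>2" by (simp add: power2_eq_square algebra_simps)
    then have "0 < S * B\<^sup>2" by simp
    then have "1 \<le> S * (4 * B\<^sup>2)" using * by simp
    then show ?thesis using B1 by (simp add: pos_divide_le_eq)
  qed
  show "1 / (4 * B\<^sup>2) \<le> \<bar>Z p q\<bar> + \<bar>Yp p q\<bar>"
  proof (rule one[of "c1 q" _ "c2 q" "a2 q" "a1 q"])
    show "\<bar>c1 q\<bar> \<le> (\<bar>Z p q\<bar> + \<bar>Yp p q\<bar>) * B" "\<bar>c2 q\<bar> \<le> (\<bar>Z p q\<bar> + \<bar>Yp p q\<bar>) * B"
      using lin[of "c1 p" "a1 p" "Z p q" "Yp p q"] lin[of "c2 p" "a2 p" "Z p q" "Yp p q"] B[OF assms(1)]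
        basis_expansion(1,2)[of q p] by auto
  qed (use B[OF assms(2)] wronskian in auto)
  show "1 / (4 * B\<^sup>2) \<le> \<bar>Z p q\<bar> + \<bar>Yq p q\<bar>"
  proof (rule one[of "a2 p" _ "a1 p" "c1 p" "c2 p"])
    show "\<bar>a2 p\<bar> \<le> (\<bar>Z p q\<bar> + \<bar>Yq p q\<bar>) * B" "\<bar>a1 p\<bar> \<le> (\<bar>Z p q\<bar> + \<bar>Yq p q\<bar>) * B"
      using lin[of "a2 q" "c2 q" "Z p q" "Yq p q"] lin[of "a1 q" "c1 q" "Z p q" "Yq p q"] B[OF assms(2)]
        basis_expansion(3,4)[of p q] by auto
  qed (use B[OF assms(1)] wronskian[of p] in \<open>auto simp: mult.commute\<close>)
qed

lemma coeff_bounds: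
  assumes "\<bar>p\<bar> \<le> R"
  shows "kap * exp (- B) \<le> kap * exp (f p)" "kap * exp (- B) \<le> kap * exp (h p)"
    "kap * exp (f p) \<le> exp B" "kap * exp (h p) \<le> exp B"
proof -
  have k: "0 < kap" "kap \<le> 1" by (simp_all add: kap_def)
  have b: "- B \<le> f p" "f p \<le> B" "- B \<le> h p" "h p \<le> B" using B[OF assms] by (auto simp: abs_le_iff)
  show "kap * exp (- B) \<le> kap * exp (f p)" "kap * exp (- B) \<le> kap * exp (h p)" using k b by auto
  show "kap * exp (f p) \<le> exp B" "kap * exp (h p) \<le> exp B"
    using mult_mono[of kap 1 "exp (f p)" "exp B"] mult_mono[of kap 1 "exp (h p)" "exp B"] k b by auto
qed

lemma Y_bounds:
  assumes "\<bar>p\<bar> \<le> R" "\<bar>q\<bar> \<le> R"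
  shows "\<bar>Yp p q\<bar> \<le> 2 * B\<^sup>2" "\<bar>Yq p q\<bar> \<le> 2 * B\<^sup>2"
proof -
  have *: "\<bar>x * y - z * w\<bar> \<le> 2 * B\<^sup>2" if "\<bar>x\<bar> \<le> B" "\<bar>y\<bar> \<le> B" "\<bar>z\<bar> \<le> B" "\<bar>w\<bar> \<le> B" for x y z w :: real
  proof -
    have "\<bar>x * y - z * w\<bar> \<le> \<bar>x\<bar> * \<bar>y\<bar> + \<bar>z\<bar> * \<bar>w\<bar>"
      using abs_triangle_ineq4[of "x * y" "z * w"] by (simp add: abs_mult)
    also have "\<dots> \<le> B * B + B * B" using that B1 by (intro add_mono mult_mono) auto
    finally show ?thesis by (simp add: power2_eq_square)
  qed
  show "\<bar>Yp p q\<bar> \<le> 2 * B\<^sup>2" "\<bar>Yq p q\<bar> \<le> 2 * B\<^sup>2"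
    unfolding Yp_def Yq_def using B[OF assms(1)] B[OF assms(2)] by (auto intro!: *)
qed

text \<open>\<open>lowc\<close> is the constant of \<open>linear_decay\<close> for
  \<open>c = 1 / (4 * B\<^sup>2)\<close> from nondegeneracy, \<open>m = kap * exp (- B)\<close> and
  edges of length at most \<open>2 * R\<close>. \<open>uppc\<close> bounds both first derivatives of
  \<open>Z\<close>: \<open>exp B\<close> for the coefficient, \<open>2 * B\<^sup>2\<close> for the
  determinant.\<close>

definition lowc :: real where "lowc = 1 / (4 * B\<^sup>2) / 2 * min (kap * exp (- B)) (1 / (2 * R))"
definition uppc :: real where "uppc = exp B * (2 * B\<^sup>2)"

lemma consts_pos: "0 < lowc" "0 < uppc"
  using B1 R0 kap_pos by (auto simp: lowc_def uppc_def)

text \<open>By monotonicity \<open>Z p q\<close> dominates its values at \<open>(p, q0)\<close> and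
  \<open>(p0, q)\<close> on the two edges through the apex, hence their average, and each of these
  decays linearly. The upper bound is the mean value inequality along the path from
  \<open>(p, q)\<close> through \<open>(p0, q)\<close> to \<open>(p0, q0)\<close>.\<close>

lemma Z_two_sided:
  assumes q0: "- R \<le> q0" and p0: "p0 \<le> R"
    and pos: "\<And>p q. q0 \<le> q \<Longrightarrow> q \<le> p \<Longrightarrow> p \<le> p0 \<Longrightarrow> (p, q) \<noteq> (p0, q0) \<Longrightarrow> 0 < Z p q"
    and zero: "Z p0 q0 = 0" and pq: "q0 \<le> q" "q \<le> p" "p \<le> p0"
  shows "lowc / 2 * ((p0 - p) + (q - q0)) \<le> Z p q" "Z p q \<le> uppc * ((p0 - p) + (q - q0))"
proof -
  have in_R: "\<bar>x\<bar> \<le> R" if "q0 \<le> x" "x \<le> p0" for x using that q0 p0 by (intro abs_leI) auto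
  have ge: "- B \<le> f x" "- B \<le> h x" if "q0 \<le> x" "x \<le> p0" for x
    using B[OF in_R[OF that]] by (auto simp: abs_le_iff)
  have nonneg: "0 \<le> Z p q" if "q0 \<le> q" "q \<le> p" "p \<le> p0" for p q
    using pos[OF that] zero by (cases "(p, q) = (p0, q0)") auto
  have qp: "q0 \<le> p0" using pq by simp
  have low_p: "lowc * (p0 - p) \<le> Z p q0" if p: "q0 \<le> p" "p \<le> p0" for p
  proof -
    have "1 / (4 * B\<^sup>2) / 2 * min (kap * exp (- B)) (1 / (2 * R)) * ((p0 - q0) - (p - q0)) \<le> Z (q0 + (p - q0)) q0"
    proof (rule linear_decay[where X = "\<lambda>s. Z (q0 + s) q0" and Y = "\<lambda>s. Yp (q0 + s) q0"
          and g = "\<lambda>s. kap * exp (f (q0 + s))" and k = "\<lambda>s. kap * exp (h (q0 + s))" and R = "2 * R"])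
      have id: "((\<lambda>s. q0 + s) has_real_derivative 1) (at s)" for s by (auto intro!: derivative_eq_intros)
      show "((\<lambda>s. Z (q0 + s) q0) has_real_derivative - (kap * exp (f (q0 + s))) * Yp (q0 + s) q0) (at s)" for s
        using DERIV_chain2[of "\<lambda>p. Z p q0" _ "\<lambda>s. q0 + s", OF deriv_Z_p id] by simp
      show "((\<lambda>s. Yp (q0 + s) q0) has_real_derivative kap * exp (h (q0 + s)) * Z (q0 + s) q0) (at s)" for s
        using DERIV_chain2[of "\<lambda>p. Yp p q0" _ "\<lambda>s. q0 + s", OF deriv_Yp_p id] by simp
      show "Z (q0 + (p0 - q0)) q0 = 0" using zero by simp
    qed (use p qp q0 p0 kap_pos B1 R0 in \<open>auto simp: diag intro!: ge nondegenerate in_R nonneg\<close>)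
    then show ?thesis by (simp add: lowc_def)
  qed
  \<comment> \<open>On this edge the parameter runs backwards from the diagonal point
    \<open>q = p0\<close>, where \<open>Yq\<close> vanishes; \<open>f\<close> and \<open>h\<close>
    exchange their roles.\<close>
  have low_q: "lowc * (q - q0) \<le> Z p0 q" if q: "q0 \<le> q" "q \<le> p0" for q
  proof -
    have "1 / (4 * B\<^sup>2) / 2 * min (kap * exp (- B)) (1 / (2 * R)) * ((p0 - q0) - (p0 - q)) \<le> Z p0 (p0 - (p0 - q))"
    proof (rule linear_decay[where X = "\<lambda>s. Z p0 (p0 - s)" and Y = "\<lambda>s. Yq p0 (p0 - s)"
          and g = "\<lambda>s. kap * exp (h (p0 - s))" and k = "\<lambda>s. kap * exp (f (p0 - s))" and R = "2 * R"])
      have id: "((\<lambda>s. p0 - s) has_real_derivative - 1) (at s)" for s by (auto intro!: derivative_eq_intros)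
      show "((\<lambda>s. Z p0 (p0 - s)) has_real_derivative - (kap * exp (h (p0 - s))) * Yq p0 (p0 - s)) (at s)" for s
        using DERIV_chain2[of "\<lambda>q. Z p0 q" _ "\<lambda>s. p0 - s", OF deriv_Z_q id] by simp
      show "((\<lambda>s. Yq p0 (p0 - s)) has_real_derivative kap * exp (f (p0 - s)) * Z p0 (p0 - s)) (at s)" for s
        using DERIV_chain2[of "\<lambda>q. Yq p0 q" _ "\<lambda>s. p0 - s", OF deriv_Yq_q id] by simp
      show "Z p0 (p0 - (p0 - q0)) = 0" using zero by simp
    qed (use q qp q0 p0 kap_pos B1 R0 in \<open>auto simp: diag intro!: ge nondegenerate in_R nonneg\<close>)
    then show ?thesis by (simp add: lowc_def)
  qed
  \<comment> \<open>\<open>Yp\<close> starts from 0 on the diagonal and its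
    \<open>p\<close>-derivative has the sign of \<open>Z\<close>.\<close>
  have Yp0: "0 \<le> Yp r s" if rs: "q0 \<le> s" "s \<le> r" "r \<le> p0" for r s
  proof -
    have "Yp s s \<le> Yp r s"
    proof (rule DERIV_nonneg_imp_nondecreasing[OF rs(2)])
      fix z assume "s \<le> z" "z \<le> r"
      then have "0 \<le> kap * exp (h z) * Z z s" using nonneg[of s z] rs kap_pos by simp
      then show "\<exists>y. ((\<lambda>r. Yp r s) has_real_derivative y) (at z) \<and> 0 \<le> y" using deriv_Yp_p by blast
    qed
    then show ?thesis by (simp add: diag)
  qed
  have Yq0: "0 \<le> Yq r s" if rs: "q0 \<le> s" "s \<le> r" "r \<le> p0" for r s
  proof -
    have "Yq r r \<le> Yq r s"
    proof (rule DERIV_nonpos_imp_nonincreasing[OF rs(2)])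
      fix z assume "s \<le> z" "z \<le> r"
      then have "- kap * exp (f z) * Z r z \<le> 0" using nonneg[of z r] rs kap_pos by simp
      then show "\<exists>y. ((\<lambda>s. Yq r s) has_real_derivative y) (at z) \<and> y \<le> 0" using deriv_Yq_q by blast
    qed
    then show ?thesis by (simp add: diag)
  qed
  have "Z p q0 \<le> Z p q"
  proof (rule DERIV_nonneg_imp_nondecreasing[OF pq(1)])
    fix z assume "q0 \<le> z" "z \<le> q"
    then have "0 \<le> kap * exp (h z) * Yq p z" using Yq0[of z p] pq kap_pos by simp
    then show "\<exists>y. ((\<lambda>q. Z p q) has_real_derivative y) (at z) \<and> 0 \<le> y" using deriv_Z_q by blast
  qed
  moreover have "Z p0 q \<le> Z p q"
  proof (rule DERIV_nonpos_imp_nonincreasing[OF pq(3)])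
    fix z assume "p \<le> z" "z \<le> p0"
    then have "- kap * exp (f z) * Yp z q \<le> 0" using Yp0[of q z] pq kap_pos by simp
    then show "\<exists>y. ((\<lambda>p. Z p q) has_real_derivative y) (at z) \<and> y \<le> 0" using deriv_Z_p by blast
  qed
  ultimately have "lowc * (p0 - p) \<le> Z p q" "lowc * (q - q0) \<le> Z p q" using low_p[of p] low_q[of q] pq by auto
  then show "lowc / 2 * ((p0 - p) + (q - q0)) \<le> Z p q" by (simp add: algebra_simps)
  have bnd: "\<bar>- kap * exp (f r) * Yp r s\<bar> \<le> uppc" "\<bar>kap * exp (h s) * Yq r s\<bar> \<le> uppc"
    if "q0 \<le> s" "s \<le> p0" "q0 \<le> r" "r \<le> p0" for r s
    unfolding abs_mult uppc_def
    using coeff_bounds(3)[OF in_R[OF that(3,4)]] coeff_bounds(4)[OF in_R[OF that(1,2)]]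
      Y_bounds[OF in_R[OF that(3,4)] in_R[OF that(1,2)]] kap_pos
    by (auto simp: abs_mult intro!: mult_mono)
  have "norm (Z p q - Z p0 q) \<le> uppc * norm (p - p0)"
    by (rule field_differentiable_bound[of "{q0..p0}" "\<lambda>p. Z p q", OF _ deriv_Z_p]) (use pq bnd in auto)
  moreover have "norm (Z p0 q - Z p0 q0) \<le> uppc * norm (q - q0)"
    by (rule field_differentiable_bound[of "{q0..p0}" "\<lambda>q. Z p0 q", OF _ deriv_Z_q]) (use pq bnd in auto)
  ultimately show "Z p q \<le> uppc * ((p0 - p) + (q - q0))" using zero pq by (simp add: algebra_simps)
qed

text \<open>In \<open>rate_bound\<close>, \<open>2 * B\<close> accounts for \<open>f\<close> and
  \<open>h\<close>, the logarithms for \<open>Z / (T - t)\<close>, which enters squared. In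
  \<open>slope_bound\<close>, the bounds of \<open>g1\<close> and \<open>g2\<close> are multiplied
  by \<open>R\<close> because \<open>T - t \<le> R\<close>, and \<open>Vp\<close> and
  \<open>Vq\<close> contribute \<open>2 * uppc / lowc\<close> each.\<close>

definition rate_bound :: real where
  "rate_bound = 2 * B + 2 * (\<bar>ln lowc\<bar> + \<bar>ln (2 * uppc)\<bar>)"
definition slope_bound :: real where
  "slope_bound = 2 * \<bar>M\<bar> * R + 4 * uppc / lowc"

lemma estimates:
  assumes a: "\<bar>a\<bar> < R - T" and T: "0 < T"
    and pos: "\<And>y s. (y, s) \<in> tri a T \<Longrightarrow> (y, s) \<noteq> (a, T) \<Longrightarrow> 0 < Z (y + s) (y - s)"
    and zero: "Z (a + T) (a - T) = 0" and t: "0 \<le> t" "t < T" and x: "\<bar>x - a\<bar> < T - t"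
  shows "\<bar>v x t + 2 * ln (T - t)\<bar> \<le> rate_bound"
    "\<bar>vx x t\<bar> \<le> slope_bound / (T - t)" "\<bar>vt x t\<bar> \<le> slope_bound / (T - t)"
proof -
  define p q where "p = x + t" and "q = x - t"
  have ab: "- R \<le> a - T" "a + T \<le> R" using a by (auto simp: abs_if split: if_splits)
  have pq: "a - T \<le> q" "q \<le> p" "p \<le> a + T" using x t by (auto simp: p_def q_def abs_if split: if_splits)
  have pos': "0 < Z p q" if "a - T \<le> q" "q \<le> p" "p \<le> a + T" "(p, q) \<noteq> (a + T, a - T)" for p q
  proof -
    have "\<bar>(p + q) / 2 - a\<bar> \<le> T - (p - q) / 2" using that
      by (intro abs_leI) (auto simp: add_divide_distrib diff_divide_distrib)
    then have "((p + q) / 2, (p - q) / 2) \<in> tri a T" using that by (simp add: tri_def)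
    moreover have e: "(p + q) / 2 + (p - q) / 2 = p" "(p + q) / 2 - (p - q) / 2 = q" by (auto simp: field_simps)
    moreover have "((p + q) / 2, (p - q) / 2) \<noteq> (a, T)" using that(4) e by auto
    ultimately show ?thesis using pos[of "(p + q) / 2" "(p - q) / 2"] by simp
  qed
  \<comment> \<open>The distance to the apex, added up along the two characteristic directions, does
    not depend on \<open>x\<close>: this makes the estimates uniform over the section.\<close>
  have sum: "(a + T - p) + (q - (a - T)) = 2 * (T - t)" by (simp add: p_def q_def)
  have e: "lowc / 2 * (2 * (T - t)) = lowc * (T - t)" "uppc * (2 * (T - t)) = 2 * uppc * (T - t)"
    by (simp_all add: algebra_simps)
  have Zl: "lowc * (T - t) \<le> Z p q" using Z_two_sided(1)[OF ab pos' zero pq] unfolding sum e .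
  have Zu: "Z p q \<le> 2 * uppc * (T - t)" using Z_two_sided(2)[OF ab pos' zero pq] unfolding sum e .
  have lp: "0 < lowc * (T - t)" using consts_pos t by simp
  then have Zp: "0 < Z p q" using Zl by linarith
  have R: "\<bar>p\<bar> \<le> R" "\<bar>q\<bar> \<le> R" using pq ab by (auto intro!: abs_leI)
  have "ln (lowc * (T - t)) \<le> ln (Z p q)" "ln (Z p q) \<le> ln (2 * uppc * (T - t))"
    using Zl Zu Zp lp by (auto intro: ln_mono)
  moreover have "ln (lowc * (T - t)) = ln lowc + ln (T - t)" "ln (2 * uppc * (T - t)) = ln (2 * uppc) + ln (T - t)"
    using consts_pos t by (auto simp: ln_mult)
  ultimately have L: "ln lowc \<le> ln (Z p q) - ln (T - t)" "ln (Z p q) - ln (T - t) \<le> ln (2 * uppc)" by auto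
  have "\<bar>ln (Z p q) - ln (T - t)\<bar> \<le> \<bar>ln lowc\<bar> + \<bar>ln (2 * uppc)\<bar>"
    using L by (intro abs_leI) (auto simp: abs_if)
  moreover have "\<bar>f p\<bar> \<le> B" "\<bar>h q\<bar> \<le> B" using B R by auto
  moreover have "v x t + 2 * ln (T - t) = f p + h q - 2 * (ln (Z p q) - ln (T - t))" by (simp add: v_def p_def q_def)
  ultimately show "\<bar>v x t + 2 * ln (T - t)\<bar> \<le> rate_bound"
    unfolding rate_bound_def by (auto simp: abs_le_iff)
  have V: "\<bar>Vp p q\<bar> \<le> 2 * uppc / (lowc * (T - t))" "\<bar>Vq p q\<bar> \<le> 2 * uppc / (lowc * (T - t))"
  proof -
    have n: "\<bar>2 * kap * exp (f p) * Yp p q\<bar> \<le> 2 * uppc" "\<bar>- 2 * kap * exp (h q) * Yq p q\<bar> \<le> 2 * uppc"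
      using mult_mono[OF coeff_bounds(3)[OF R(1)] Y_bounds(1)[OF R]] mult_mono[OF coeff_bounds(4)[OF R(2)] Y_bounds(2)[OF R]] kap_pos
      by (auto simp: abs_mult uppc_def mult.assoc)
    show "\<bar>Vp p q\<bar> \<le> 2 * uppc / (lowc * (T - t))" "\<bar>Vq p q\<bar> \<le> 2 * uppc / (lowc * (T - t))"
      unfolding Vp_def Vq_def abs_divide using n Zl Zp lp consts_pos by (auto intro!: frac_le)
  qed
  have "2 * \<bar>M\<bar> \<le> 2 * \<bar>M\<bar> * R / (T - t)"
  proof -
    have "T - t \<le> R" using a t by linarith
    then have "2 * \<bar>M\<bar> * (T - t) \<le> 2 * \<bar>M\<bar> * R" by (intro mult_left_mono) auto
    then show ?thesis using t by (simp add: pos_le_divide_eq)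
  qed
  moreover have "\<bar>g1 p\<bar> \<le> \<bar>M\<bar>" "\<bar>g2 q\<bar> \<le> \<bar>M\<bar>" using g1(2)[of p] g2(2)[of q] by auto
  moreover have "slope_bound / (T - t) = 2 * \<bar>M\<bar> * R / (T - t) + 2 * (2 * uppc / (lowc * (T - t)))"
    by (simp add: slope_bound_def add_divide_distrib)
  ultimately show "\<bar>vx x t\<bar> \<le> slope_bound / (T - t)" "\<bar>vt x t\<bar> \<le> slope_bound / (T - t)"
    using V unfolding vx_def vt_def p_def[symmetric] q_def[symmetric] by (auto simp: abs_le_iff)
qed

lemma bounds_nonneg: "0 \<le> rate_bound" "0 \<le> slope_bound"
  using B1 R0 consts_pos by (auto simp: rate_bound_def slope_bound_def)

end

end

section \<open>Reduction of the initial data\<close>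

text \<open>Truncating a Borel version at the essential bound makes the bound hold
  everywhere.\<close>

lemma Linf_borel_representative:
  assumes "Linf k"
  obtains g M where "g \<in> borel_measurable borel" "\<And>x. \<bar>g x\<bar> \<le> M" "AE x in lebesgue. k x = g x"
proof -
  obtain M0 where k: "k \<in> borel_measurable lebesgue" and M0: "AE x in lebesgue. \<bar>k x\<bar> \<le> M0"
    using assms by (auto simp: Linf_def)
  obtain g0 where g0: "g0 \<in> borel_measurable lborel" "AE x in lborel. k x = g0 x"
    using completion_ex_borel_measurable_real[OF k] by blast
  define g where "g x = max (- \<bar>M0\<bar>) (min \<bar>M0\<bar> (g0 x))" for x
  show ?thesis
  proof (rule that[of g "\<bar>M0\<bar>"])
    show "g \<in> borel_measurable borel" using g0(1) unfolding g_def by auto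
    show "\<bar>g x\<bar> \<le> \<bar>M0\<bar>" for x by (auto simp: g_def)
    show "AE x in lebesgue. k x = g x"
      using AE_completion[OF g0(2)] M0 by eventually_elim (auto simp: g_def abs_le_iff max_def min_def)
  qed
qed

lemma set_lint_AE_cong:
  fixes k g :: "real \<Rightarrow> real"
  assumes k: "set_integrable lebesgue S k" and ae: "AE x in lebesgue. k x = g x"
  shows "set_integrable lebesgue S g" "(LINT x:S|lebesgue. k x) = (LINT x:S|lebesgue. g x)"
proof -
  have i: "integrable lebesgue (\<lambda>x. indicator S x *\<^sub>R k x)" using k by (simp add: set_integrable_def)
  have ae': "AE x in lebesgue. indicator S x *\<^sub>R k x = indicator S x *\<^sub>R g x" using ae by eventually_elim simp
  note m = borel_measurable_AE[OF borel_measurable_integrable[OF i] ae']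
  show "set_integrable lebesgue S g"
    unfolding set_integrable_def by (rule integrable_cong_AE_imp[OF i m ae'])
  show "(LINT x:S|lebesgue. k x) = (LINT x:S|lebesgue. g x)"
    unfolding set_lebesgue_integral_def by (rule integral_cong_AE[OF borel_measurable_integrable[OF i] m ae'])
qed

lemma has_weak_deriv_AE_cong:
  assumes f: "has_weak_deriv UNIV f k" and ae: "AE x in lebesgue. k x = g x"
  shows "has_weak_deriv UNIV f g"
proof -
  have k: "loc_integrable_on UNIV k" using f by (simp add: has_weak_deriv_def)
  have "(LINT x:UNIV|lebesgue. k x * \<phi> x) = (LINT x:UNIV|lebesgue. g x * \<phi> x)" if "test_function UNIV \<phi>" for \<phi>
    by (rule set_lint_AE_cong(2)[OF test_set_integrable(1)[OF _ k that]]) (use ae in \<open>auto elim!: eventually_mono\<close>)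
  moreover have "loc_integrable_on UNIV g"
    using k set_lint_AE_cong(1)[OF _ ae] by (auto simp: loc_integrable_on_def)
  ultimately show ?thesis using f by (auto simp: has_weak_deriv_def)
qed

text \<open>The weak derivative is identified by Fubini, without differentiating the primitive at
  any point.\<close>

lemma bounded_borel_primitive:
  fixes g :: "real \<Rightarrow> real"
  assumes g: "g \<in> borel_measurable borel" and M: "\<And>x. \<bar>g x\<bar> \<le> M"
  obtains P where "\<And>a b. a \<le> b \<Longrightarrow> P b - P a = integral {a..b} g" "continuous_on UNIV P" "has_weak_deriv UNIV P g"
proof -
  have si: "set_integrable lborel {a..b} g" "set_integrable lebesgue {a..b} g" for a b
    using g M by (auto intro!: set_integrable_bounded_borel[where B = M])
  have hk: "g integrable_on {a..b}" for a b by (rule set_lebesgue_integral_eq_integral(1)[OF si(2)])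
  define P where "P x = (if 0 \<le> x then integral {0..x} g else - integral {x..0} g)" for x
  have P: "P b - P a = integral {a..b} g" if ab: "a \<le> b" for a b
  proof -
    have comb: "integral {x..y} g + integral {y..z} g = integral {x..z} g" if "x \<le> y" "y \<le> z" for x y z
      by (rule Henstock_Kurzweil_Integration.integral_combine[OF that hk])
    consider "0 \<le> a" | "a < 0" "0 \<le> b" | "b < 0" by linarith
    then show ?thesis
    proof cases
      case 1 then show ?thesis using comb[of 0 a b] ab by (simp add: P_def)
    next
      case 2 then show ?thesis using comb[of a 0 b] by (simp add: P_def)
    next
      case 3 then show ?thesis using comb[of a b 0] ab by (simp add: P_def)
    qed
  qed
  have lip: "\<bar>P b - P a\<bar> \<le> M * \<bar>b - a\<bar>" for a b
  proof -
    have *: "\<bar>P b - P a\<bar> \<le> M * (b - a)" if "a \<le> b" for a b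
      using set_lint_bound[OF si(2)[of a b] has_integral_const_real[of M a b]] M that P[OF that]
        set_lebesgue_integral_eq_integral(2)[OF si(2)[of a b]] by (simp add: mult.commute)
    show ?thesis using *[of a b] *[of b a] by (cases "a \<le> b") (auto simp: abs_minus_commute)
  qed
  have cP: "continuous_on UNIV P"
    by (rule lipschitz_on_continuous_on[of M]) (use lip order_trans[OF abs_ge_zero M] in \<open>auto intro!: lipschitz_onI simp: dist_real_def\<close>)
  have wd: "has_weak_deriv UNIV P g"
    unfolding has_weak_deriv_def
  proof (intro conjI allI impI)
    show "loc_integrable_on UNIV P" by (rule loc_integrable_on_continuous[OF cP])
    show lg: "loc_integrable_on UNIV g" using loc_integrable_on_bounded_borel[OF g M, of "\<lambda>_. 1"] by simp
    fix \<phi> assume \<phi>: "test_function UNIV \<phi>"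
    obtain c d D where *: "c < d" "{c..d} \<subseteq> UNIV"
      "\<And>x. (\<phi> has_real_derivative D x) (at x)" "continuous_on UNIV D"
      "\<And>x. x \<notin> {c<..<d} \<Longrightarrow> \<phi> x = 0" "\<And>x. x \<notin> {c<..<d} \<Longrightarrow> D x = 0" "deriv \<phi> = D"
      by (rule test_function_ivlE[OF \<phi> open_ivl_simps(1)]) blast
    have mD: "D \<in> borel_measurable borel" by (rule borel_measurable_continuous_onI[OF *(4)])
    have "bounded (D ` {c..d})" by (intro compact_imp_bounded compact_continuous_image continuous_on_subset[OF *(4)]) auto
    then obtain N where "\<forall>y\<in>D ` {c..d}. norm y \<le> N" unfolding bounded_iff by blast
    then have N: "\<And>x. x \<in> {c..d} \<Longrightarrow> \<bar>D x\<bar> \<le> N" by simp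
    have N0: "0 \<le> N" using order_trans[OF abs_ge_zero N[of c]] *(1) by simp
    \<comment> \<open>Both sides of the integration by parts are iterated integrals of
      \<open>D x * g y\<close> over the triangle \<open>c \<le> y \<le> x \<le> d\<close>: over
      \<open>y\<close> first it gives \<open>P x - P c\<close>, over \<open>x\<close> first
      \<open>- \<phi> y\<close>.\<close>
    define S where "S = {z. c \<le> snd z \<and> snd z \<le> fst z \<and> fst z \<le> d}"
    define F where "F x y = indicator S (x, y) *\<^sub>R (D x * g y)" for x y
    have "S \<subseteq> cbox (c, c) (d, d)" by (auto simp: S_def)
    then have "bounded S" by (rule bounded_subset[OF bounded_cbox])
    have Sm: "S \<in> sets borel" unfolding S_def by (intro borel_closed closed_Collect_conj closed_Collect_le continuous_intros)
    have "integrable lborel (\<lambda>z. indicator S z *\<^sub>R (D (fst z) * g (snd z)))"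
    proof (rule integrableI_bounded_set_indicator[where B = "N * M"])
      show "emeasure lborel S < \<infinity>" using emeasure_bounded_finite[OF \<open>bounded S\<close>] by simp
      have "(\<lambda>z. D (fst z) * g (snd z)) \<in> borel_measurable (borel \<Otimes>\<^sub>M borel)"
        using mD g by measurable
      then show "(\<lambda>z. D (fst z) * g (snd z)) \<in> borel_measurable lborel" by (simp add: borel_prod)
      show "AE z in lborel. z \<in> S \<longrightarrow> norm (D (fst z) * g (snd z)) \<le> N * M"
        using N M N0 by (intro AE_I2) (auto simp: S_def abs_mult intro!: mult_mono)
    qed (use Sm in simp)
    then have int: "integrable (lborel \<Otimes>\<^sub>M lborel) (case_prod F)"
      by (simp add: lborel_prod F_def[abs_def] case_prod_beta')
    have fub: "(\<integral>y. (\<integral>x. F x y \<partial>lborel) \<partial>lborel) = (\<integral>x. (\<integral>y. F x y \<partial>lborel) \<partial>lborel)"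
      by (rule lborel_pair.Fubini_integral[OF int])
    have in1: "(\<integral>y. F x y \<partial>lborel) = indicator {c..d} x *\<^sub>R ((P x - P c) * D x)" for x
    proof (cases "x \<in> {c..d}")
      case True
      have "(\<integral>y. F x y \<partial>lborel) = (\<integral>y. D x * (indicator {c..x} y *\<^sub>R g y) \<partial>lborel)"
        using True by (intro Bochner_Integration.integral_cong) (auto simp: F_def S_def indicator_def)
      also have "\<dots> = D x * (LINT y:{c..x}|lborel. g y)" by (simp add: set_lebesgue_integral_def)
      also have "(LINT y:{c..x}|lborel. g y) = P x - P c"
        using set_borel_integral_eq_integral(2)[OF si(1), of c x] P[of c x] True by simp
      finally show ?thesis using True by simp
    next
      case False
      then have "F x y = 0" for y by (auto simp: F_def S_def indicator_def)
      then show ?thesis using False by simp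
    qed
    have in2: "(\<integral>x. F x y \<partial>lborel) = indicator {c..d} y *\<^sub>R (- (g y * \<phi> y))" for y
    proof (cases "y \<in> {c..d}")
      case True
      have "(\<integral>x. F x y \<partial>lborel) = (\<integral>x. g y * (indicator {y..d} x *\<^sub>R D x) \<partial>lborel)"
        using True by (intro Bochner_Integration.integral_cong) (auto simp: F_def S_def indicator_def)
      also have "\<dots> = g y * (\<integral>x. indicator {y..d} x *\<^sub>R D x \<partial>lborel)" by simp
      also have "(\<integral>x. indicator {y..d} x *\<^sub>R D x \<partial>lborel) = \<phi> d - \<phi> y"
        using True *(3,4) by (intro integral_FTC_atLeastAtMost)
          (auto simp: has_real_derivative_iff_has_vector_derivative[symmetric] intro: has_field_derivative_at_within continuous_on_subset)
      finally show ?thesis using True *(5)[of d] by simp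
    next
      case False
      then have "F x y = 0" for x by (auto simp: F_def S_def indicator_def)
      then show ?thesis using False by simp
    qed
    have cont: "continuous_on {c..d} (\<lambda>x. (P x - P c) * D x)" "continuous_on {c..d} (\<lambda>x. P c * D x)"
      by (intro continuous_intros continuous_on_subset[OF cP] continuous_on_subset[OF *(4)]; simp)+
    have leb: "(LINT x:{c..d}|lebesgue. k x) = (\<integral>x. indicator {c..d} x *\<^sub>R k x \<partial>lborel)"
      if "k \<in> borel_measurable borel" for k :: "real \<Rightarrow> real"
      unfolding set_lebesgue_integral_def using that by (intro integral_completion) auto
    have mP: "P \<in> borel_measurable borel" "\<phi> \<in> borel_measurable borel"
      using cP *(3) by (auto intro!: borel_measurable_continuous_onI continuous_at_imp_continuous_on DERIV_isCont)
    have "(LINT x:UNIV|lebesgue. P x * deriv \<phi> x) = (LINT x:{c..d}|lebesgue. P x * D x)"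
      using *(6) unfolding *(7) by (intro set_lint_support(1)) auto
    also have "\<dots> = (LINT x:{c..d}|lebesgue. (P x - P c) * D x + P c * D x)" by (simp add: algebra_simps)
    also have "\<dots> = (LINT x:{c..d}|lebesgue. (P x - P c) * D x) + (LINT x:{c..d}|lebesgue. P c * D x)"
      by (intro set_integral_add(2) set_integrable_lebesgue_continuous cont)
    also have "(LINT x:{c..d}|lebesgue. P c * D x) = P c * (\<integral>x. indicator {c..d} x *\<^sub>R D x \<partial>lborel)"
      using leb[of D] mD by simp
    also have "(\<integral>x. indicator {c..d} x *\<^sub>R D x \<partial>lborel) = \<phi> d - \<phi> c"
      using *(1,3,4) by (intro integral_FTC_atLeastAtMost)
        (auto simp: has_real_derivative_iff_has_vector_derivative[symmetric] intro: has_field_derivative_at_within continuous_on_subset)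
    also have "(LINT x:{c..d}|lebesgue. (P x - P c) * D x) = (\<integral>x. (\<integral>y. F x y \<partial>lborel) \<partial>lborel)"
      unfolding in1 using mP mD by (intro leb) auto
    also have "\<dots> = (\<integral>y. indicator {c..d} y *\<^sub>R (- (g y * \<phi> y)) \<partial>lborel)" by (simp only: fub[symmetric] in2)
    also have "\<dots> = (LINT x:{c..d}|lebesgue. - (g x * \<phi> x))" using mP g by (intro leb[symmetric]) auto
    also have "\<dots> = - (LINT x:{c..d}|lebesgue. g x * \<phi> x)"
      by (simp add: set_lebesgue_integral_def)
    also have "(LINT x:{c..d}|lebesgue. g x * \<phi> x) = (LINT x:UNIV|lebesgue. g x * \<phi> x)"
      using *(5) by (intro set_lint_support(1)[symmetric]) auto
    finally show "(LINT x:UNIV|lebesgue. P x * deriv \<phi> x) = - (LINT x:UNIV|lebesgue. g x * \<phi> x)"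
      using *(5)[of c] *(5)[of d] by simp
  qed
  show ?thesis using that[OF P cP wd] .
qed

lemma liouville_wave_exists:
  assumes u0: "W1inf u0" and u1: "Linf u1"
  shows "\<exists>f h a1 a2 c1 c2 g1 g2 M. liouville_wave f h a1 a2 c1 c2 g1 g2 u0 u1 M"
proof -
  obtain k where c0: "continuous_on UNIV u0" and k: "Linf k" "has_weak_deriv UNIV u0 k"
    using u0 by (auto simp: W1inf_def)
  obtain k' Mk where k': "k' \<in> borel_measurable borel" "\<And>x. \<bar>k' x\<bar> \<le> Mk" "AE x in lebesgue. k x = k' x"
    by (rule Linf_borel_representative[OF k(1)]) blast
  obtain g M where g: "g \<in> borel_measurable borel" "\<And>x. \<bar>g x\<bar> \<le> M" "AE x in lebesgue. u1 x = g x"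
    by (rule Linf_borel_representative[OF u1]) blast
  obtain P where P: "\<And>a b. a \<le> b \<Longrightarrow> P b - P a = integral {a..b} g" "continuous_on UNIV P" "has_weak_deriv UNIV P g"
    by (rule bounded_borel_primitive[OF g(1,2)]) blast
  have wu: "has_weak_deriv UNIV u0 k'" by (rule has_weak_deriv_AE_cong[OF k(2) k'(3)])
  \<comment> \<open>D'Alembert's splitting of the free wave, \<open>P\<close> being a primitive of
    \<open>u1\<close>.\<close>
  define f where "f x = 1/2 * u0 x + 1/2 * P x" for x
  define h where "h x = 1/2 * u0 x + (- 1/2) * P x" for x
  have cfh: "continuous_on UNIV f" "continuous_on UNIV h"
    unfolding f_def h_def by (intro continuous_intros c0 P(2))+
  obtain a1 a2 c1 c2 where L: "liouville f h a1 a2 c1 c2" using liouville_exists[OF cfh] by blast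
  have "liouville_wave f h a1 a2 c1 c2 (\<lambda>x. 1/2 * k' x + 1/2 * g x) (\<lambda>x. 1/2 * k' x + (- 1/2) * g x) u0 u1 (1/2 * Mk + 1/2 * M)"
  proof (intro liouville_wave.intro L liouville_wave_axioms.intro)
    show "has_weak_deriv UNIV f (\<lambda>x. 1/2 * k' x + 1/2 * g x)"
      unfolding f_def by (intro has_weak_deriv_add has_weak_deriv_cmult wu P(3)) simp
    show "has_weak_deriv UNIV h (\<lambda>x. 1/2 * k' x + (- 1/2) * g x)"
      unfolding h_def by (intro has_weak_deriv_add has_weak_deriv_cmult wu P(3)) simp
    show "(\<lambda>x. 1/2 * k' x + 1/2 * g x) \<in> borel_measurable borel" "(\<lambda>x. 1/2 * k' x + (- 1/2) * g x) \<in> borel_measurable borel"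
      using k'(1) g(1) by auto
    show "\<bar>1/2 * k' x + 1/2 * g x\<bar> \<le> 1/2 * Mk + 1/2 * M" "\<bar>1/2 * k' x + (- 1/2) * g x\<bar> \<le> 1/2 * Mk + 1/2 * M" for x
      using k'(2)[of x] g(2)[of x] by (auto simp: abs_le_iff)
    show "free_wave u0 u1 x t = f (x + t) + h (x - t)" if t: "0 \<le> t" for x t
    proof -
      have sg: "set_integrable lebesgue {x - t..x + t} g"
        using g by (intro set_integrable_bounded_borel(2)[where B = M]) auto
      have ae: "AE x in lebesgue. g x = u1 x" using g(3) by eventually_elim simp
      have "(LINT z:{x - t..x + t}|lebesgue. u1 z) = (LINT z:{x - t..x + t}|lebesgue. g z)"
        using set_lint_AE_cong(2)[OF sg ae] by simp
      also have "\<dots> = P (x + t) - P (x - t)"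
        using set_lebesgue_integral_eq_integral(2)[OF sg] P(1)[of "x - t" "x + t"] t by simp
      finally show ?thesis by (simp add: free_wave_def f_def h_def algebra_simps)
    qed
  qed
  then show ?thesis by blast
qed

section \<open>The blow-up rate\<close>

context liouville_wave begin

text \<open>If \<open>Z\<close> were positive at \<open>(a, T)\<close>, the whole closed triangle
  would be good and could be enlarged beyond the supremum; by continuity from below \<open>Z\<close>
  cannot be negative there either.\<close>

lemma blowup_apex:
  fixes a :: real
  defines "T \<equiv> blowup_time u0 u1 a"
  assumes blowup: "max_domain u0 u1 \<noteq> UNIV \<times> {0..}" and a: "a \<in> noncharacteristic u0 u1"
    and T0: "0 \<le> T"
  shows "0 < T" "tri a T - {(a, T)} \<subseteq> max_domain u0 u1" "Z (a + T) (a - T) = 0"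
proof -
  have set_eq: "{t. (a, t) \<in> max_domain u0 u1} = {t. 0 \<le> t \<and> good a t}" by (auto simp: max_domain_eq)
  let ?E = "{t. 0 \<le> t \<and> good a t}"
  have T: "T = Sup ?E" by (simp add: T_def blowup_time_def set_eq)
  obtain x0 t0 where bad: "0 \<le> t0" "\<not> good x0 t0" using blowup by (auto simp: max_domain_eq)
  \<comment> \<open>A later good time above \<open>a\<close> would have the bad point
    \<open>(x0, t0)\<close> in its triangle.\<close>
  have "t < \<bar>a - x0\<bar> + t0" if t: "t \<in> ?E" for t
  proof (rule ccontr)
    assume "\<not> t < \<bar>a - x0\<bar> + t0"
    then have "(x0, t0) \<in> tri a t" using bad(1) by (simp add: tri_def abs_minus_commute)
    then show False using good_mono t bad(2) by blast
  qed
  then have bdd: "bdd_above ?E" by (intro bdd_aboveI[of _ "\<bar>a - x0\<bar> + t0"]) force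
  have "good a 0"
  proof -
    have "Z p q > 0" if "a - 0 \<le> q" "q \<le> p" "p \<le> a + 0" for p q
    proof -
      have "p = a" "q = a" using that by auto
      then show ?thesis by (simp add: diag)
    qed
    then show ?thesis unfolding good_def by blast
  qed
  then obtain e where e: "e > 0" "good a e" using good_extend by blast
  then have "e \<le> T" unfolding T by (intro cSup_upper bdd) simp
  then show Tpos: "0 < T" using e by simp
  obtain d where d: "0 < d" "d < 1" "bcone a T d \<subseteq> max_domain u0 u1"
    using a by (auto simp: noncharacteristic_def T_def)
  \<comment> \<open>Here the non-characteristic assumption enters: a slope \<open>d < 1\<close>
    opens the cone wide enough to contain the closed triangle of slope 1 up to its apex.\<close>
  have "tri a T - {(a, T)} \<subseteq> bcone a T d"
  proof
    fix z assume z: "z \<in> tri a T - {(a, T)}"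
    then obtain y s where ys: "z = (y, s)" "0 \<le> s" "\<bar>y - a\<bar> \<le> T - s" "(y, s) \<noteq> (a, T)" by (auto simp: tri_def)
    have "d * \<bar>y - a\<bar> \<le> 1 * \<bar>y - a\<bar>" using d by (intro mult_right_mono) auto
    then show "z \<in> bcone a T d" using ys by (auto simp: bcone_def)
  qed
  then show sub: "tri a T - {(a, T)} \<subseteq> max_domain u0 u1" using d(3) by blast
  have pos: "0 < Z (y + s) (y - s)" if "(y, s) \<in> tri a T" "(y, s) \<noteq> (a, T)" for y s
  proof -
    have "(y, s) \<in> max_domain u0 u1" using that sub by blast
    then have "good y s" "0 \<le> s" by (auto simp: max_domain_eq)
    then show ?thesis by (auto simp: good_def)
  qed
  have "\<not> 0 < Z (a + T) (a - T)"
  proof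
    assume "0 < Z (a + T) (a - T)"
    then have "good a T" unfolding good_iff_tri using pos by auto
    then obtain t' where t': "t' > T" "good a t'" using good_extend by blast
    then have "t' \<le> T" using T0 unfolding T by (intro cSup_upper bdd) (simp add: T[symmetric])
    then show False using t'(1) by simp
  qed
  moreover have "0 \<le> Z (a + T) (a - T)"
  proof -
    have "continuous_on UNIV (\<lambda>\<tau>. Z (a + \<tau>) (a - \<tau>))" by (intro continuous_intros)
    then have "isCont (\<lambda>\<tau>. Z (a + \<tau>) (a - \<tau>)) T" by (simp add: continuous_on_eq_continuous_at)
    then have "((\<lambda>\<tau>. Z (a + \<tau>) (a - \<tau>)) \<longlongrightarrow> Z (a + T) (a - T)) (at T within {0..<T})"
      unfolding isCont_def by (rule tendsto_within_subset) simp
    moreover have "\<forall>\<^sub>F \<tau> in at T within {0..<T}. 0 \<le> Z (a + \<tau>) (a - \<tau>)"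
    proof -
      have "0 \<le> Z (a + \<tau>) (a - \<tau>)" if "\<tau> \<in> {0..<T}" for \<tau>
        using pos[of a \<tau>] that by (auto simp: tri_def)
      then show ?thesis by (auto simp: eventually_at_filter)
    qed
    moreover have "at T within {0..<T} \<noteq> bot"
      using Tpos by (subst at_within_eq_bot_iff) (auto simp: closure_atLeastLessThan)
    ultimately show ?thesis by (intro tendsto_lowerbound)
  qed
  ultimately show "Z (a + T) (a - T) = 0" by simp
qed

section \<open>Derivatives in similarity variables\<close>

lemma borel_measurable_vx_vt:
  "(\<lambda>x. vx x t) \<in> borel_measurable borel" "(\<lambda>x. vt x t) \<in> borel_measurable borel"
proof -
  note [measurable] = g1(1) g2(1) borel_measurable_continuous_onI[OF cont_f] borel_measurable_continuous_onI[OF cont_h]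
    borel_measurable_continuous_onI[OF cont_acc(1)] borel_measurable_continuous_onI[OF cont_acc(2)]
    borel_measurable_continuous_onI[OF cont_acc(3)] borel_measurable_continuous_onI[OF cont_acc(4)]
  show "(\<lambda>x. vx x t) \<in> borel_measurable borel" "(\<lambda>x. vt x t) \<in> borel_measurable borel"
    unfolding vx_def vt_def Vp_def Vq_def Z_def Yp_def Yq_def by measurable
qed

lemma has_weak_deriv_similarity:
  assumes J: "open_ivl J" and m: "0 < m"
    and pos: "\<And>y. y \<in> J \<Longrightarrow> 0 < Z ((a + y * m) + (T - m)) ((a + y * m) - (T - m))"
  shows "has_weak_deriv J (\<lambda>y. v (a + y * m) (T - m) + c) (\<lambda>y. m * vx (a + y * m) (T - m))"
proof -
  define p q where "p = (\<lambda>y. (a + y * m) + (T - m))" and "q = (\<lambda>y. (a + y * m) - (T - m))"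
  have pq: "p y = (a + T - m) + m * y" "q y = (a - T + m) + m * y" for y by (simp_all add: p_def q_def algebra_simps)
  have 1: "has_weak_deriv J (\<lambda>y. f (p y)) (\<lambda>y. m * g1 (p y))"
    unfolding pq by (rule has_weak_deriv_affine[OF J cont_f weak_f g1 m])
  have 2: "has_weak_deriv J (\<lambda>y. h (q y)) (\<lambda>y. m * g2 (q y))"
    unfolding pq by (rule has_weak_deriv_affine[OF J cont_h weak_h g2 m])
  have pos': "0 < Z (p y) (q y)" if "y \<in> J" for y using pos[OF that] by (simp add: p_def q_def)
  have 3: "has_weak_deriv J (\<lambda>y. - 2 * ln (Z (p y) (q y)) + c) (\<lambda>y. Vp (p y) (q y) * m + Vq (p y) (q y) * m)"
  proof (rule has_weak_deriv_C1[OF J])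
    fix y assume y: "y \<in> J"
    have "(p has_real_derivative m) (at y)" "(q has_real_derivative m) (at y)"
      unfolding p_def q_def by (auto intro!: derivative_eq_intros)
    from DERIV_add[OF deriv_lnZ_comp[OF this pos'[OF y]] DERIV_const]
    show "((\<lambda>y. - 2 * ln (Z (p y) (q y)) + c) has_real_derivative Vp (p y) (q y) * m + Vq (p y) (q y) * m) (at y)" by simp
  next
    have "Z (p y) (q y) \<noteq> 0" if "y \<in> J" for y using pos'[OF that] by simp
    then show "continuous_on J (\<lambda>y. Vp (p y) (q y) * m + Vq (p y) (q y) * m)"
      unfolding p_def q_def by (intro continuous_on_add continuous_on_mult continuous_on_const cont_VE_comp continuous_intros)
  qed
  have "has_weak_deriv J (\<lambda>y. f (p y) + h (q y) + (- 2 * ln (Z (p y) (q y)) + c))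
      (\<lambda>y. m * g1 (p y) + m * g2 (q y) + (Vp (p y) (q y) * m + Vq (p y) (q y) * m))"
    by (rule has_weak_deriv_add[OF J has_weak_deriv_add[OF J 1 2] 3])
  then show ?thesis by (simp add: v_def vx_def p_def q_def algebra_simps)
qed

text \<open>The chain rule for \<open>x = a + y * exp (- s)\<close> and
  \<open>t = T - exp (- s)\<close>; the \<open>- 2\<close> is the derivative of
  \<open>2 * ln (exp (- s))\<close>. Both characteristic coordinates are affine in \<open>y\<close>
  with coefficients depending on \<open>s\<close>, as \<open>has_time_deriv_affine\<close>
  requires.\<close>

lemma has_time_deriv_similarity:
  fixes a T s :: real
  defines "m \<equiv> exp (- s)"
  assumes J: "open_ivl J"
    and pos: "\<And>y. y \<in> J \<Longrightarrow> 0 < Z ((a + y * m) + (T - m)) ((a + y * m) - (T - m))"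
  shows "has_time_deriv J A (\<lambda>y s. v (a + y * exp (- s)) (T - exp (- s)) + 2 * ln (exp (- s))) s
    (\<lambda>y. m * (vt (a + y * m) (T - m) - y * vx (a + y * m) (T - m)) - 2)"
proof -
  define p q where "p = (\<lambda>s y. (a + y * exp (- s)) + (T - exp (- s)))" and "q = (\<lambda>s y. (a + y * exp (- s)) - (T - exp (- s)))"
  have pq: "p s y = (a + T - exp (- s)) + exp (- s) * y" "q s y = (a - T + exp (- s)) + exp (- s) * y" for s y
    by (simp_all add: p_def q_def algebra_simps)
  have de: "((\<lambda>s. exp (- s)) has_real_derivative - exp (- s)) (at s)" for s :: real
    by (auto intro!: derivative_eq_intros)
  have ce: "continuous_on UNIV (\<lambda>s::real. - exp (- s))" "continuous_on UNIV (\<lambda>s::real. exp (- s))"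
    by (intro continuous_intros)+
  have db: "((\<lambda>s. a + T - exp (- s)) has_real_derivative exp (- s)) (at s)" "((\<lambda>s. a - T + exp (- s)) has_real_derivative - exp (- s)) (at s)" for s
    by (auto intro!: derivative_eq_intros)
  have 1: "has_time_deriv J A (\<lambda>y s. f (p s y)) s (\<lambda>y. g1 (p s y) * (exp (- s) + - exp (- s) * y))"
    unfolding pq by (rule has_time_deriv_affine[OF J cont_f weak_f g1 db(1) ce(2) de ce(1)]) simp
  have 2: "has_time_deriv J A (\<lambda>y s. h (q s y)) s (\<lambda>y. g2 (q s y) * (- exp (- s) + - exp (- s) * y))"
    unfolding pq by (rule has_time_deriv_affine[OF J cont_h weak_h g2 db(2) ce(1) de ce(1)]) simp
  have 3: "has_time_deriv J A (\<lambda>y s. - 2 * ln (Z (p s y) (q s y))) s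
      (\<lambda>y. Vp (p s y) (q s y) * (exp (- s) * (1 - y)) + Vq (p s y) (q s y) * (- exp (- s) * (1 + y)))"
  proof (rule has_time_deriv_lnZ[OF J, where P = p and Q = q and P' = "\<lambda>s y. exp (- s) * (1 - y)" and Q' = "\<lambda>s y. - exp (- s) * (1 + y)"])
    show "0 < Z (p s y) (q s y)" if "y \<in> J" for y using pos[OF that] by (simp add: p_def q_def m_def)
    show "((\<lambda>s. p s y) has_real_derivative exp (- s) * (1 - y)) (at s)" for s y
      unfolding p_def by (auto intro!: derivative_eq_intros simp: algebra_simps)
    show "((\<lambda>s. q s y) has_real_derivative - exp (- s) * (1 + y)) (at s)" for s y
      unfolding q_def by (auto intro!: derivative_eq_intros simp: algebra_simps)
  qed (auto simp: p_def q_def split_beta intro!: continuous_intros)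
  have 4: "has_time_deriv J A (\<lambda>y s. - 2 * s) s (\<lambda>y. - 2)"
    by (rule has_time_deriv_C1[OF J open_UNIV, where F' = "\<lambda>_ _. - 2"])
      (auto intro!: derivative_eq_intros continuous_intros simp: split_beta)
  have "has_time_deriv J A (\<lambda>y s. f (p s y) + h (q s y) + - 2 * ln (Z (p s y) (q s y)) + - 2 * s) s
      (\<lambda>y. g1 (p s y) * (exp (- s) + - exp (- s) * y) + g2 (q s y) * (- exp (- s) + - exp (- s) * y)
        + (Vp (p s y) (q s y) * (exp (- s) * (1 - y)) + Vq (p s y) (q s y) * (- exp (- s) * (1 + y))) + - 2)"
    by (rule has_time_deriv_add[OF J has_time_deriv_add[OF J has_time_deriv_add[OF J 1 2] 3] 4])
  moreover have "(\<lambda>y s. f (p s y) + h (q s y) + - 2 * ln (Z (p s y) (q s y)) + - 2 * s)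
      = (\<lambda>y s. v (a + y * exp (- s)) (T - exp (- s)) + 2 * ln (exp (- s)))"
    by (simp add: v_def p_def q_def fun_eq_iff)
  moreover have "(\<lambda>y. g1 (p s y) * (exp (- s) + - exp (- s) * y) + g2 (q s y) * (- exp (- s) + - exp (- s) * y)
        + (Vp (p s y) (q s y) * (exp (- s) * (1 - y)) + Vq (p s y) (q s y) * (- exp (- s) * (1 + y))) + - 2)
      = (\<lambda>y. m * (vt (a + y * m) (T - m) - y * vx (a + y * m) (T - m)) - 2)"
    by (simp add: vx_def vt_def p_def q_def m_def fun_eq_iff algebra_simps)
  ultimately show ?thesis by simp
qed

text \<open>One explicit derivative shows that the choice picks a genuine derivative, and uniqueness
  then transfers the pointwise bound to it almost everywhere.\<close>

lemma deriv_choices_bound: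
  fixes w :: "real \<Rightarrow> real \<Rightarrow> real"
  assumes J: "J = {l<..<r}" "l < r" and A: "at t within A \<noteq> bot"
    and wx: "has_weak_deriv J (\<lambda>x. w x t) g" and wt: "has_time_deriv J A w t g'"
    and g: "g \<in> borel_measurable borel" "\<And>x. x \<in> J \<Longrightarrow> \<bar>g x\<bar> \<le> K"
    and g': "g' \<in> borel_measurable borel" "\<And>x. x \<in> J \<Longrightarrow> \<bar>g' x\<bar> \<le> K"
  shows "L2_on J (space_deriv J w t)" "L2_on J (time_deriv J A w t)"
    "(LINT x:J|lebesgue. (space_deriv J w t x)\<^sup>2 + (time_deriv J A w t x)\<^sup>2) \<le> 2 * K\<^sup>2 * (r - l)"
proof -
  have J': "open_ivl J" using J by simp
  have s: "has_weak_deriv J (\<lambda>x. w x t) (space_deriv J w t)" unfolding space_deriv_def by (rule someI[of "\<lambda>g. has_weak_deriv J (\<lambda>x. w x t) g", OF wx])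
  have t: "has_time_deriv J A w t (time_deriv J A w t)" unfolding time_deriv_def by (rule someI[of "\<lambda>g. has_time_deriv J A w t g", OF wt])
  note b = L2_bound_AE[OF less_imp_le[OF J(2)] g(1) g'(1) g(2)[unfolded J(1)] g'(2)[unfolded J(1)]
    has_weak_deriv_unique[OF J' s wx, unfolded J(1)] has_time_deriv_unique[OF J' A t wt, unfolded J(1)]]
  show "L2_on J (space_deriv J w t)" "L2_on J (time_deriv J A w t)"
    "(LINT x:J|lebesgue. (space_deriv J w t x)\<^sup>2 + (time_deriv J A w t x)\<^sup>2) \<le> 2 * K\<^sup>2 * (r - l)"
    using b unfolding J(1) by auto
qed

lemma blowup_rate:
  assumes R0: "0 < R"
  shows "\<exists>C>0. \<forall>u. blowup_solution u0 u1 u \<longrightarrow>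
    (let T = blowup_time u0 u1 in
     \<forall>a\<in>noncharacteristic u0 u1. (a, T a) \<in> D_trunc R \<longrightarrow>
       (let w = similarity u T a in
        \<forall>s\<ge>- ln (T a) + 1.
          (let ws = time_deriv {-1<..<1} {- ln (T a)..} w s;
               wy = space_deriv {-1<..<1} w s in
           L2_on {-1<..<1} ws \<and> L2_on {-1<..<1} wy \<and>
           (\<forall>y. \<bar>y\<bar> < 1 \<longrightarrow>
              \<bar>w y s\<bar> + (LINT z:{-1<..<1}|lebesgue. (ws z)\<^sup>2 + (wy z)\<^sup>2) \<le> C))) \<and>
       (\<forall>t\<in>{0..<T a}.
          (let J = section_ivl T a t;
               ux = space_deriv J u t;
               ut = time_deriv J {0..<T a} u t in
           L2_on J ux \<and> L2_on J ut \<and>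
           (\<forall>x\<in>J.
              \<bar>u x t + 2 * ln (T a - t)\<bar>
                + (T a - t) * (LINT z:J|lebesgue. (ux z)\<^sup>2 + (ut z)\<^sup>2) \<le> C))) \<and>
       (\<forall>t\<in>{0..<T a}. \<forall>x\<in>section_ivl T a t.
          1 / C \<le> exp (u x t) * (T a - t)\<^sup>2 \<and> exp (u x t) * (T a - t)\<^sup>2 \<le> C))"
    (is "\<exists>C>0. \<forall>u. _ u \<longrightarrow> ?Q C u")
proof -
  obtain B where B: "1 \<le> B" "\<And>x. \<bar>x\<bar> \<le> R \<Longrightarrow> \<bar>f x\<bar> \<le> B \<and> \<bar>h x\<bar> \<le> B \<and> \<bar>a1 x\<bar> \<le> B \<and> \<bar>a2 x\<bar> \<le> B \<and> \<bar>c1 x\<bar> \<le> B \<and> \<bar>c2 x\<bar> \<le> B"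
    using bounds_exist[of R] by blast
  define C0 where "C0 = rate_bound R B"
  define S where "S = slope_bound R B"
  have nn: "0 \<le> C0" "0 \<le> S" using bounds_nonneg[OF B(1) R0 B(2)] by (simp_all add: C0_def S_def)
  \<comment> \<open>In similarity variables both derivatives are at most \<open>2 * S + 2\<close>:
    two slopes of size \<open>S\<close> and the \<open>- 2\<close> from the logarithm. Two squares
    on an interval of length 2 give the factor 4; \<open>exp C0\<close> serves the exponential
    bounds.\<close>
  define C where "C = C0 + 4 * (2 * S + 2)\<^sup>2 + exp C0"
  have C: "0 < C" "exp C0 \<le> C" "C0 + 4 * (2 * S + 2)\<^sup>2 \<le> C" using nn by (auto simp: C_def add_nonneg_pos)
  show ?thesis
  proof (intro exI[of _ C] conjI C(1) allI impI)
    fix u assume u: "blowup_solution u0 u1 u"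
    define T where "T = blowup_time u0 u1"
    have umax: "maximal_solution u0 u1 u" and blow: "max_domain u0 u1 \<noteq> UNIV \<times> {0..}"
      using u by (auto simp: blowup_solution_def)
    show "?Q C u"
      unfolding Let_def T_def[symmetric]
    proof (intro ballI impI)
      fix a assume a: "a \<in> noncharacteristic u0 u1" and D: "(a, T a) \<in> D_trunc R"
      have aT: "0 \<le> T a" "\<bar>a\<bar> < R - T a" using D by (auto simp: D_trunc_def)
      note apex = blowup_apex[OF blow a aT(1)[unfolded T_def], folded T_def]
      have Tp: "0 < T a" by (rule apex(1))
      have dom: "(x, t) \<in> max_domain u0 u1" and Zpos: "0 < Z (x + t) (x - t)"
        if "(x, t) \<in> tri a (T a)" "(x, t) \<noteq> (a, T a)" for x t
      proof -
        show d: "(x, t) \<in> max_domain u0 u1" using apex(2) that by blast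
        then have "good x t" "0 \<le> t" by (auto simp: max_domain_eq)
        then show "0 < Z (x + t) (x - t)" by (auto simp: good_def)
      qed
      have in_tri: "(x, t) \<in> tri a (T a)" "(x, t) \<noteq> (a, T a)" if "0 \<le> t" "t < T a" "\<bar>x - a\<bar> < T a - t" for x t
        using that by (auto simp: tri_def)
      have uv: "u x t = v x t" if "0 \<le> t" "t < T a" "\<bar>x - a\<bar> < T a - t" for x t
        by (rule maximal_solution_eq_v[OF umax dom[OF in_tri[OF that]]])
      have est1: "\<bar>v x t + 2 * ln (T a - t)\<bar> \<le> C0" if tx: "0 \<le> t" "t < T a" "\<bar>x - a\<bar> < T a - t" for x t
        unfolding C0_def S_def by (rule estimates(1)[OF B(1) R0 B(2) aT(2) Tp Zpos apex(3) tx])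
      have est2: "\<bar>vx x t\<bar> \<le> S / (T a - t)" if tx: "0 \<le> t" "t < T a" "\<bar>x - a\<bar> < T a - t" for x t
        unfolding C0_def S_def by (rule estimates(2)[OF B(1) R0 B(2) aT(2) Tp Zpos apex(3) tx])
      have est3: "\<bar>vt x t\<bar> \<le> S / (T a - t)" if tx: "0 \<le> t" "t < T a" "\<bar>x - a\<bar> < T a - t" for x t
        unfolding C0_def S_def by (rule estimates(3)[OF B(1) R0 B(2) aT(2) Tp Zpos apex(3) tx])

      have i: "L2_on {-1<..<1} (time_deriv {-1<..<1} {- ln (T a)..} (similarity u T a) s) \<and>
          L2_on {-1<..<1} (space_deriv {-1<..<1} (similarity u T a) s) \<and>
          (\<forall>y. \<bar>y\<bar> < 1 \<longrightarrow> \<bar>similarity u T a y s\<bar> +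
            (LINT z:{-1<..<1}|lebesgue. (time_deriv {-1<..<1} {- ln (T a)..} (similarity u T a) s z)\<^sup>2
              + (space_deriv {-1<..<1} (similarity u T a) s z)\<^sup>2) \<le> C)"
        if s: "- ln (T a) + 1 \<le> s" for s
      proof -
        let ?J = "{-1<..<1::real}" and ?A = "{- ln (T a)..}" and ?w = "similarity u T a"
        define m where "m = exp (- s)"
        have m_le: "0 < exp (- s) \<and> exp (- s) \<le> T a" if "s \<in> ?A" for s
        proof -
          have "exp (- s) \<le> exp (ln (T a))" using that by simp
          then show ?thesis using Tp by simp
        qed
        have sA: "s \<in> ?A" using s by simp
        have m: "0 < m" "m \<le> T a" using m_le[OF sA] by (simp_all add: m_def)
        have cone: "0 \<le> T a - exp (- s)" "T a - exp (- s) < T a" "\<bar>(a + y * exp (- s)) - a\<bar> < T a - (T a - exp (- s))"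
          if "s \<in> ?A" "\<bar>y\<bar> < 1" for s y
          using m_le[OF that(1)] that(2) mult_strict_right_mono[OF that(2), of "exp (- s)"] by (auto simp: abs_mult)
        have w_eq: "v (a + y * exp (- s)) (T a - exp (- s)) + 2 * ln (exp (- s)) = ?w y s"
          if "s \<in> ?A" "\<bar>y\<bar> < 1" for s y
          using uv[OF cone[OF that]] by (simp add: similarity_def)
        have pos: "0 < Z ((a + y * m) + (T a - m)) ((a + y * m) - (T a - m))" if "y \<in> ?J" for y
          using Zpos[OF in_tri[OF cone[OF sA, of y]]] that by (auto simp: m_def abs_if)
        have e1: "\<bar>v (a + y * m) (T a - m) + 2 * ln m\<bar> \<le> C0"
          and e2: "\<bar>vx (a + y * m) (T a - m)\<bar> \<le> S / m" and e3: "\<bar>vt (a + y * m) (T a - m)\<bar> \<le> S / m" if "\<bar>y\<bar> < 1" for y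
          using est1[OF cone[OF sA that]] est2[OF cone[OF sA that]] est3[OF cone[OF sA that]] by (simp_all add: m_def)
        have J: "open_ivl ?J" by simp
        have wy: "has_weak_deriv ?J (\<lambda>y. ?w y s) (\<lambda>y. m * vx (a + y * m) (T a - m))"
          by (rule has_weak_deriv_cong[OF _ has_weak_deriv_similarity[OF J m(1) pos, of "2 * ln m"]])
            (use w_eq[OF sA] in \<open>auto simp: m_def abs_less_iff\<close>)
        have ws: "has_time_deriv ?J ?A ?w s (\<lambda>y. m * (vt (a + y * m) (T a - m) - y * vx (a + y * m) (T a - m)) - 2)"
        proof (rule has_time_deriv_cong[OF J has_time_deriv_similarity[OF J, where s = s, folded m_def, OF pos]])
          fix c d assume cd: "{c..d} \<subseteq> ?J"
          have "\<forall>\<^sub>F s in at s within ?A. s \<in> ?A" by (simp add: eventually_at_filter)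
          then show "\<forall>\<^sub>F s in at s within ?A. \<forall>y\<in>{c..d}. v (a + y * exp (- s)) (T a - exp (- s)) + 2 * ln (exp (- s)) = ?w y s"
          proof eventually_elim
            case (elim s)
            show ?case
            proof
              fix y assume "y \<in> {c..d}"
              then have "\<bar>y\<bar> < 1" using subsetD[OF cd, of y] by (auto simp: abs_less_iff)
              then show "v (a + y * exp (- s)) (T a - exp (- s)) + 2 * ln (exp (- s)) = ?w y s" by (rule w_eq[OF elim])
            qed
          qed
        next
          fix y assume "y \<in> ?J"
          then show "v (a + y * exp (- s)) (T a - exp (- s)) + 2 * ln (exp (- s)) = ?w y s"
            by (intro w_eq[OF sA]) (auto simp: abs_less_iff)
        qed
        \<comment> \<open>The margin 1 in the range of \<open>s\<close> makes \<open>s\<close> an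
          interior time, so the derivative is two-sided.\<close>
        have nb: "at s within ?A \<noteq> bot"
        proof -
          have "at s within ?A = at s" using s by (intro at_within_interior) auto
          then show ?thesis by simp
        qed
        have mb: "(\<lambda>y. vx (a + y * m) (T a - m)) \<in> borel_measurable borel" "(\<lambda>y. vt (a + y * m) (T a - m)) \<in> borel_measurable borel"
          by (rule measurable_compose[OF _ borel_measurable_vx_vt(1)] measurable_compose[OF _ borel_measurable_vx_vt(2)]; simp)+
        have mx: "m * \<bar>vx (a + y * m) (T a - m)\<bar> \<le> S" "m * \<bar>vt (a + y * m) (T a - m)\<bar> \<le> S" if "\<bar>y\<bar> < 1" for y
          using e2[OF that] e3[OF that] m(1) by (auto simp: pos_le_divide_eq mult.commute)
        have bx: "\<bar>m * vx (a + y * m) (T a - m)\<bar> \<le> 2 * S + 2" if "y \<in> ?J" for y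
        proof -
          have "\<bar>y\<bar> < 1" using that by (auto simp: abs_less_iff)
          from mx(1)[OF this] show ?thesis using nn m(1) by (simp add: abs_mult)
        qed
        have bt: "\<bar>m * (vt (a + y * m) (T a - m) - y * vx (a + y * m) (T a - m)) - 2\<bar> \<le> 2 * S + 2" if "y \<in> ?J" for y
        proof -
          let ?x = "vx (a + y * m) (T a - m)" and ?t = "vt (a + y * m) (T a - m)"
          have y: "\<bar>y\<bar> < 1" using that by (auto simp: abs_less_iff)
          have "\<bar>m * (?t - y * ?x) - 2\<bar> \<le> \<bar>m * (?t - y * ?x)\<bar> + 2" using abs_triangle_ineq4[of "m * (?t - y * ?x)" 2] by simp
          also have "\<bar>m * (?t - y * ?x)\<bar> \<le> m * (\<bar>?t\<bar> + \<bar>y * ?x\<bar>)"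
            using m(1) abs_triangle_ineq4[of ?t "y * ?x"] by (simp add: abs_mult)
          also have "\<bar>y * ?x\<bar> \<le> 1 * \<bar>?x\<bar>" unfolding abs_mult using y by (intro mult_right_mono) auto
          finally have "\<bar>m * (?t - y * ?x) - 2\<bar> \<le> m * (\<bar>?t\<bar> + 1 * \<bar>?x\<bar>) + 2" using m(1) by simp
          also have "\<dots> \<le> 2 * S + 2" using mx[OF y] by (simp add: distrib_left)
          finally show ?thesis .
        qed
        have mb': "(\<lambda>y. m * vx (a + y * m) (T a - m)) \<in> borel_measurable borel"
          "(\<lambda>y. m * (vt (a + y * m) (T a - m) - y * vx (a + y * m) (T a - m)) - 2) \<in> borel_measurable borel"
          using mb by measurable
        have lr: "- 1 < (1::real)" by simp
        have "L2_on ?J (space_deriv ?J ?w s)"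
          by (rule deriv_choices_bound(1)[OF refl lr nb wy ws mb'(1) bx mb'(2) bt])
        moreover have "L2_on ?J (time_deriv ?J ?A ?w s)"
          by (rule deriv_choices_bound(2)[OF refl lr nb wy ws mb'(1) bx mb'(2) bt])
        moreover have "(LINT z:?J|lebesgue. (space_deriv ?J ?w s z)\<^sup>2 + (time_deriv ?J ?A ?w s z)\<^sup>2) \<le> 2 * (2 * S + 2)\<^sup>2 * (1 - (- 1))"
          by (rule deriv_choices_bound(3)[OF refl lr nb wy ws mb'(1) bx mb'(2) bt])
        moreover have "\<bar>?w y s\<bar> \<le> C0" if "\<bar>y\<bar> < 1" for y
          using e1[OF that] w_eq[OF sA that] by (simp add: m_def)
        ultimately show ?thesis using C(3) by (auto simp: add.commute intro!: order_trans[OF add_mono C(3)])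
      qed

      have ii: "L2_on (section_ivl T a t) (space_deriv (section_ivl T a t) u t) \<and>
          L2_on (section_ivl T a t) (time_deriv (section_ivl T a t) {0..<T a} u t) \<and>
          (\<forall>x\<in>section_ivl T a t. \<bar>u x t + 2 * ln (T a - t)\<bar> + (T a - t) *
            (LINT z:section_ivl T a t|lebesgue. (space_deriv (section_ivl T a t) u t z)\<^sup>2
              + (time_deriv (section_ivl T a t) {0..<T a} u t z)\<^sup>2) \<le> C)"
        and iii: "\<forall>x\<in>section_ivl T a t. 1 / C \<le> exp (u x t) * (T a - t)\<^sup>2 \<and> exp (u x t) * (T a - t)\<^sup>2 \<le> C"
        if t: "t \<in> {0..<T a}" for t
      proof -
        let ?J = "section_ivl T a t" and ?A = "{0..<T a}"
        have t': "0 \<le> t" "t < T a" using t by auto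
        have Jeq: "?J = {a - (T a - t)<..<a + (T a - t)}" by (simp add: section_ivl_def)
        have J: "open_ivl ?J" unfolding Jeq using t' by simp
        have inJ: "\<bar>x - a\<bar> < T a - t" if "x \<in> ?J" for x using that by (auto simp: Jeq abs_less_iff)
        have e1: "\<bar>u x t + 2 * ln (T a - t)\<bar> \<le> C0" and e2: "\<bar>vx x t\<bar> \<le> S / (T a - t)" and e3: "\<bar>vt x t\<bar> \<le> S / (T a - t)"
          if "x \<in> ?J" for x
          using est1[OF t' inJ[OF that]] est2[OF t' inJ[OF that]] est3[OF t' inJ[OF that]] uv[OF t' inJ[OF that]] by simp_all
        have pos: "0 < Z (x + t) (x - t)" if "x \<in> ?J" for x by (rule Zpos[OF in_tri[OF t' inJ[OF that]]])
        have ux: "has_weak_deriv ?J (\<lambda>x. u x t) (\<lambda>x. vx x t)"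
          by (rule has_weak_deriv_cong[OF _ has_weak_deriv_v[OF J pos]]) (use uv[OF t' inJ] in auto)
        have ut: "has_time_deriv ?J ?A u t (\<lambda>x. vt x t)"
        proof (rule has_time_deriv_cong[OF J has_time_deriv_v[OF J pos]])
          show "v x t = u x t" if "x \<in> ?J" for x using uv[OF t' inJ[OF that]] by simp
          fix c d assume cd: "{c..d} \<subseteq> ?J"
          show "\<forall>\<^sub>F s in at t within ?A. \<forall>x\<in>{c..d}. v x s = u x s"
          proof (cases "c \<le> d")
            case False then show ?thesis by simp
          next
            case True
            then have "c \<in> ?J" "d \<in> ?J" using cd by auto
            then have ends: "\<bar>c - a\<bar> < T a - t" "\<bar>d - a\<bar> < T a - t" using inJ by auto
            \<comment> \<open>For times closer to \<open>t\<close> than \<open>e\<close>, the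
              compact interval \<open>{c..d}\<close> still lies inside the section of the
              cone.\<close>
            define e where "e = min (T a - t - \<bar>c - a\<bar>) (T a - t - \<bar>d - a\<bar>)"
            have e: "e > 0" using ends by (simp add: e_def)
            have "\<forall>\<^sub>F s in at t within ?A. s \<in> ?A \<and> dist s t < e"
              unfolding eventually_at using e by blast
            then show ?thesis
            proof eventually_elim
              case (elim s)
              show ?case
              proof
                fix x assume x: "x \<in> {c..d}"
                have "\<bar>x - a\<bar> \<le> max \<bar>c - a\<bar> \<bar>d - a\<bar>" using x by (auto simp: abs_if max_def)
                moreover have "\<bar>s - t\<bar> < e" using elim by (simp add: dist_real_def)
                ultimately have "\<bar>x - a\<bar> < T a - s" unfolding e_def by (auto simp: abs_less_iff max_def split: if_splits)
                then show "v x s = u x s" using elim by (intro uv[symmetric]) auto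
              qed
            qed
          qed
        qed
        \<comment> \<open>At \<open>t = 0\<close> the time derivative is one-sided, so
          \<open>t\<close> is approached through later times.\<close>
        have nb: "at t within ?A \<noteq> bot"
        proof -
          have "t \<in> closure {t<..<T a}" using t' by (simp add: closure_greaterThanLessThan)
          also have "\<dots> \<subseteq> closure (?A - {t})" using t' by (intro closure_mono) auto
          finally show ?thesis by (simp add: at_within_eq_bot_iff)
        qed
        let ?K = "S / (T a - t)"
        let ?I = "LINT z:?J|lebesgue. (space_deriv ?J u t z)\<^sup>2 + (time_deriv ?J ?A u t z)\<^sup>2"
        have lr: "a - (T a - t) < a + (T a - t)" using t' by simp
        have ch1: "L2_on ?J (space_deriv ?J u t)"
          by (rule deriv_choices_bound(1)[OF Jeq lr nb ux ut borel_measurable_vx_vt(1) e2 borel_measurable_vx_vt(2) e3])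
        have ch2: "L2_on ?J (time_deriv ?J ?A u t)"
          by (rule deriv_choices_bound(2)[OF Jeq lr nb ux ut borel_measurable_vx_vt(1) e2 borel_measurable_vx_vt(2) e3])
        have ch3: "?I \<le> 2 * ?K\<^sup>2 * ((a + (T a - t)) - (a - (T a - t)))"
          by (rule deriv_choices_bound(3)[OF Jeq lr nb ux ut borel_measurable_vx_vt(1) e2 borel_measurable_vx_vt(2) e3])
        have "(T a - t) * ?I \<le> (T a - t) * (2 * ?K\<^sup>2 * ((a + (T a - t)) - (a - (T a - t))))"
          using ch3 t' by (intro mult_left_mono) auto
        \<comment> \<open>The section has length \<open>2 * (T a - t)\<close>, so all powers of
          \<open>T a - t\<close> cancel: the weighted energy is scale invariant.\<close>
        also have "\<dots> = 4 * S\<^sup>2"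
        proof -
          have "d * (2 * (S / d)\<^sup>2 * (2 * d)) = 4 * S\<^sup>2" if "d > 0" for d :: real
            using that by (simp add: power2_eq_square)
          from this[of "T a - t"] show ?thesis using t' by simp
        qed
        also have "4 * S\<^sup>2 \<le> 4 * (2 * S + 2)\<^sup>2" using nn by (intro mult_left_mono power_mono) auto
        finally have I: "(T a - t) * ?I \<le> 4 * (2 * S + 2)\<^sup>2" .
        show "L2_on ?J (space_deriv ?J u t) \<and> L2_on ?J (time_deriv ?J ?A u t) \<and>
          (\<forall>x\<in>?J. \<bar>u x t + 2 * ln (T a - t)\<bar> + (T a - t) * ?I \<le> C)"
          using ch1 ch2 order_trans[OF add_mono[OF e1 I] C(3)] by blast
        show "\<forall>x\<in>?J. 1 / C \<le> exp (u x t) * (T a - t)\<^sup>2 \<and> exp (u x t) * (T a - t)\<^sup>2 \<le> C"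
        proof
          fix x assume x: "x \<in> ?J"
          have "exp (u x t + 2 * ln (T a - t)) = exp (u x t) * (T a - t)\<^sup>2"
            using t' by (simp add: exp_add exp_double)
          moreover have "exp (- C0) \<le> exp (u x t + 2 * ln (T a - t))" "exp (u x t + 2 * ln (T a - t)) \<le> exp C0"
            using e1[OF x] by (auto simp: abs_le_iff)
          moreover have "1 / C \<le> exp (- C0)"
            using C(1,2) by (simp add: exp_minus divide_simps)
          ultimately show "1 / C \<le> exp (u x t) * (T a - t)\<^sup>2 \<and> exp (u x t) * (T a - t)\<^sup>2 \<le> C"
            using C(2) by simp
        qed
      qed
      show "(\<forall>s\<ge>- ln (T a) + 1.
          L2_on {-1<..<1} (time_deriv {-1<..<1} {- ln (T a)..} (similarity u T a) s) \<and>
          L2_on {-1<..<1} (space_deriv {-1<..<1} (similarity u T a) s) \<and>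
          (\<forall>y. \<bar>y\<bar> < 1 \<longrightarrow> \<bar>similarity u T a y s\<bar> +
            (LINT z:{-1<..<1}|lebesgue. (time_deriv {-1<..<1} {- ln (T a)..} (similarity u T a) s z)\<^sup>2
              + (space_deriv {-1<..<1} (similarity u T a) s z)\<^sup>2) \<le> C)) \<and>
        (\<forall>t\<in>{0..<T a}. L2_on (section_ivl T a t) (space_deriv (section_ivl T a t) u t) \<and>
          L2_on (section_ivl T a t) (time_deriv (section_ivl T a t) {0..<T a} u t) \<and>
          (\<forall>x\<in>section_ivl T a t. \<bar>u x t + 2 * ln (T a - t)\<bar> + (T a - t) *
            (LINT z:section_ivl T a t|lebesgue. (space_deriv (section_ivl T a t) u t z)\<^sup>2
              + (time_deriv (section_ivl T a t) {0..<T a} u t z)\<^sup>2) \<le> C)) \<and>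
        (\<forall>t\<in>{0..<T a}. \<forall>x\<in>section_ivl T a t. 1 / C \<le> exp (u x t) * (T a - t)\<^sup>2 \<and> exp (u x t) * (T a - t)\<^sup>2 \<le> C)"
        using i ii iii by blast
    qed
  qed
qed

end

theorem theorem2:
  fixes u0 u1 :: "real \<Rightarrow> real"
  assumes "W1inf u0" and "Linf u1"
  shows "\<forall>R>0. \<exists>C>0. \<forall>u. blowup_solution u0 u1 u \<longrightarrow>
    (let T = blowup_time u0 u1 in
     \<forall>a\<in>noncharacteristic u0 u1. (a, T a) \<in> D_trunc R \<longrightarrow>
       (let w = similarity u T a in
        \<forall>s\<ge>- ln (T a) + 1.
          (let ws = time_deriv {-1<..<1} {- ln (T a)..} w s;
               wy = space_deriv {-1<..<1} w s in
           L2_on {-1<..<1} ws \<and> L2_on {-1<..<1} wy \<and>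
           (\<forall>y. \<bar>y\<bar> < 1 \<longrightarrow>
              \<bar>w y s\<bar> + (LINT z:{-1<..<1}|lebesgue. (ws z)\<^sup>2 + (wy z)\<^sup>2) \<le> C))) \<and>
       (\<forall>t\<in>{0..<T a}.
          (let J = section_ivl T a t;
               ux = space_deriv J u t;
               ut = time_deriv J {0..<T a} u t in
           L2_on J ux \<and> L2_on J ut \<and>
           (\<forall>x\<in>J.
              \<bar>u x t + 2 * ln (T a - t)\<bar>
                + (T a - t) * (LINT z:J|lebesgue. (ux z)\<^sup>2 + (ut z)\<^sup>2) \<le> C))) \<and>
       (\<forall>t\<in>{0..<T a}. \<forall>x\<in>section_ivl T a t.
          1 / C \<le> exp (u x t) * (T a - t)\<^sup>2 \<and> exp (u x t) * (T a - t)\<^sup>2 \<le> C))"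
proof -
  \<comment> \<open>The Liouville functions are built from the initial data before \<open>R\<close>,
    \<open>u\<close> and \<open>a\<close> appear, so the constant obtained depends on
    \<open>R\<close> and the data only.\<close>
  obtain f h a1 a2 c1 c2 g1 g2 M where "liouville_wave f h a1 a2 c1 c2 g1 g2 u0 u1 M"
    using liouville_wave_exists[OF assms] by blast
  then interpret liouville_wave f h a1 a2 c1 c2 g1 g2 u0 u1 M .
  show ?thesis using blowup_rate by blast
qed

end
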